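(* There exists $\varepsilon>0$ such that $$\mathbb E\left[\left|\frac{\#\mathcal L^{\max}_\cap(T^k)}{k}-\alpha\right|\right]=O(k^{-\varepsilon})\qquad\text{as }k\to\infty.$$
   Context: A sign-decorated binary tree is a finite planar rooted tree in which every internal vertex (node) has exactly two ordered children and carries a sign $\oplus$ or $\ominus$. A positive subtree is a subtree (induced by a set of leaves, unary vertices contracted) all of whose nodes carry $\oplus$; $\mathrm{LIS}(t)$ is the maximal number of leaves of a positive subtree; $\mathcal L^{\max}_\cap(t)$ is the set of leaves contained in all positive subtrees with $\mathrm{LIS}(t)$ leaves. Fix $p\in(0,1)$. $T$ is a critical binary Bienaymé–Galton–Watson tree with i.i.d. node signs, $\mathbb P(\oplus)=p$, and $T^k$ is $T$ conditioned on $\mathrm{LIS}(T)=k$. $\alpha=\alpha(p)$ is the unique solution in $(1/2,1)$ of $\frac{1}{4^{1/(2\alpha)}\sqrt\pi}\frac{\Gamma(1/2-1/(2\alpha))}{\Gamma(1-1/(2\alpha))}=\frac{p}{p-1}$. *)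

theory Defs
  imports "HOL-Analysis.Analysis" "HOL-Library.Landau_Symbols"
begin

text \<open>Sign-decorated planar binary trees: a node carries a sign
  (True = plus, False = minus) and an ordered pair of children.\<close>
datatype stree = Leaf | Node bool stree stree

fun leaves :: "stree \<Rightarrow> bool list set" where
  "leaves Leaf = {[]}"
| "leaves (Node s l r) = (Cons False) ` leaves l \<union> (Cons True) ` leaves r"

text \<open>Subtree induced by a set of leaves: keep the minimal subtree spanning the
  leaves and contract unary vertices (None = empty subtree).\<close>
fun induced :: "stree \<Rightarrow> bool list set \<Rightarrow> stree option" where
  "induced Leaf S = (if [] \<in> S then Some Leaf else None)"
| "induced (Node s l r) S =
     (case (induced l {xs. False # xs \<in> S}, induced r {xs. True # xs \<in> S}) of
        (None, None) \<Rightarrow> None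
      | (Some a, None) \<Rightarrow> Some a
      | (None, Some b) \<Rightarrow> Some b
      | (Some a, Some b) \<Rightarrow> Some (Node s a b))"

fun all_plus :: "stree \<Rightarrow> bool" where
  "all_plus Leaf = True"
| "all_plus (Node s l r) = (s \<and> all_plus l \<and> all_plus r)"

definition positive_leafset :: "stree \<Rightarrow> bool list set \<Rightarrow> bool" where
  "positive_leafset t S \<longleftrightarrow> S \<subseteq> leaves t \<and> S \<noteq> {} \<and>
     (case induced t S of None \<Rightarrow> False | Some u \<Rightarrow> all_plus u)"

definition LIS :: "stree \<Rightarrow> nat" where
  "LIS t = Max (card ` {S. positive_leafset t S})"

definition Lmax_cap :: "stree \<Rightarrow> bool list set" where
  "Lmax_cap t = leaves t \<inter> \<Inter> {S. positive_leafset t S \<and> card S = LIS t}"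

fun n_plus :: "stree \<Rightarrow> nat" where
  "n_plus Leaf = 0"
| "n_plus (Node s l r) = (if s then 1 else 0) + n_plus l + n_plus r"

fun n_minus :: "stree \<Rightarrow> nat" where
  "n_minus Leaf = 0"
| "n_minus (Node s l r) = (if s then 0 else 1) + n_minus l + n_minus r"

fun n_vertices :: "stree \<Rightarrow> nat" where
  "n_vertices Leaf = 1"
| "n_vertices (Node s l r) = 1 + n_vertices l + n_vertices r"

text \<open>Law of the critical binary BGW tree (offspring 0 or 2, each w.p. 1/2)
  with i.i.d. signs, P(plus) = p:  P(T = t).\<close>
definition bgw_prob :: "real \<Rightarrow> stree \<Rightarrow> real" where
  "bgw_prob p t = (1/2) ^ n_vertices t * p ^ n_plus t * (1 - p) ^ n_minus t"

definition cond_expect :: "real \<Rightarrow> nat \<Rightarrow> (stree \<Rightarrow> real) \<Rightarrow> real" where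
  "cond_expect p k f =
     infsum (\<lambda>t. bgw_prob p t * f t) {t. LIS t = k} /
     infsum (\<lambda>t. bgw_prob p t) {t. LIS t = k}"

definition alpha :: "real \<Rightarrow> real" where
  "alpha p = (THE a. 1/2 < a \<and> a < 1 \<and>
     1 / (4 powr (1 / (2 * a)) * sqrt pi) *
       (Gamma (1/2 - 1 / (2 * a)) / Gamma (1 - 1 / (2 * a))) = p / (p - 1))"

end

theory Submission
  imports Defs "HOL-Real_Asymp.Real_Asymp"
begin

text \<open>
  Write \<open>q k = P(LIS = k)\<close>, \<open>u k = P(LIS > k)\<close>, \<open>\<lambda> = (1 - p) / p\<close>, and let \<open>N\<close> be the number
  of leaves common to all optimal positive subtrees. Splitting at the root gives, for \<open>k \<ge> 1\<close>,
  \<open>\<Sum>i<k. q (k - i) * u i = u k * (1 + \<lambda> * u k)\<close>, so \<open>q (k - i) * u i\<close> is, up to normalisation, the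
  transition kernel of a strictly decreasing Markov chain. Up to an error that is summable in \<open>k\<close>, the
  ratio \<open>\<rho> k = (k + 1) * q (k + 1) / u k\<close> is harmonic for this chain. Elementary bounds show that the
  chain forgets its starting point at a fixed rate per scale and rarely jumps over many scales at
  once; hence the oscillation of \<open>\<rho>\<close> beyond \<open>n\<close> decays like a power of \<open>n\<close>, and \<open>\<rho> k\<close> converges
  polynomially fast to some \<open>\<beta>\<close>. Comparing \<open>u\<close> with the coefficients of \<open>(1 - z) powr (\<beta> - 1)\<close>,
  whose self-convolution is explicit, identifies \<open>\<beta> = 1 / (2 * \<alpha>)\<close>.

  The first moment of \<open>N\<close> is explicit, \<open>E[N; LIS = k + 1] = u k / 2\<close>, so that the conditional mean of
  \<open>N / k\<close> is asymptotically \<open>1 / (2 * \<beta>)\<close>. The second moment satisfies a linear recursion with the same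
  kernel, and a supersolution of the form \<open>(k + 1) powr (1 - \<epsilon>) * u k\<close> bounds the variance.
\<close>

section \<open>Longest positive subtrees\<close>

text \<open>Summed over \<open>k\<close>, the recursion says that \<open>(\<Sum>j\<le>n. u j * u (n
  - j)) + lam * (\<Sum>j\<le>n. (u j)\<^sup>2)\<close> does not depend on \<open>n\<close>. For
  generating functions this mixes an ordinary square with a Hadamard square, so no closed equation
  offers a singularity to analyse; regularity of \<open>u\<close> has to come first, asymptotics
  afterwards. Regularity comes from linearising: taking differences, or weighting by the index (a
  derivation for convolutions), turns the quadratic recursion into one linear recursion with kernel
  \<open>d\<close>, solved exactly by \<open>u\<close> and nearly by
  \<open>x k = (k + 1) * d k\<close>. Hence \<open>rho = x / u\<close> is nearly harmonic. The
  obstacle is that the chain moves slowly: a jump from \<open>k\<close> halves the position only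
  with probability of order \<open>u k\<close>, so no single step minorises uniformly and barrier
  functions have to collect the effect of many steps. A rate for \<open>rho\<close> is needed, not
  only a limit: it makes \<open>u\<close> asymptotic to a constant times a pure power, it controls
  the source in the second-moment recursion, and half of its exponent is the final
  \<epsilon>.\<close>

lemma finite_leaves [simp]: "finite (leaves t)"
  by (induction t) auto

lemma induced_eq_None_iff: "induced t S = None \<longleftrightarrow> S \<inter> leaves t = {}"
proof (induction t arbitrary: S)
  case Leaf
  then show ?case by simp
next
  case (Node s l r)
  have "induced (Node s l r) S = None \<longleftrightarrow>
      induced l {xs. False # xs \<in> S} = None \<and> induced r {xs. True # xs \<in> S} = None"
    by (simp split: option.split)
  also have "\<dots> \<longleftrightarrow> {xs. False # xs \<in> S} \<inter> leaves l = {} \<and> {xs. True # xs \<in> S} \<inter> leaves r = {}"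
    by (simp only: Node.IH)
  also have "\<dots> \<longleftrightarrow> S \<inter> leaves (Node s l r) = {}"
    unfolding disjoint_iff by (simp add: image_iff) blast
  finally show ?case .
qed

text \<open>Leaves are addressed by paths, \<open>False\<close> meaning left; each leaf set of a
  node is the graft of one set per child, which lets the tree recursion act on pairs
  \<open>A\<close>, \<open>B\<close>.\<close>

definition graft :: "bool list set \<Rightarrow> bool list set \<Rightarrow> bool list set" where
  "graft A B = Cons False ` A \<union> Cons True ` B"

lemma Cons_mem_graft [simp]:
  "False # xs \<in> graft A B \<longleftrightarrow> xs \<in> A" "True # xs \<in> graft A B \<longleftrightarrow> xs \<in> B" "[] \<notin> graft A B"
  by (auto simp: graft_def)

lemma graft_subset_leaves: "graft A B \<subseteq> leaves (Node s l r) \<longleftrightarrow> A \<subseteq> leaves l \<and> B \<subseteq> leaves r"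
  by (auto simp: graft_def)

lemma subset_leaves_NodeE:
  assumes "S \<subseteq> leaves (Node s l r)"
  obtains A B where "S = graft A B"
  using assms by (intro that[of "{xs. False # xs \<in> S}" "{xs. True # xs \<in> S}"]) (auto simp: graft_def)

lemma graft_eq_empty: "graft A B = {} \<longleftrightarrow> A = {} \<and> B = {}"
  by (auto simp: graft_def)

lemma card_graft: "finite A \<Longrightarrow> finite B \<Longrightarrow> card (graft A B) = card A + card B"
  unfolding graft_def by (subst card_Un_disjoint) (auto simp: card_image)

lemma positive_leafset_finite: "positive_leafset t S \<Longrightarrow> finite S"
  by (auto simp: positive_leafset_def intro: finite_subset)

lemma positive_leafset_Leaf [simp]: "positive_leafset Leaf S \<longleftrightarrow> S = {[]}"
  by (auto simp: positive_leafset_def)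

text \<open>The root survives in the induced subtree only if both children contribute leaves; with
  one side empty it is unary and contracted, so its sign matters only in the last
  alternative.\<close>

lemma positive_leafset_graft:
  "positive_leafset (Node s l r) (graft A B) \<longleftrightarrow>
    positive_leafset l A \<and> B = {} \<or> A = {} \<and> positive_leafset r B \<or>
    s \<and> positive_leafset l A \<and> positive_leafset r B"
proof -
  have l: "A \<subseteq> leaves l \<Longrightarrow> induced l A = None \<longleftrightarrow> A = {}"
    and r: "B \<subseteq> leaves r \<Longrightarrow> induced r B = None \<longleftrightarrow> B = {}"
    by (auto simp: induced_eq_None_iff)
  show ?thesis
  proof (cases "A \<subseteq> leaves l \<and> B \<subseteq> leaves r")
    case True
    have I: "induced (Node s l r) (graft A B) = (case (induced l A, induced r B) of
        (None, None) \<Rightarrow> None | (Some a, None) \<Rightarrow> Some a | (None, Some b) \<Rightarrow> Some b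
      | (Some a, Some b) \<Rightarrow> Some (Node s a b))"
      by simp
    define a b where "a = induced l A" and "b = induced r B"
    have a: "a = None \<longleftrightarrow> A = {}" and b: "b = None \<longleftrightarrow> B = {}"
      using l r True by (auto simp: a_def b_def)
    have P: "positive_leafset (Node s l r) (graft A B) \<longleftrightarrow> \<not> (A = {} \<and> B = {}) \<and>
        (case (case (a, b) of (None, None) \<Rightarrow> None | (Some a, None) \<Rightarrow> Some a | (None, Some b) \<Rightarrow> Some b
          | (Some a, Some b) \<Rightarrow> Some (Node s a b)) of None \<Rightarrow> False | Some u \<Rightarrow> all_plus u)"
      unfolding positive_leafset_def graft_subset_leaves graft_eq_empty I a_def b_def using True by blast
    have Pl: "positive_leafset l A \<longleftrightarrow> A \<noteq> {} \<and> (case a of None \<Rightarrow> False | Some u \<Rightarrow> all_plus u)"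
      and Pr: "positive_leafset r B \<longleftrightarrow> B \<noteq> {} \<and> (case b of None \<Rightarrow> False | Some u \<Rightarrow> all_plus u)"
      using True by (simp_all add: positive_leafset_def a_def b_def)
    show ?thesis
      unfolding P Pl Pr using a b by (cases a; cases b) auto
  next
    case False
    then show ?thesis unfolding positive_leafset_def graft_subset_leaves by blast
  qed
qed

lemma positive_leafset_ex: "\<exists>S. positive_leafset t S"
proof (induction t)
  case (Node s l r)
  then obtain A where "positive_leafset l A" by blast
  then have "positive_leafset (Node s l r) (graft A {})" by (simp add: positive_leafset_graft)
  then show ?case by blast
qed simp

lemma finite_positive_leafsets: "finite {S. positive_leafset t S}"
  by (rule finite_subset[of _ "Pow (leaves t)"]) (auto simp: positive_leafset_def)

lemma card_le_LIS: "positive_leafset t S \<Longrightarrow> card S \<le> LIS t"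
  unfolding LIS_def using finite_positive_leafsets by (intro Max_ge) auto

definition optimal :: "stree \<Rightarrow> bool list set \<Rightarrow> bool" where
  "optimal t S \<longleftrightarrow> positive_leafset t S \<and> card S = LIS t"

lemma optimal_ex: "\<exists>S. optimal t S"
proof -
  have "LIS t \<in> card ` {S. positive_leafset t S}"
    unfolding LIS_def using finite_positive_leafsets positive_leafset_ex by (intro Max_in) auto
  then show ?thesis by (auto simp: optimal_def)
qed

lemma LIS_eqI:
  assumes "positive_leafset t S" "card S = n" "\<And>S. positive_leafset t S \<Longrightarrow> card S \<le> n"
  shows "LIS t = n"
  using assms card_le_LIS[of t S] optimal_ex[of t] by (force simp: optimal_def)

lemma LIS_pos: "LIS t > 0"
proof -
  obtain S where S: "positive_leafset t S" using positive_leafset_ex by blast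
  then have "S \<noteq> {}" by (simp add: positive_leafset_def)
  then have "card S \<noteq> 0" using positive_leafset_finite[OF S] by simp
  then show ?thesis using card_le_LIS[OF S] by simp
qed

lemma LIS_Leaf [simp]: "LIS Leaf = 1"
  by (rule LIS_eqI[of _ "{[]}"]) auto

lemma card_positive_le:
  assumes "positive_leafset (Node s l r) S"
  shows "card S \<le> (if s then LIS l + LIS r else max (LIS l) (LIS r))"
proof -
  obtain A B where S: "S = graft A B"
    using assms subset_leaves_NodeE[of S s l r] by (auto simp: positive_leafset_def)
  show ?thesis
    using assms positive_leafset_finite[of l A] positive_leafset_finite[of r B] card_le_LIS[of l A] card_le_LIS[of r B]
    unfolding S positive_leafset_graft by (auto simp: card_graft)
qed

lemma LIS_Node [simp]: "LIS (Node s l r) = (if s then LIS l + LIS r else max (LIS l) (LIS r))"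
proof -
  obtain A B where AB: "optimal l A" "optimal r B" using optimal_ex by metis
  then have fin: "finite A" "finite B" using positive_leafset_finite by (auto simp: optimal_def)
  consider "s" | "\<not> s" "LIS l \<le> LIS r" | "\<not> s" "LIS r < LIS l" by fastforce
  then show ?thesis
  proof cases
    case 1
    then show ?thesis using AB fin card_positive_le[of s l r]
      by (intro LIS_eqI[of _ "graft A B"]) (auto simp: positive_leafset_graft card_graft optimal_def)
  next
    case 2
    then show ?thesis using AB fin card_positive_le[of s l r]
      by (intro LIS_eqI[of _ "graft {} B"]) (auto simp: positive_leafset_graft card_graft optimal_def)
  next
    case 3
    then show ?thesis using AB fin card_positive_le[of s l r]
      by (intro LIS_eqI[of _ "graft A {}"]) (auto simp: positive_leafset_graft card_graft optimal_def)
  qed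
qed

text \<open>Since \<open>LIS\<close> is positive on both sides, a one-sided set falls strictly short
  of \<open>LIS l + LIS r\<close>.\<close>

lemma optimal_True: "optimal (Node True l r) (graft A B) \<longleftrightarrow> optimal l A \<and> optimal r B"
  using card_le_LIS[of l A] card_le_LIS[of r B] positive_leafset_finite[of l A] positive_leafset_finite[of r B]
    LIS_pos[of l] LIS_pos[of r]
  by (auto simp: optimal_def positive_leafset_graft card_graft)

lemma optimal_False: "optimal (Node False l r) (graft A B) \<longleftrightarrow>
    optimal l A \<and> B = {} \<and> LIS r \<le> LIS l \<or> A = {} \<and> optimal r B \<and> LIS l \<le> LIS r"
  using card_le_LIS[of l A] card_le_LIS[of r B] positive_leafset_finite[of l A] positive_leafset_finite[of r B]
  by (auto simp: optimal_def positive_leafset_graft card_graft max_def)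

lemma mem_Lmax_cap: "xs \<in> Lmax_cap t \<longleftrightarrow> (\<forall>S. optimal t S \<longrightarrow> xs \<in> S)"
  using optimal_ex[of t] by (auto simp: Lmax_cap_def optimal_def positive_leafset_def)

lemma finite_Lmax_cap: "finite (Lmax_cap t)"
  by (simp add: Lmax_cap_def)

lemma optimal_NodeE:
  assumes "optimal (Node s l r) S"
  obtains A B where "S = graft A B"
  using assms subset_leaves_NodeE[of S s l r] by (auto simp: optimal_def positive_leafset_def)

lemma Lmax_cap_Leaf [simp]: "Lmax_cap Leaf = {[]}"
  by (auto simp: mem_Lmax_cap optimal_def)

lemma Lmax_cap_True: "Lmax_cap (Node True l r) = graft (Lmax_cap l) (Lmax_cap r)"
proof (rule set_eqI)
  fix xs
  have "xs \<in> Lmax_cap (Node True l r) \<longleftrightarrow> (\<forall>A B. optimal l A \<longrightarrow> optimal r B \<longrightarrow> xs \<in> graft A B)"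
    unfolding mem_Lmax_cap by (metis optimal_NodeE optimal_True)
  also have "\<dots> \<longleftrightarrow> xs \<in> graft (Lmax_cap l) (Lmax_cap r)"
    using optimal_ex[of l] optimal_ex[of r]
    by (cases xs; cases "hd xs") (auto simp: mem_Lmax_cap)
  finally show "xs \<in> Lmax_cap (Node True l r) \<longleftrightarrow> xs \<in> graft (Lmax_cap l) (Lmax_cap r)" .
qed

text \<open>At a tie both children supply optimal sets, and those of the left child are disjoint
  from those of the right child, so nothing is common to all.\<close>

lemma Lmax_cap_False: "Lmax_cap (Node False l r) =
  (if LIS l < LIS r then graft {} (Lmax_cap r) else if LIS r < LIS l then graft (Lmax_cap l) {} else {})"
proof (rule set_eqI)
  fix xs
  have "xs \<in> Lmax_cap (Node False l r) \<longleftrightarrow>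
      (\<forall>A. optimal l A \<longrightarrow> LIS r \<le> LIS l \<longrightarrow> xs \<in> graft A {}) \<and>
      (\<forall>B. optimal r B \<longrightarrow> LIS l \<le> LIS r \<longrightarrow> xs \<in> graft {} B)"
    (is "_ \<longleftrightarrow> ?R")
  proof
    assume "xs \<in> Lmax_cap (Node False l r)"
    then have *: "xs \<in> graft A B" if "optimal (Node False l r) (graft A B)" for A B
      using that by (simp add: mem_Lmax_cap)
    show ?R using *[of _ "{}"] *[of "{}"] by (simp add: optimal_False)
  next
    assume R: ?R
    show "xs \<in> Lmax_cap (Node False l r)" unfolding mem_Lmax_cap
    proof (intro allI impI)
      fix S assume S: "optimal (Node False l r) S"
      obtain A B where AB: "S = graft A B" by (rule optimal_NodeE[OF S])
      show "xs \<in> S" using R S unfolding AB optimal_False by blast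
    qed
  qed
  also have "?R \<longleftrightarrow> xs \<in> (if LIS l < LIS r then graft {} (Lmax_cap r)
      else if LIS r < LIS l then graft (Lmax_cap l) {} else {})"
  proof -
    have L: "(\<forall>A. optimal l A \<longrightarrow> xs \<in> graft A {}) \<longleftrightarrow> xs \<in> graft (Lmax_cap l) {}"
      using optimal_ex[of l] by (cases xs; cases "hd xs") (auto simp: mem_Lmax_cap)
    have R: "(\<forall>B. optimal r B \<longrightarrow> xs \<in> graft {} B) \<longleftrightarrow> xs \<in> graft {} (Lmax_cap r)"
      using optimal_ex[of r] by (cases xs; cases "hd xs") (auto simp: mem_Lmax_cap)
    have "\<not> (xs \<in> graft (Lmax_cap l) {} \<and> xs \<in> graft {} (Lmax_cap r))"
      by (auto simp: graft_def)
    then show ?thesis using L R by (cases "LIS l" "LIS r" rule: linorder_cases) auto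
  qed
  finally show "xs \<in> Lmax_cap (Node False l r) \<longleftrightarrow> xs \<in> (if LIS l < LIS r then graft {} (Lmax_cap r)
      else if LIS r < LIS l then graft (Lmax_cap l) {} else {})" .
qed

definition N :: "stree \<Rightarrow> nat" where "N t = card (Lmax_cap t)"

lemma N_simps [simp]:
  "N Leaf = 1"
  "N (Node True l r) = N l + N r"
  "N (Node False l r) = (if LIS l < LIS r then N r else if LIS r < LIS l then N l else 0)"
  by (auto simp: N_def Lmax_cap_True Lmax_cap_False card_graft finite_Lmax_cap)

lemma N_le_LIS: "N t \<le> LIS t"
proof -
  obtain S where "optimal t S" using optimal_ex by blast
  then have "Lmax_cap t \<subseteq> S" "finite S" "card S = LIS t"
    using positive_leafset_finite by (auto simp: mem_Lmax_cap optimal_def)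
  then show ?thesis unfolding N_def by (metis card_mono)
qed

section \<open>The tail recursion\<close>

text \<open>Concavity of the power at 1, obtained from Young's inequality with weights
  \<open>c\<close>, \<open>1 - c\<close> and second factor 1. Source of the discrete power estimates
  below.\<close>

lemma powr_le_tangent:
  fixes y c :: real
  assumes "y \<ge> 0" "0 < c" "c < 1"
  shows "y powr c \<le> 1 + c * (y - 1)"
  using Youngs_inequality_0[of c "1 - c" y 1] assms
  by (cases "y = 0") (auto simp: algebra_simps)

text \<open>Separates the analytic problem from the trees. \<open>rec_Suc\<close> is the root
  decomposition of \<open>LIS = k + 1\<close> divided by \<open>p / 2\<close>: plus gives the
  convolution, minus the difference of squares. In \<open>rec_0\<close> the right-hand side
  \<open>1 + lam = 1 / p\<close> is the one-leaf tree.\<close>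

locale tail_recursion =
  fixes lam :: real and u :: "nat \<Rightarrow> real"
  assumes lam_pos: "lam > 0"
    and u_0: "u 0 = 1"
    and u_pos: "u k > 0"
    and u_decr: "u (Suc k) < u k"
    and rec_0: "2 * (u 0 - u 1) + lam * ((u 0)\<^sup>2 - (u 1)\<^sup>2) = 1 + lam"
    and rec_Suc: "k > 0 \<Longrightarrow> 2 * (u k - u (Suc k)) + lam * ((u k)\<^sup>2 - (u (Suc k))\<^sup>2)
        = (\<Sum>i<k. (u i - u (Suc i)) * (u (k - 1 - i) - u (k - i)))"
begin

definition d :: "nat \<Rightarrow> real" where "d k = u k - u (Suc k)"

definition v :: "nat \<Rightarrow> real" where "v k = u k + lam * (u k)\<^sup>2"

definition x :: "nat \<Rightarrow> real" where "x k = (real k + 1) * d k"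

text \<open>Unnormalised weight of a jump from \<open>k\<close> down to \<open>i\<close>;
  \<open>v k\<close> is its total mass, see \<open>a_sum\<close>. The factor \<open>u i\<close> is
  the h-transform that turns the plain convolution kernel \<open>d\<close> into a Markov
  kernel.\<close>

definition a :: "nat \<Rightarrow> nat \<Rightarrow> real" where "a k i = d (k - 1 - i) * u i"

definition T :: "nat \<Rightarrow> real" where "T k = (\<Sum>i<k. u i)"

lemma d_pos: "d k > 0"
  using u_decr by (simp add: d_def)

lemma u_antimono: "i \<le> j \<Longrightarrow> u j \<le> u i"
  by (rule lift_Suc_antimono_le[of u]) (rule less_imp_le[OF u_decr])

lemma u_le_1: "u k \<le> 1"
  using u_antimono[of 0 k] u_0 by simp

lemma d_le_u: "d k \<le> u k"
  using u_pos[of "Suc k"] by (simp add: d_def)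

lemma x_pos: "x k > 0"
  using d_pos by (simp add: x_def)

lemma v_pos: "v k > 0"
  unfolding v_def by (intro add_pos_nonneg mult_nonneg_nonneg) (auto simp: u_pos lam_pos less_imp_le)

lemma a_pos: "a k i > 0"
  using d_pos u_pos by (simp add: a_def)

lemma v_eq: "v k = u k * (1 + lam * u k)"
  by (simp add: v_def algebra_simps power2_eq_square)

lemma conv_d: "k > 0 \<Longrightarrow> 2 * d k + lam * ((u k)\<^sup>2 - (u (Suc k))\<^sup>2) = (\<Sum>i<k. d i * d (k - 1 - i))"
  using rec_Suc[of k] by (simp add: d_def Suc_diff_Suc)

text \<open>As \<open>d\<close> is the difference sequence of \<open>u\<close>, passing to the next
  index changes the sum by \<open>d (Suc k)\<close> minus a self-convolution of \<open>d\<close>,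
  which the recursion evaluates; the increments telescope to \<open>v\<close>, with
  \<open>rec_0\<close> as base.\<close>

lemma a_sum_aux: "(\<Sum>i<Suc k. d (k - i) * u i) = v (Suc k)"
proof (induction k)
  case 0
  have "(1 + lam) = 2 * (1 - u 1) + lam * (1 - (u 1)\<^sup>2)" using rec_0 u_0 by simp
  then show ?case by (simp add: u_0 v_def d_def algebra_simps)
next
  case (Suc k)
  have "(\<Sum>i<Suc (Suc k). d (Suc k - i) * u i) = d (Suc k) + (\<Sum>i<Suc k. d (k - i) * u (Suc i))"
    by (subst sum.lessThan_Suc_shift) (simp add: u_0)
  also have "(\<Sum>i<Suc k. d (k - i) * u (Suc i)) = (\<Sum>i<Suc k. d (k - i) * u i) - (\<Sum>i<Suc k. d i * d (k - i))"
    by (subst sum_subtractf[symmetric], intro sum.cong refl) (simp add: d_def[of "_::nat"] algebra_simps)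
  also have "(\<Sum>i<Suc k. d i * d (k - i)) = 2 * d (Suc k) + lam * ((u (Suc k))\<^sup>2 - (u (Suc (Suc k)))\<^sup>2)"
    using conv_d[of "Suc k"] by simp
  finally show ?case using Suc by (simp add: v_def d_def algebra_simps)
qed

lemma a_sum: "k > 0 \<Longrightarrow> (\<Sum>i<k. a k i) = v k"
  using a_sum_aux[of "k - 1"] by (simp add: a_def)

text \<open>The index weight is additive along the convolution,
  \<open>(i + 1) + (k - i) = k + 1\<close>, so multiplying the recursion by \<open>k + 1\<close>
  symmetrises into twice a linear convolution. The last summand is the quadratic error left by
  \<open>(u k)\<^sup>2 - (u (Suc k))\<^sup>2 = d k * (2 * u k - d k)\<close>.\<close>

lemma x_rec:
  assumes "k > 0"
  shows "x k * (1 + lam * u k) = (\<Sum>i<k. d (k - 1 - i) * x i) + lam / 2 * x k * d k"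
proof -
  let ?S = "\<Sum>i<k. d (k - 1 - i) * x i"
  have "?S = (\<Sum>i<k. d i * x (k - 1 - i))"
    by (rule sum.reindex_bij_witness[of _ "\<lambda>i. k - 1 - i" "\<lambda>i. k - 1 - i"]) auto
  then have "2 * ?S = (\<Sum>i<k. d (k - 1 - i) * x i + d i * x (k - 1 - i))"
    by (simp add: sum.distrib)
  also have "\<dots> = (\<Sum>i<k. (real k + 1) * (d i * d (k - 1 - i)))"
    by (intro sum.cong refl) (auto simp: x_def algebra_simps of_nat_diff)
  also have "\<dots> = (real k + 1) * (2 * d k + lam * ((u k)\<^sup>2 - (u (Suc k))\<^sup>2))"
    using conv_d[OF assms] by (simp add: sum_distrib_left)
  also have "\<dots> = 2 * x k + lam * (x k * (2 * u k - d k))"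
    by (simp add: x_def d_def algebra_simps power2_eq_square)
  finally show ?thesis by (simp add: algebra_simps)
qed

text \<open>By \<open>a_sum\<close>, \<open>u\<close> solves the same linear recursion as
  \<open>x\<close> without the positive source term, so the comparison at \<open>k = 0\<close>
  propagates.\<close>

lemma x_lower: "d 0 * u k \<le> x k"
proof (induction k rule: less_induct)
  case (less k)
  show ?case
  proof (cases "k = 0")
    case True
    then show ?thesis by (simp add: x_def u_0)
  next
    case False
    have "d 0 * u k * (1 + lam * u k) = d 0 * (\<Sum>i<k. a k i)"
      using a_sum[of k] False by (simp add: v_eq)
    also have "\<dots> = (\<Sum>i<k. d (k - 1 - i) * (d 0 * u i))"
      by (simp add: a_def sum_distrib_left mult_ac)
    also have "\<dots> \<le> (\<Sum>i<k. d (k - 1 - i) * x i)"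
      using less d_pos by (intro sum_mono mult_left_mono) (auto intro: less_imp_le)
    also have "\<dots> \<le> x k * (1 + lam * u k)"
      using x_rec[of k] False lam_pos x_pos[of k] d_pos[of k] by simp
    finally show ?thesis
      using lam_pos u_pos[of k] by (simp add: add_pos_pos)
  qed
qed

text \<open>Here the source works against the bound. It costs a factor of at most
  \<open>exp (lam / 2 * d k)\<close> at step \<open>k\<close>, and these factors have a bounded
  product because the sum of \<open>d\<close> telescopes to at most 1.\<close>

lemma x_upper_aux: "x k \<le> exp (lam / 2 * (1 - u (Suc k))) * u k"
proof (induction k rule: less_induct)
  case (less k)
  show ?case
  proof (cases "k = 0")
    case True
    have "d 0 \<le> 1" using d_le_u[of 0] u_0 by simp
    also have "1 \<le> exp (lam / 2 * (1 - u (Suc 0)))" using lam_pos u_le_1[of 1] by simp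
    finally show ?thesis using True by (simp add: x_def u_0)
  next
    case False
    define b where "b = exp (lam / 2 * (1 - u k))"
    have "x k * (1 + lam * u k - lam / 2 * d k) = (\<Sum>i<k. d (k - 1 - i) * x i)"
      using x_rec[of k] False by (simp add: algebra_simps)
    also have "\<dots> \<le> (\<Sum>i<k. d (k - 1 - i) * (b * u i))"
    proof (intro sum_mono mult_left_mono)
      fix i assume i: "i \<in> {..<k}"
      have "x i \<le> exp (lam / 2 * (1 - u (Suc i))) * u i" using less i by auto
      also have "\<dots> \<le> b * u i" unfolding b_def
        using lam_pos u_pos[of i] u_antimono[of "Suc i" k] i
        by (intro mult_right_mono) auto
      finally show "x i \<le> b * u i" .
    qed (auto intro: less_imp_le d_pos)
    also have "\<dots> = b * (\<Sum>i<k. a k i)"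
      by (simp add: a_def sum_distrib_left mult_ac)
    also have "\<dots> = b * (u k * (1 + lam * u k))"
      using a_sum[of k] False by (simp add: v_eq)
    finally have 1: "x k * (1 + lam * u k - lam / 2 * d k) \<le> b * (u k * (1 + lam * u k))" .
    have D: "1 + lam * u k - lam / 2 * d k \<ge> 1"
      using d_le_u[of k] lam_pos d_pos[of k] u_pos[of k] by (simp add: algebra_simps)
    \<comment> \<open>Moving the source to the left leaves
      \<open>1 + lam * u k - lam / 2 * d k\<close>, which is still at least 1; this lets the missing
      \<open>lam / 2 * d k\<close> be written as a relative error.\<close>
    have "1 + lam * u k \<le> (1 + lam / 2 * d k) * (1 + lam * u k - lam / 2 * d k)"
    proof -
      have "lam / 2 * d k * 1 \<le> lam / 2 * d k * (1 + lam * u k - lam / 2 * d k)"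
        using D lam_pos d_pos[of k] by (intro mult_left_mono) auto
      then show ?thesis by (simp add: algebra_simps)
    qed
    also have "\<dots> \<le> exp (lam / 2 * d k) * (1 + lam * u k - lam / 2 * d k)"
      using D by (intro mult_right_mono) auto
    finally have 2: "1 + lam * u k \<le> exp (lam / 2 * d k) * (1 + lam * u k - lam / 2 * d k)" .
    have "x k * (1 + lam * u k - lam / 2 * d k) \<le> b * (u k * (exp (lam / 2 * d k) * (1 + lam * u k - lam / 2 * d k)))"
      using 1 2 u_pos[of k] by (smt (verit) b_def exp_gt_zero mult_left_mono)
    also have "\<dots> = (b * exp (lam / 2 * d k) * u k) * (1 + lam * u k - lam / 2 * d k)"
      by (simp add: mult_ac)
    finally have "x k \<le> b * exp (lam / 2 * d k) * u k" using D by simp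
    also have "b * exp (lam / 2 * d k) = exp (lam / 2 * (1 - u (Suc k)))"
      unfolding b_def exp_add[symmetric] by (simp add: d_def algebra_simps add_divide_distrib diff_divide_distrib)
    finally show ?thesis .
  qed
qed

abbreviation "K_step \<equiv> exp (lam / 2)"

lemma x_upper: "x k \<le> K_step * u k"
proof -
  have "lam / 2 * (1 - u (Suc k)) \<le> lam / 2 * 1"
    using lam_pos u_pos[of "Suc k"] by (intro mult_left_mono) auto
  then have "exp (lam / 2 * (1 - u (Suc k))) * u k \<le> K_step * u k"
    using u_pos[of k] by (intro mult_right_mono) auto
  then show ?thesis using x_upper_aux[of k] by linarith
qed

lemma d0_less_1: "d 0 < 1"
  using u_pos[of 1] u_0 by (simp add: d_def)

text \<open>If \<open>u\<close> loses at least the fraction \<open>e = c / (k + 1)\<close> in a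
  step, the power gains at most the factor \<open>1 + e\<close>, and
  \<open>(1 + e) * (1 - e) \<le> 1\<close>.\<close>

lemma u_powr_step:
  assumes c: "0 < c" "c < 1" "c * u k \<le> x k"
  shows "(real k + 2) powr c * u (Suc k) \<le> (real k + 1) powr c * u k"
proof -
  define e where "e = c / (real k + 1)"
  have e: "0 < e" "e < 1" using c by (auto simp: e_def divide_less_eq)
  have "u (Suc k) = u k - x k / (real k + 1)"
    by (simp add: x_def d_def)
  also have "\<dots> \<le> u k - c * u k / (real k + 1)"
    using c by (simp add: divide_right_mono)
  also have "\<dots> = u k * (1 - e)" by (simp add: algebra_simps e_def)
  finally have 1: "u (Suc k) \<le> u k * (1 - e)" .
  have "(real k + 2) powr c = (real k + 1) powr c * (1 + 1 / (real k + 1)) powr c"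
  proof -
    have "real k + 2 = (real k + 1) * (1 + 1 / (real k + 1))" by (simp add: field_simps)
    then show ?thesis by (simp only: powr_mult[symmetric])
  qed
  also have "(1 + 1 / (real k + 1)) powr c \<le> 1 + e"
    using powr_le_tangent[of "1 + 1 / (real k + 1)" c] c by (simp add: e_def)
  finally have 2: "(real k + 2) powr c \<le> (real k + 1) powr c * (1 + e)"
    by (simp add: mult_left_mono)
  have "(real k + 2) powr c * u (Suc k) \<le> (real k + 2) powr c * (u k * (1 - e))"
    using 1 by (intro mult_left_mono) auto
  also have "\<dots> \<le> (real k + 1) powr c * (1 + e) * (u k * (1 - e))"
    using 2 u_pos[of k] e by (intro mult_right_mono mult_nonneg_nonneg) (auto simp: less_imp_le)
  also have "\<dots> = (real k + 1) powr c * u k * (1 - e\<^sup>2)"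
    by (simp add: algebra_simps power2_eq_square)
  also have "\<dots> \<le> (real k + 1) powr c * u k * 1"
    using u_pos[of k] by (intro mult_left_mono) auto
  finally show ?thesis by simp
qed

lemma u_powr_antimono: "i \<le> j \<Longrightarrow> (real j + 1) powr d 0 * u j \<le> (real i + 1) powr d 0 * u i"
proof (induction j)
  case (Suc j)
  show ?case
  proof (cases "i = Suc j")
    case False
    then have "(real j + 1) powr d 0 * u j \<le> (real i + 1) powr d 0 * u i" using Suc by simp
    moreover have "real (Suc j) + 1 = real j + 2" by simp
    ultimately show ?thesis
      using u_powr_step[OF d_pos d0_less_1 x_lower, of j] by (simp only:)
  qed simp
qed simp

lemma u_decay: "u k \<le> (real k + 1) powr (- d 0)"
  using u_powr_antimono[of 0 k] u_0 by (simp add: powr_minus_divide pos_le_divide_eq mult.commute)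

section \<open>Downward drift of the kernel and regularity of \<open>u\<close>\<close>

definition K_drift :: real where "K_drift = 2 * (1 + lam) / d 0"

definition K_sum :: real where "K_sum = K_drift / d 0"

lemma K_drift_ge_1: "K_drift \<ge> 1"
  using d_pos[of 0] d0_less_1 lam_pos by (simp add: K_drift_def)

lemma K_sum_ge_1: "K_sum \<ge> 1"
  using K_drift_ge_1 d_pos[of 0] d0_less_1 by (simp add: K_sum_def)

text \<open>Monotonicity of \<open>(k + 1) powr d 0 * u k\<close> bounds \<open>u k / u i\<close> by
  a power of \<open>(i + 1) / (k + 1)\<close>; the tangent of that power makes the bound linear in
  \<open>k - i\<close>, as needed for a mean step.\<close>

lemma u_diff_lower:
  assumes "i \<le> k"
  shows "d 0 * real (k - i) / (real k + 1) * u i \<le> u i - u k"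
proof -
  have c: "0 < d 0" "d 0 < 1" using d_pos d0_less_1 by auto
  define y where "y = (real i + 1) / (real k + 1)"
  have y: "y > 0" by (simp add: y_def)
  have "u k \<le> y powr d 0 * u i"
    using u_powr_antimono[OF assms] by (simp add: y_def powr_divide field_simps)
  also have "\<dots> \<le> (1 + d 0 * (y - 1)) * u i"
    using powr_le_tangent[of y "d 0"] y c u_pos[of i] by (intro mult_right_mono) auto
  also have "y - 1 = - (real (k - i) / (real k + 1))"
    using assms by (simp add: y_def field_simps of_nat_diff)
  finally show ?thesis by (simp add: algebra_simps)
qed

text \<open>The mean downward step of the kernel \<open>a\<close>: the recursion for \<open>u\<close> also evaluates
  \<open>\<Sum>i<k. d (k - 1 - i) * (u i - u k)\<close> exactly, and regular decrease of \<open>u\<close> compares the two.\<close>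
lemma a_drift:
  assumes "k > 0"
  shows "(\<Sum>i<k. a k i * real (k - i)) \<le> K_drift * real k * (u k)\<^sup>2"
proof -
  have c: "0 < d 0" using d_pos by auto
  have tele: "(\<Sum>i<k. d (k - 1 - i)) = 1 - u k"
  proof -
    have "(\<Sum>i<k. d (k - 1 - i)) = (\<Sum>i<k. d i)"
      by (rule sum.reindex_bij_witness[of _ "\<lambda>i. k - 1 - i" "\<lambda>i. k - 1 - i"]) auto
    also have "\<dots> = u 0 - u k" unfolding d_def by (rule sum_lessThan_telescope')
    finally show ?thesis by (simp add: u_0)
  qed
  have "d 0 / (real k + 1) * (\<Sum>i<k. a k i * real (k - i))
      = (\<Sum>i<k. d (k - 1 - i) * (d 0 * real (k - i) / (real k + 1) * u i))"
    by (simp add: a_def sum_distrib_left mult_ac)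
  also have "\<dots> \<le> (\<Sum>i<k. d (k - 1 - i) * (u i - u k))"
    using u_diff_lower d_pos by (intro sum_mono mult_left_mono) (auto intro: less_imp_le)
  also have "\<dots> = (\<Sum>i<k. a k i) - u k * (\<Sum>i<k. d (k - 1 - i))"
    by (simp add: a_def sum_subtractf sum_distrib_left algebra_simps)
  also have "\<dots> = (1 + lam) * (u k)\<^sup>2"
    unfolding tele a_sum[OF assms] by (simp add: v_def algebra_simps power2_eq_square)
  finally have "(\<Sum>i<k. a k i * real (k - i)) \<le> (1 + lam) * (u k)\<^sup>2 * (real k + 1) / d 0"
    using c by (simp add: field_simps)
  also have "\<dots> \<le> (1 + lam) * (u k)\<^sup>2 * (2 * real k) / d 0"
    using c lam_pos assms by (intro divide_right_mono mult_left_mono) auto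
  also have "\<dots> = K_drift * real k * (u k)\<^sup>2" unfolding K_drift_def by simp
  finally show ?thesis .
qed

text \<open>The jump length times its weight \<open>d\<close> is exactly \<open>x\<close>, so the
  mean step is a convolution of \<open>x\<close> with \<open>u\<close>, to which
  \<open>x_lower\<close> applies.\<close>

lemma a_drift_x: "k > 0 \<Longrightarrow> (\<Sum>i<k. x i * u (k - 1 - i)) \<le> K_drift * real k * (u k)\<^sup>2"
proof -
  assume k: "k > 0"
  have "(\<Sum>i<k. x i * u (k - 1 - i)) = (\<Sum>i<k. x (k - 1 - i) * u i)"
    by (rule sum.reindex_bij_witness[of _ "\<lambda>i. k - 1 - i" "\<lambda>i. k - 1 - i"]) auto
  also have "\<dots> = (\<Sum>i<k. a k i * real (k - i))"
    by (intro sum.cong refl) (auto simp: x_def a_def of_nat_diff)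
  finally show ?thesis using a_drift[OF k] by simp
qed

text \<open>A converse to \<open>T_lower'\<close>: the drift bound prevents the mass of
  \<open>u\<close> from concentrating on small indices. It is the quantitative precursor of
  \<open>beta < 1\<close>.\<close>

lemma T_upper:
  assumes "k > 0"
  shows "T k \<le> K_sum * real k * u k"
proof -
  have c: "0 < d 0" using d_pos by auto
  have "d 0 * u k * T k = (\<Sum>i<k. d 0 * u i * u k)"
    by (simp add: T_def sum_distrib_left mult_ac)
  also have "\<dots> \<le> (\<Sum>i<k. x i * u (k - 1 - i))"
    using x_lower u_pos x_pos c by (intro sum_mono mult_mono u_antimono) (auto intro: less_imp_le)
  also have "\<dots> \<le> K_drift * real k * (u k)\<^sup>2" by (rule a_drift_x[OF assms])
  finally have "u k * (d 0 * T k) \<le> u k * (K_drift * real k * u k)"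
    by (simp add: power2_eq_square mult_ac)
  then have "d 0 * T k \<le> K_drift * real k * u k" using u_pos[of k] by simp
  then show ?thesis using c by (simp add: K_sum_def field_simps)
qed

lemma T_Suc: "T (Suc k) = T k + u k"
  by (simp add: T_def)

lemma T_mono: "i \<le> j \<Longrightarrow> T i \<le> T j"
  unfolding T_def by (intro sum_mono2) (auto intro: less_imp_le u_pos)

lemma T_nonneg: "T k \<ge> 0"
  unfolding T_def by (intro sum_nonneg) (auto intro: less_imp_le u_pos)

lemma T_lower: "real k * u (k - 1) \<le> T k"
proof -
  have "(\<Sum>i<k. u (k - 1)) \<le> T k"
    unfolding T_def by (intro sum_mono u_antimono) auto
  then show ?thesis by simp
qed

lemma T_lower': "real k * u k \<le> T k"
  using T_lower[of k] u_antimono[of "k - 1" k] mult_left_mono[of "u k" "u (k - 1)" "real k"] by simp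

lemma u_le_shift:
  assumes "j < k"
  shows "u j \<le> K_sum * real k / (real j + 1) * u k"
proof -
  have "(real j + 1) * u j \<le> T (Suc j)" using T_lower[of "Suc j"] by (simp add: add.commute)
  also have "\<dots> \<le> T k" using assms by (intro T_mono) auto
  also have "\<dots> \<le> K_sum * real k * u k" using assms by (intro T_upper) auto
  finally show ?thesis by (simp add: field_simps)
qed

section \<open>Comparison of the kernel with the product \<open>u k / k * u i\<close>\<close>

definition K_kernel :: real where "K_kernel = 4 * K_step * K_sum"

lemma K_kernel_ge_1: "K_kernel \<ge> 1"
proof -
  have "1 * 1 \<le> (4 * K_step) * K_sum"
    using K_sum_ge_1 lam_pos one_le_exp_iff[of "lam / 2"] by (intro mult_mono) linarith+
  then show ?thesis by (simp add: K_kernel_def)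
qed

lemma d_upper: "d k \<le> K_step * u k / (real k + 1)"
  using x_upper[of k] by (simp add: x_def field_simps)

lemma d_lower: "d 0 * u k / (real k + 1) \<le> d k"
  using x_lower[of k] by (simp add: x_def field_simps)

text \<open>Together with \<open>a_upper\<close> this says that, up to constants, a long jump from
  any \<open>k\<close> lands according to the one measure \<open>u i\<close>, whatever the starting
  point. The minorisation exploits this loss of memory.\<close>

lemma a_lower:
  assumes "i < k"
  shows "d 0 * u k / real k * u i \<le> a k i"
proof -
  have "d 0 * u k / real k \<le> d 0 * u (k - 1 - i) / (real (k - 1 - i) + 1)"
    using assms d_pos[of 0] u_pos[of k]
    by (intro frac_le mult_left_mono u_antimono mult_nonneg_nonneg) (auto simp: less_imp_le u_pos)
  also have "\<dots> \<le> d (k - 1 - i)" by (rule d_lower)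
  finally show ?thesis unfolding a_def using u_pos[of i] by (intro mult_right_mono) auto
qed

lemma a_upper:
  assumes "i < k" "2 * i \<le> k"
  shows "a k i \<le> K_kernel * u k / real k * u i"
proof -
  define j where "j = k - 1 - i"
  have j: "j < k" "real k \<le> 2 * (real j + 1)" using assms by (auto simp: j_def of_nat_diff)
  have 1: "real k / (real j + 1) \<le> 2" using j by (simp add: divide_le_eq)
  have "u j \<le> K_sum * real k / (real j + 1) * u k" by (rule u_le_shift[OF j(1)])
  also have "\<dots> = K_sum * u k * (real k / (real j + 1))" by simp
  also have "\<dots> \<le> K_sum * u k * 2"
    using 1 K_sum_ge_1 u_pos[of k] by (intro mult_left_mono) auto
  finally have 2: "u j \<le> 2 * K_sum * u k" by simp
  have "d j \<le> K_step * u j / (real j + 1)" by (rule d_upper)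
  \<comment> \<open>One factor 2 comes from the bound on \<open>u j\<close>, the other from the
    denominator; hence the 4 in \<open>K_kernel\<close>.\<close>
  also have "\<dots> \<le> K_step * (2 * K_sum * u k) / (real k / 2)"
    using 2 j u_pos[of k] K_sum_ge_1 by (intro frac_le mult_left_mono mult_nonneg_nonneg) auto
  also have "\<dots> = K_kernel * u k / real k" by (simp add: K_kernel_def)
  finally show ?thesis unfolding a_def j_def using u_pos[of i] by (intro mult_right_mono) auto
qed

end

section \<open>Doeblin minorisation and overshoot\<close>

lemma sum_powr_le:
  assumes "0 < s" "s < 1"
  shows "(\<Sum>i<m. (real i + 1) powr (s - 1)) \<le> real m powr s / s"
proof (induction m)
  case (Suc m)
  have "(real m) powr s = (real m + 1) powr s * (real m / (real m + 1)) powr s"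
    by (subst powr_mult[symmetric]) auto
  also have "\<dots> \<le> (real m + 1) powr s * (1 + s * (real m / (real m + 1) - 1))"
    using assms by (intro mult_left_mono powr_le_tangent) auto
  also have "real m / (real m + 1) - 1 = - (1 / (real m + 1))" by (simp add: field_simps)
  finally have "real m powr s \<le> (real m + 1) powr s - s * ((real m + 1) powr s / (real m + 1))"
    by (simp add: algebra_simps)
  also have "(real m + 1) powr s / (real m + 1) = (real m + 1) powr (s - 1)"
    by (simp add: powr_diff)
  finally show ?case using Suc assms by (simp add: field_simps add.commute)
qed simp

context tail_recursion
begin

text \<open>\<open>T_upper\<close> bounds the relative growth \<open>u k / T k\<close> below by
  \<open>1 / (K_sum * k)\<close>, so \<open>T\<close> grows at least like a power; half that
  exponent is taken, which keeps it away from 1.\<close>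

definition eta :: real where "eta = 1 / (2 * K_sum)"

lemma eta: "0 < eta" "eta \<le> 1 / 2"
  using K_sum_ge_1 by (auto simp: eta_def field_simps)

lemma T_powr_step:
  assumes "k > 0"
  shows "T k * (real k + 1) powr eta \<le> T (Suc k) * real k powr eta"
proof -
  have "T k \<le> K_sum * real k * u k" by (rule T_upper[OF assms])
  also have "\<dots> \<le> 2 * (K_sum * real k * u k)" using K_sum_ge_1 u_pos[of k] by simp
  finally have "T k \<le> 2 * (K_sum * real k * u k)" .
  then have "T k * (1 + eta / real k) \<le> T k + u k"
    using assms K_sum_ge_1 u_pos[of k] by (simp add: eta_def field_simps)
  then have 1: "T k * (1 + eta / real k) \<le> T (Suc k)" by (simp add: T_Suc)
  have "(real k + 1) powr eta = real k powr eta * (1 + 1 / real k) powr eta"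
  proof -
    have "real k + 1 = real k * (1 + 1 / real k)" using assms by (simp add: field_simps)
    then show ?thesis by (simp only: powr_mult[symmetric])
  qed
  also have "(1 + 1 / real k) powr eta \<le> 1 + eta / real k"
    using powr_le_tangent[of "1 + 1 / real k" eta] eta by simp
  finally have "(real k + 1) powr eta \<le> real k powr eta * (1 + eta / real k)"
    by (simp add: mult_left_mono)
  then have "T k * (real k + 1) powr eta \<le> T k * (real k powr eta * (1 + eta / real k))"
    using T_nonneg by (rule mult_left_mono)
  also have "\<dots> = (T k * (1 + eta / real k)) * real k powr eta" by simp
  also have "\<dots> \<le> T (Suc k) * real k powr eta" using 1 by (intro mult_right_mono) auto
  finally show ?thesis .
qed

lemma T_powr:
  assumes "0 < i" "i \<le> j"
  shows "T i \<le> (real i / real j) powr eta * T j"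
  using assms(2)
proof (induction j rule: dec_induct)
  case base
  then show ?case using assms by simp
next
  case (step j)
  then have j: "j > 0" using assms by simp
  have "T i \<le> (real i / real j) powr eta * T j" by (rule step.IH)
  also have "\<dots> = (real i / (real j + 1)) powr eta * (T j * (real j + 1) powr eta) / real j powr eta"
    using j assms by (simp add: powr_divide)
  also have "\<dots> \<le> (real i / (real j + 1)) powr eta * (T (Suc j) * real j powr eta) / real j powr eta"
    using T_powr_step[OF j] by (intro divide_right_mono mult_left_mono) auto
  also have "\<dots> = (real i / real (Suc j)) powr eta * T (Suc j)" using j by (simp add: add.commute)
  finally show ?case .
qed

text \<open>The growth of \<open>T\<close> makes \<open>u i\<close> at most
  \<open>T n * ((i + 1) / n) powr eta / (i + 1)\<close>, so a singular weight of exponent at most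
  \<open>eta / 2\<close> leaves at least \<open>eta / 2\<close> for the decay in
  \<open>m / n\<close>.\<close>

lemma u_weighted_sum:
  assumes "0 < e" "e \<le> eta / 2" "m \<le> n" "0 < n"
  shows "(\<Sum>i<m. u i * (real n / (real i + 1)) powr e) \<le> 2 / eta * (real m / real n) powr (eta / 2) * T n"
proof -
  define s where "s = eta - e"
  have s: "eta / 2 \<le> s" "0 < s" "s < 1" using assms eta by (auto simp: s_def)
  have n: "real n > 0" using assms by simp
  have "(\<Sum>i<m. u i * (real n / (real i + 1)) powr e)
      \<le> (\<Sum>i<m. T n * real n powr (- s) * (real i + 1) powr (s - 1))"
  proof (intro sum_mono)
    fix i assume i: "i \<in> {..<m}"
    have "u i * (real i + 1) \<le> T (Suc i)" using T_lower[of "Suc i"] by (simp add: mult.commute add.commute)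
    also have "\<dots> \<le> (real (Suc i) / real n) powr eta * T n"
      using i assms by (intro T_powr) auto
    finally have "u i \<le> ((real i + 1) / real n) powr eta * T n / (real i + 1)"
      by (simp add: pos_le_divide_eq add.commute)
    then have "u i * (real n / (real i + 1)) powr e
        \<le> ((real i + 1) / real n) powr eta * T n / (real i + 1) * (real n / (real i + 1)) powr e"
      by (intro mult_right_mono) auto
    also have "\<dots> = T n * real n powr (- s) * (real i + 1) powr (s - 1)"
      using n by (simp add: powr_divide s_def powr_diff powr_minus divide_simps)
    finally show "u i * (real n / (real i + 1)) powr e \<le> T n * real n powr (- s) * (real i + 1) powr (s - 1)" .
  qed
  also have "\<dots> = T n * real n powr (- s) * (\<Sum>i<m. (real i + 1) powr (s - 1))"
    by (simp add: sum_distrib_left)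
  also have "\<dots> \<le> T n * real n powr (- s) * (real m powr s / s)"
    using s T_nonneg by (intro mult_left_mono sum_powr_le mult_nonneg_nonneg) auto
  also have "\<dots> = T n * ((real m / real n) powr s / s)"
    using n by (simp add: powr_divide powr_minus divide_simps)
  also have "\<dots> \<le> T n * ((real m / real n) powr (eta / 2) / (eta / 2))"
    using s T_nonneg eta assms by (intro mult_left_mono frac_le powr_mono') auto
  finally show ?thesis by (simp add: mult_ac)
qed

text \<open>The inequality is required only above \<open>n\<close>: values at indices up to
  \<open>n\<close> serve as boundary data where the chain is stopped.\<close>

definition superharm :: "nat \<Rightarrow> (nat \<Rightarrow> real) \<Rightarrow> bool" where
  "superharm n f \<longleftrightarrow> (\<forall>k>n. (\<Sum>i<k. a k i * f i) \<le> v k * f k)"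

lemma superharm_nonneg:
  assumes "superharm n f" "\<And>i. i \<le> n \<Longrightarrow> f i \<ge> 0"
  shows "f k \<ge> 0"
proof (induction k rule: less_induct)
  case (less k)
  show ?case
  proof (cases "k \<le> n")
    case False
    have "0 \<le> (\<Sum>i<k. a k i * f i)"
      using less a_pos by (intro sum_nonneg mult_nonneg_nonneg) (auto intro: less_imp_le)
    also have "\<dots> \<le> v k * f k" using assms(1) False by (auto simp: superharm_def)
    finally show ?thesis using v_pos[of k] by (simp add: zero_le_mult_iff)
  qed (use assms in auto)
qed

text \<open>The 20 leaves room for \<open>(j / n)\<^sup>2 \<le> 16\<close> on the range
  \<open>j \<le> 4 * n\<close>, where the drift is set against the mass entering
  \<open>{..n}\<close>.\<close>

definition c_near :: real where "c_near = d 0 / (20 * K_drift)"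

lemma c_near: "0 < c_near" using d_pos[of 0] K_drift_ge_1 by (simp add: c_near_def)

text \<open>Just above \<open>n\<close> the chain makes mostly short steps, so the chance of jumping
  into the bulk of \<open>{..n}\<close> must be collected over many of them. A barrier proportional
  to \<open>j - n\<close> does so: by \<open>a_drift\<close> the kernel lowers it by at most order
  \<open>g * (u j)\<^sup>2\<close>, and the direct entries into \<open>{..n}\<close> repay
  that.\<close>

lemma doeblin_near:
  assumes sup: "superharm n f" and nonneg: "\<And>i. i \<le> n \<Longrightarrow> f i \<ge> 0" and n: "n > 0"
    and j: "n < j" "j \<le> 4 * n"
  defines "g \<equiv> (\<Sum>i\<le>n. f i) / real n"
  shows "c_near * g * (real j - real n) / real n \<le> f j"
  using j
proof (induction j rule: less_induct)
  case (less j)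
  have g: "g \<ge> 0" unfolding g_def using nonneg by (intro divide_nonneg_nonneg sum_nonneg) auto
  define b where "b = c_near * g / real n"
  have b: "b \<ge> 0" using g c_near by (simp add: b_def)
  have jpos: "real j > 0" using less by simp
  have "(\<Sum>i\<le>n. d 0 * (u j)\<^sup>2 / real j * f i) \<le> (\<Sum>i\<le>n. a j i * f i)"
  proof (intro sum_mono mult_right_mono nonneg)
    fix i assume i: "i \<in> {..n}"
    have "d 0 * (u j)\<^sup>2 / real j = d 0 * u j / real j * u j" by (simp add: power2_eq_square)
    also have "\<dots> \<le> d 0 * u j / real j * u i"
      using i less d_pos[of 0] u_pos[of j] by (intro mult_left_mono u_antimono) auto
    also have "\<dots> \<le> a j i" using i less by (intro a_lower) auto
    finally show "d 0 * (u j)\<^sup>2 / real j \<le> a j i" .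
  qed auto
  then have 1: "d 0 * (u j)\<^sup>2 / real j * (real n * g) \<le> (\<Sum>i\<le>n. a j i * f i)"
    using n by (simp only: sum_distrib_left[symmetric]) (simp add: g_def)
  \<comment> \<open>On \<open>{..n}\<close> the linear barrier is nonpositive, so it may be extended
    to all \<open>i < j\<close> and the true boundary contribution added separately.\<close>
  have "(\<Sum>i<j. a j i * (b * (real i - real n))) \<le> (\<Sum>i<j. if i \<le> n then 0 else a j i * f i)"
  proof (intro sum_mono)
    fix i assume i: "i \<in> {..<j}"
    show "a j i * (b * (real i - real n)) \<le> (if i \<le> n then 0 else a j i * f i)"
    proof (cases "i \<le> n")
      case True
      then have "a j i * b * (real i - real n) \<le> 0"
        using a_pos[of j i] b by (intro mult_nonneg_nonpos) auto
      then show ?thesis using True by (simp add: mult_ac)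
    next
      case False
      then have "b * (real i - real n) \<le> f i" using less i by (simp add: b_def mult_ac)
      then show ?thesis using False a_pos[of j i] by simp
    qed
  qed
  also have "\<dots> = (\<Sum>i<j. a j i * f i) - (\<Sum>i\<le>n. a j i * f i)"
  proof -
    have "(\<Sum>i<j. a j i * f i) = (\<Sum>i<j. (if i \<le> n then 0 else a j i * f i) + (if i \<le> n then a j i * f i else 0))"
      by (intro sum.cong) auto
    also have "\<dots> = (\<Sum>i<j. if i \<le> n then 0 else a j i * f i) + (\<Sum>i<j. if i \<le> n then a j i * f i else 0)"
      by (rule sum.distrib)
    also have "(\<Sum>i<j. if i \<le> n then a j i * f i else 0) = (\<Sum>i\<le>n. a j i * f i)"
      using less by (intro sum.mono_neutral_cong_right) auto
    finally show ?thesis by simp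
  qed
  finally have 2: "(\<Sum>i<j. a j i * (b * (real i - real n))) + d 0 * (u j)\<^sup>2 / real j * (real n * g)
      \<le> (\<Sum>i<j. a j i * f i)" using 1 by linarith
  have "(\<Sum>i<j. a j i * (b * (real i - real n)))
      = b * (real j - real n) * (\<Sum>i<j. a j i) - b * (\<Sum>i<j. a j i * real (j - i))"
    unfolding sum_distrib_left sum_subtractf[symmetric]
    by (intro sum.cong refl) (auto simp: of_nat_diff algebra_simps)
  also have "\<dots> \<ge> b * (real j - real n) * v j - b * (K_drift * real j * (u j)\<^sup>2)"
    using a_sum[of j] a_drift[of j] less b by (simp add: mult_left_mono)
  finally have 3: "b * (real j - real n) * v j - b * (K_drift * real j * (u j)\<^sup>2)
      + d 0 * (u j)\<^sup>2 / real j * (real n * g) \<le> (\<Sum>i<j. a j i * f i)" using 2 by linarith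
  have "b * (K_drift * real j * (u j)\<^sup>2) \<le> d 0 * (u j)\<^sup>2 / real j * (real n * g)"
  proof -
    have "real j * real j \<le> (4 * real n) * (4 * real n)" using less by (intro mult_mono) auto
    also have "\<dots> \<le> 20 * (real n * real n)" by simp
    finally have "g * d 0 * (u j)\<^sup>2 * (real j * real j) \<le> g * d 0 * (u j)\<^sup>2 * (20 * (real n * real n))"
      using g K_drift_ge_1 d_pos[of 0] by (intro mult_left_mono) auto
    then show ?thesis using n jpos K_drift_ge_1 unfolding b_def c_near_def by (simp add: field_simps)
  qed
  then have "b * (real j - real n) * v j \<le> (\<Sum>i<j. a j i * f i)" using 3 by linarith
  also have "\<dots> \<le> v j * f j" using sup less by (auto simp: superharm_def)
  finally have "b * (real j - real n) \<le> f j" using v_pos[of j] by (simp add: mult.commute)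
  then show ?case by (simp add: b_def)
qed

text \<open>The second entry is the ratio between the lower bound for landing in
  \<open>{..n}\<close> and the upper bound for landing below \<open>2 * n\<close>.\<close>

definition c_doeblin :: real where "c_doeblin = min c_near (d 0 / (2 * K_sum * K_kernel))"

lemma c_doeblin: "0 < c_doeblin" "c_doeblin \<le> c_near" "c_doeblin \<le> d 0 / (2 * K_sum * K_kernel)"
  using c_near d_pos[of 0] K_sum_ge_1 K_kernel_ge_1 by (auto simp: c_doeblin_def)

text \<open>From \<open>k > 4 * n\<close>, a fixed proportion of the jumps below
  \<open>2 * n\<close> is spread evenly over \<open>{..n}\<close>, as \<open>u i \<ge> u n\<close>
  there; a jump that stays in \<open>{2 * n..<k}\<close> is covered by induction. What lands
  strictly between is only known to be nonnegative and is dropped.\<close>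

lemma doeblin:
  assumes sup: "superharm n f" and nonneg: "\<And>i. i \<le> n \<Longrightarrow> f i \<ge> 0" and n: "n > 0"
    and k: "2 * n \<le> k"
  shows "c_doeblin * ((\<Sum>i\<le>n. f i) / real n) \<le> f k"
  using k
proof (induction k rule: less_induct)
  case (less k)
  define g where "g = (\<Sum>i\<le>n. f i) / real n"
  have g: "g \<ge> 0" unfolding g_def using nonneg by (intro divide_nonneg_nonneg sum_nonneg) auto
  have fnn: "f i \<ge> 0" for i using superharm_nonneg[OF sup nonneg] .
  show ?case
  proof (cases "k \<le> 4 * n")
    case True
    have "c_doeblin * g * 1 \<le> c_near * g * ((real k - real n) / real n)"
      using c_doeblin g n less by (intro mult_mono) (auto simp: divide_simps)
    also have "\<dots> \<le> f k" unfolding g_def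
      using doeblin_near[OF sup nonneg n, of k] less n True by simp
    finally show ?thesis by (simp add: g_def)
  next
    case False
    have kpos: "real k > 0" using False by simp
    have "(\<Sum>i\<le>n. d 0 * u k * u n / real k * f i) \<le> (\<Sum>i\<le>n. a k i * f i)"
    proof (intro sum_mono mult_right_mono nonneg)
      fix i assume i: "i \<in> {..n}"
      have "d 0 * u k * u n / real k = d 0 * u k / real k * u n" by simp
      also have "\<dots> \<le> d 0 * u k / real k * u i"
        using i d_pos[of 0] u_pos[of k] by (intro mult_left_mono u_antimono) auto
      also have "\<dots> \<le> a k i" using i False by (intro a_lower) auto
      finally show "d 0 * u k * u n / real k \<le> a k i" .
    qed auto
    then have 1: "d 0 * u k * u n / real k * (real n * g) \<le> (\<Sum>i\<le>n. a k i * f i)"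
      using n by (simp only: sum_distrib_left[symmetric]) (simp add: g_def)
    have "(\<Sum>i<2*n. a k i) \<le> (\<Sum>i<2*n. K_kernel * u k / real k * u i)"
      using False by (intro sum_mono a_upper) auto
    also have "\<dots> = K_kernel * u k / real k * T (2 * n)" by (simp add: T_def sum_distrib_left)
    also have "\<dots> \<le> K_kernel * u k / real k * (K_sum * real (2 * n) * u (2 * n))"
      using K_kernel_ge_1 u_pos[of k] n by (intro mult_left_mono T_upper) auto
    also have "\<dots> \<le> K_kernel * u k / real k * (K_sum * real (2 * n) * u n)"
      using K_kernel_ge_1 K_sum_ge_1 u_pos[of k] n by (intro mult_left_mono u_antimono) auto
    finally have 2: "(\<Sum>i<2*n. a k i) \<le> K_kernel * u k / real k * (K_sum * real (2 * n) * u n)" .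
    have "c_doeblin * g * (\<Sum>i<2*n. a k i) \<le> d 0 / (2 * K_sum * K_kernel) * g * (K_kernel * u k / real k * (K_sum * real (2 * n) * u n))"
      using c_doeblin g d_pos[of 0] 2 K_sum_ge_1 K_kernel_ge_1 a_pos by (intro mult_mono sum_nonneg) (auto intro: less_imp_le)
    also have "\<dots> = d 0 * u k * u n / real k * (real n * g)"
      using K_sum_ge_1 K_kernel_ge_1 by simp
    finally have 3: "c_doeblin * g * (\<Sum>i<2*n. a k i) \<le> (\<Sum>i\<le>n. a k i * f i)" using 1 by linarith
    have "c_doeblin * g * (\<Sum>i=2*n..<k. a k i) = (\<Sum>i=2*n..<k. a k i * (c_doeblin * g))"
      by (simp add: sum_distrib_left mult.commute)
    also have "\<dots> \<le> (\<Sum>i=2*n..<k. a k i * f i)"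
      using less a_pos by (intro sum_mono mult_left_mono) (auto simp: g_def intro: less_imp_le)
    finally have 4: "c_doeblin * g * (\<Sum>i=2*n..<k. a k i) \<le> (\<Sum>i=2*n..<k. a k i * f i)" .
    have "c_doeblin * g * v k = c_doeblin * g * (\<Sum>i<k. a k i)" using a_sum[of k] kpos by simp
    also have "(\<Sum>i<k. a k i) = (\<Sum>i<2*n. a k i) + (\<Sum>i=2*n..<k. a k i)"
      using False unfolding lessThan_atLeast0 by (intro sum.atLeastLessThan_concat[symmetric]) auto
    also have "c_doeblin * g * \<dots> \<le> (\<Sum>i\<le>n. a k i * f i) + (\<Sum>i=2*n..<k. a k i * f i)"
      using 3 4 by (simp add: distrib_left)
    also have "\<dots> = (\<Sum>i\<in>{..n} \<union> {2*n..<k}. a k i * f i)"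
      using n by (intro sum.union_disjoint[symmetric]) auto
    also have "\<dots> \<le> (\<Sum>i<k. a k i * f i)"
      using False by (intro sum_mono2) (auto intro!: mult_nonneg_nonneg less_imp_le[OF a_pos] fnn)
    also have "\<dots> \<le> v k * f k" using sup False by (auto simp: superharm_def)
    finally have "c_doeblin * g * v k \<le> f k * v k" by (simp add: mult.commute)
    then show ?thesis using v_pos[of k] by (simp only: mult_le_cancel_right_pos g_def)
  qed
qed

definition K_overshoot :: real where "K_overshoot = 2 * K_kernel / (eta * d 0)"

lemma K_overshoot_pos: "K_overshoot > 0" using K_kernel_ge_1 eta d_pos[of 0] by (simp add: K_overshoot_def)

text \<open>Both sums are compared with the same measure \<open>u i\<close>, so the bound is uniform
  in the starting point \<open>k > n\<close>; \<open>2 * m \<le> n\<close> keeps the jumps below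
  \<open>m\<close> in the range of \<open>a_upper\<close>.\<close>

lemma overshoot:
  assumes "0 < e" "e \<le> eta / 2" "2 * m \<le> n" "0 < n" "n < k"
  shows "(\<Sum>i<m. a k i * (real n / (real i + 1)) powr e)
    \<le> K_overshoot * (real m / real n) powr (eta / 2) * (\<Sum>i<n. a k i)"
proof -
  have kpos: "real k > 0" using assms by simp
  have "(\<Sum>i<m. a k i * (real n / (real i + 1)) powr e)
      \<le> (\<Sum>i<m. K_kernel * u k / real k * u i * (real n / (real i + 1)) powr e)"
    using assms by (intro sum_mono mult_right_mono a_upper) auto
  also have "\<dots> = K_kernel * u k / real k * (\<Sum>i<m. u i * (real n / (real i + 1)) powr e)"
    by (simp add: sum_distrib_left mult_ac)
  also have "\<dots> \<le> K_kernel * u k / real k * (2 / eta * (real m / real n) powr (eta / 2) * T n)"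
    using assms K_kernel_ge_1 u_pos[of k] by (intro mult_left_mono u_weighted_sum) auto
  also have "\<dots> = K_overshoot * (real m / real n) powr (eta / 2) * (\<Sum>i<n. d 0 * u k / real k * u i)"
    using d_pos[of 0] unfolding sum_distrib_left[symmetric] by (simp add: K_overshoot_def T_def mult_ac)
  also have "\<dots> \<le> K_overshoot * (real m / real n) powr (eta / 2) * (\<Sum>i<n. a k i)"
    using K_overshoot_pos assms by (intro mult_left_mono sum_mono a_lower) auto
  finally show ?thesis .
qed

section \<open>Oscillation decay\<close>

definition rho :: "nat \<Rightarrow> real" where "rho k = x k / u k"

lemma rho_lower: "d 0 \<le> rho k"
  using x_lower[of k] u_pos[of k] by (simp add: rho_def field_simps)

lemma rho_upper: "rho k \<le> K_step"
  using x_upper[of k] u_pos[of k] by (simp add: rho_def field_simps)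

lemma rho_pos: "rho k > 0"
  using rho_lower[of k] d_pos[of 0] by linarith

lemma x_eq_rho: "x k = rho k * u k"
  using u_pos[of k] by (simp add: rho_def)

lemma sum_a_rho: "k > 0 \<Longrightarrow> (\<Sum>i<k. a k i * rho i) = v k * rho k - lam / 2 * x k * d k"
proof -
  assume k: "k > 0"
  have "(\<Sum>i<k. a k i * rho i) = (\<Sum>i<k. d (k - 1 - i) * x i)"
    using u_pos by (intro sum.cong refl) (simp add: a_def x_eq_rho)
  also have "\<dots> = x k * (1 + lam * u k) - lam / 2 * x k * d k"
    using x_rec[OF k] by simp
  finally show ?thesis by (simp add: x_eq_rho v_eq mult_ac)
qed

lemma superharm_rho: "superharm n rho"
proof -
  have "0 \<le> lam / 2 * x k * d k" for k
    using lam_pos by (intro mult_nonneg_nonneg) (auto intro: less_imp_le[OF x_pos] less_imp_le[OF d_pos])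
  then show ?thesis using sum_a_rho by (auto simp: superharm_def)
qed

definition K_source where "K_source = lam * K_step / 2"

lemma K_source_pos: "K_source > 0"
  using lam_pos by (simp add: K_source_def)

text \<open>The source has the wrong sign for \<open>- rho\<close>. Averaging
  \<open>u (Suc i)\<close> over \<open>i < k\<close> gives at least \<open>u k\<close>, and the
  shift by one makes this exceed \<open>u (Suc k)\<close> by exactly \<open>d k\<close>, which pays
  for a source of size at most \<open>K_source * v k * d k\<close>.\<close>

lemma superharm_neg_rho: "superharm n (\<lambda>k. - rho k - K_source * u (Suc k))"
  unfolding superharm_def
proof (intro allI impI)
  fix k assume "k > n"
  then have k: "k > 0" by simp
  have "u k * v k = (\<Sum>i<k. a k i * u k)"
    unfolding sum_distrib_right[symmetric] a_sum[OF k] by simp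
  also have "\<dots> \<le> (\<Sum>i<k. a k i * u (Suc i))"
    by (intro sum_mono mult_left_mono u_antimono less_imp_le[OF a_pos]) auto
  finally have 1: "K_source * (u k * v k) \<le> K_source * (\<Sum>i<k. a k i * u (Suc i))"
    using K_source_pos by simp
  have "(\<Sum>i<k. a k i * (- rho i - K_source * u (Suc i)))
      = - (\<Sum>i<k. a k i * rho i) - K_source * (\<Sum>i<k. a k i * u (Suc i))"
    by (simp add: sum_distrib_left sum_subtractf sum_negf algebra_simps)
  also have "\<dots> \<le> - (v k * rho k) + lam / 2 * x k * d k - K_source * (u k * v k)"
    using sum_a_rho[OF k] 1 by simp
  also have "lam / 2 * x k * d k \<le> K_source * v k * d k"
  proof -
    have "x k \<le> K_step * v k"
      using x_upper[of k] lam_pos u_pos[of k] by (simp add: v_def) (smt (verit) exp_gt_zero mult_left_mono zero_le_mult_iff zero_le_power2)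
    then have "lam / 2 * x k \<le> lam / 2 * (K_step * v k)" using lam_pos by (intro mult_left_mono) auto
    then show ?thesis using d_pos[of k] by (intro mult_right_mono) (auto simp: K_source_def)
  qed
  finally show "(\<Sum>i<k. a k i * (- rho i - K_source * u (Suc i))) \<le> v k * (- rho k - K_source * u (Suc k))"
    by (simp add: d_def algebra_simps)
qed

lemma superharm_add_const:
  assumes "superharm n f"
  shows "superharm n (\<lambda>k. c + f k)"
  unfolding superharm_def
proof (intro allI impI)
  fix k assume "k > n"
  then have "(\<Sum>i<k. a k i * (c + f i)) = v k * c + (\<Sum>i<k. a k i * f i)"
    using a_sum[of k] by (simp add: distrib_left sum.distrib sum_distrib_right[symmetric])
  then show "(\<Sum>i<k. a k i * (c + f i)) \<le> v k * (c + f k)"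
    using assms \<open>k > n\<close> by (simp add: superharm_def distrib_left)
qed

lemma superharm_add_mult:
  assumes "superharm n f" "superharm n g" "c \<ge> 0"
  shows "superharm n (\<lambda>k. f k + c * g k)"
  unfolding superharm_def
proof (intro allI impI)
  fix k assume k: "k > n"
  have "(\<Sum>i<k. a k i * (f i + c * g i)) = (\<Sum>i<k. a k i * f i) + c * (\<Sum>i<k. a k i * g i)"
    by (simp add: distrib_left sum.distrib sum_distrib_left mult_ac)
  also have "\<dots> \<le> v k * f k + c * (v k * g k)"
    using assms k by (intro add_mono mult_left_mono) (auto simp: superharm_def)
  finally show "(\<Sum>i<k. a k i * (f i + c * g i)) \<le> v k * (f k + c * g k)"
    by (simp add: algebra_simps)
qed

text \<open>The function dominates the mean weight collected when the chain first enters
  \<open>{..n}\<close>: up to \<open>n\<close> it is the weight itself, and above \<open>n\<close>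
  the constant \<open>\<kappa>\<close> from \<open>overshoot\<close> suffices.\<close>

lemma superharm_overshoot:
  assumes "0 < e" "e \<le> eta / 2" "2 * m \<le> n" "0 < n"
  defines "\<kappa> \<equiv> K_overshoot * (real m / real n) powr (eta / 2)"
  shows "superharm n (\<lambda>i. if i < m then (real n / (real i + 1)) powr e else if i \<le> n then 0 else \<kappa>)"
    (is "superharm n ?G")
  unfolding superharm_def
proof (intro allI impI)
  fix k assume k: "k > n"
  have \<kappa>: "\<kappa> \<ge> 0" using K_overshoot_pos by (simp add: \<kappa>_def)
  have "(\<Sum>i<k. a k i * ?G i) = (\<Sum>i<k. if i < m then a k i * (real n / (real i + 1)) powr e else 0)
      + (\<Sum>i<k. if i \<le> n then 0 else a k i * \<kappa>)"
    unfolding sum.distrib[symmetric] using assms by (intro sum.cong) auto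
  also have "(\<Sum>i<k. if i < m then a k i * (real n / (real i + 1)) powr e else 0)
      = (\<Sum>i<m. a k i * (real n / (real i + 1)) powr e)"
    using k assms by (intro sum.mono_neutral_cong_right) auto
  also have "\<dots> \<le> \<kappa> * (\<Sum>i<n. a k i)"
    unfolding \<kappa>_def using assms k by (intro overshoot) auto
  also have "\<kappa> * (\<Sum>i<n. a k i) = (\<Sum>i<k. if i < n then \<kappa> * a k i else 0)"
    unfolding sum_distrib_left using k by (intro sum.mono_neutral_cong_left) auto
  also have "\<dots> + (\<Sum>i<k. if i \<le> n then 0 else a k i * \<kappa>) \<le> (\<Sum>i<k. \<kappa> * a k i)"
    unfolding sum.distrib[symmetric] using \<kappa> a_pos
    by (intro sum_mono) (auto simp: mult.commute intro!: mult_nonneg_nonneg less_imp_le[OF a_pos])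
  also have "\<dots> = v k * \<kappa>" using a_sum[of k] k by (simp add: sum_distrib_left[symmetric] mult.commute)
  finally show "(\<Sum>i<k. a k i * ?G i) \<le> v k * ?G k" using k assms by simp
qed

text \<open>Values far below the scale \<open>n\<close> are allowed to be slightly negative: they are rarely visited.\<close>
lemma doeblin_weighted:
  assumes e: "0 < e" "e \<le> eta / 2" and m: "2 * m \<le> n" "0 < n"
    and sup: "superharm n f" and b: "b \<ge> 0"
    and low: "\<And>i. i < m \<Longrightarrow> - b * (real n / (real i + 1)) powr e \<le> f i"
    and nonneg: "\<And>i. m \<le> i \<Longrightarrow> i \<le> n \<Longrightarrow> 0 \<le> f i"
    and k: "2 * n \<le> k"
  shows "c_doeblin * ((\<Sum>i=m..n. f i) / real n) - b * (K_overshoot * (real m / real n) powr (eta / 2)) \<le> f k"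
proof -
  define G where "G = (\<lambda>i. if i < m then (real n / (real i + 1)) powr e else if i \<le> n then 0 else K_overshoot * (real m / real n) powr (eta / 2))"
  define F where "F = (\<lambda>i. f i + b * G i)"
  have "superharm n F"
    unfolding F_def G_def by (intro superharm_add_mult sup b superharm_overshoot e m)
  moreover have F: "F i \<ge> 0" if "i \<le> n" for i
    using low[of i] nonneg[of i] that by (auto simp: F_def G_def)
  ultimately have "c_doeblin * ((\<Sum>i\<le>n. F i) / real n) \<le> F k"
    using m k by (intro doeblin) auto
  moreover have "(\<Sum>i=m..n. f i) \<le> (\<Sum>i\<le>n. F i)"
  proof -
    have "(\<Sum>i=m..n. f i) = (\<Sum>i=m..n. F i)"
      by (intro sum.cong) (auto simp: F_def G_def)
    also have "\<dots> \<le> (\<Sum>i\<le>n. F i)" using F by (intro sum_mono2) auto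
    finally show ?thesis .
  qed
  then have "c_doeblin * ((\<Sum>i=m..n. f i) / real n) \<le> c_doeblin * ((\<Sum>i\<le>n. F i) / real n)"
    using c_doeblin by (intro mult_left_mono divide_right_mono) auto
  ultimately show ?thesis using m k by (simp add: F_def G_def)
qed

section \<open>Oscillation of \<open>rho\<close> beyond an index\<close>

definition Mx where "Mx n = Sup (rho ` {n..})"
definition mn where "mn n = Inf (rho ` {n..})"
definition osc where "osc n = Mx n - mn n"

lemma bdd_rho: "bdd_above (rho ` A)" "bdd_below (rho ` A)"
  using rho_upper rho_lower by (auto intro!: bdd_aboveI[of _ K_step] bdd_belowI[of _ "d 0"])

lemma rho_le_Mx: "n \<le> k \<Longrightarrow> rho k \<le> Mx n"
  unfolding Mx_def by (intro cSup_upper bdd_rho) auto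

lemma mn_le_rho: "n \<le> k \<Longrightarrow> mn n \<le> rho k"
  unfolding mn_def by (intro cInf_lower bdd_rho) auto

lemma Mx_antimono: "n \<le> k \<Longrightarrow> Mx k \<le> Mx n"
  unfolding Mx_def by (intro cSup_subset_mono bdd_rho) auto

lemma mn_mono: "n \<le> k \<Longrightarrow> mn n \<le> mn k"
  unfolding mn_def by (intro cInf_superset_mono bdd_rho) auto

lemma osc_antimono: "n \<le> k \<Longrightarrow> osc k \<le> osc n"
  unfolding osc_def using Mx_antimono mn_mono by (intro diff_mono)

lemma osc_nonneg: "osc n \<ge> 0"
  unfolding osc_def using rho_le_Mx[of n n] mn_le_rho[of n n] by simp

lemma osc_le:
  assumes "\<And>k k'. n \<le> k \<Longrightarrow> n \<le> k' \<Longrightarrow> rho k - rho k' \<le> b"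
  shows "osc n \<le> b"
proof -
  have "Mx n - b \<le> mn n" unfolding mn_def
  proof (intro cInf_greatest)
    fix y assume "y \<in> rho ` {n..}"
    then obtain k' where k': "k' \<ge> n" "y = rho k'" by auto
    have "Mx n \<le> b + rho k'" unfolding Mx_def
      using assms[OF _ k'(1)] by (intro cSup_least) (force simp: algebra_simps)+
    then show "Mx n - b \<le> y" using k' by simp
  qed auto
  then show ?thesis by (simp add: osc_def)
qed

text \<open>\<open>rho - mn m\<close> and \<open>Mx m - rho\<close> are nonnegative from
  \<open>m\<close> on and add up to \<open>osc m\<close>, so their averages over
  \<open>{m..n}\<close> cannot both be small, and \<open>doeblin_weighted\<close> turns the averages
  into a gain at \<open>k'\<close> and at \<open>k\<close>. Below \<open>m\<close> they may be
  negative, but at most by an earlier oscillation, which \<open>IH\<close> bounds.\<close>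

lemma osc_step:
  assumes e: "0 < e" "e \<le> eta / 2" "e \<le> d 0" and m: "2 * m \<le> n" "0 < n"
    and K: "K_source \<le> K" and IH: "\<And>i. i < m \<Longrightarrow> osc i \<le> K * (real i + 1) powr (- e)"
  shows "osc (2 * n) \<le> (1 - c_doeblin / 2) * osc m + K_source * (real m + 1) powr (- e)
    + 3 * K * (K_overshoot * (real m / real n) powr (eta / 2)) * real n powr (- e)"
proof (rule osc_le)
  fix k k' assume k: "2 * n \<le> k" "2 * n \<le> k'"
  define \<kappa> where "\<kappa> = K_overshoot * (real m / real n) powr (eta / 2)"
  have n: "real n > 0" using m by simp
  have u_e: "u i \<le> (real i + 1) powr (- e)" for i
  proof -
    have "u i \<le> (real i + 1) powr (- d 0)" by (rule u_decay)
    also have "\<dots> \<le> (real i + 1) powr (- e)" using e by (intro powr_mono) auto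
    finally show ?thesis .
  qed
  have powr_e: "real n powr (- e) * (real n / (real i + 1)) powr e = (real i + 1) powr (- e)" for i
    using n by (simp add: powr_divide powr_minus divide_simps)
  have Kn: "K * real n powr (- e) \<ge> 0" using K K_source_pos by simp
  have 1: "c_doeblin * ((\<Sum>i=m..n. - mn m + rho i) / real n) - K * real n powr (- e) * \<kappa> \<le> - mn m + rho k'"
    unfolding \<kappa>_def
  proof (rule doeblin_weighted[OF e(1,2) m superharm_add_const[OF superharm_rho] Kn _ _ k(2)])
    fix i assume i: "i < m"
    have "mn m \<le> Mx i" using mn_le_rho[of m m] rho_le_Mx[of i m] i by simp
    then have "- osc i \<le> - mn m + rho i" using mn_le_rho[of i i] by (simp add: osc_def)
    then show "- (K * real n powr - e) * (real n / (real i + 1)) powr e \<le> - mn m + rho i"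
      using IH[OF i] powr_e[of i] by (simp add: mult.assoc)
  qed (use mn_le_rho in auto)
  \<comment> \<open>One \<open>K\<close> covers the earlier oscillation, the second the correction
    \<open>K_source * u (Suc i)\<close>; with the single \<open>K\<close> used for
    \<open>- mn m + rho\<close> this makes the 3 in the claim.\<close>
  have Kn2: "2 * K * real n powr (- e) \<ge> 0" using K K_source_pos by simp
  have 2: "c_doeblin * ((\<Sum>i=m..n. Mx m + K_source * u m + (- rho i - K_source * u (Suc i))) / real n) - 2 * K * real n powr (- e) * \<kappa>
      \<le> Mx m + K_source * u m + (- rho k - K_source * u (Suc k))"
    unfolding \<kappa>_def
  proof (rule doeblin_weighted[OF e(1,2) m superharm_add_const[OF superharm_neg_rho] Kn2 _ _ k(1)])
    fix i assume i: "i < m"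
    have "mn i \<le> Mx m" using rho_le_Mx[of m m] mn_le_rho[of i m] i by simp
    then have "- osc i \<le> Mx m - rho i" using rho_le_Mx[of i i] by (simp add: osc_def)
    moreover have "K_source * u (Suc i) \<le> K * (real i + 1) powr (- e)"
      using K K_source_pos u_e[of i] u_antimono[of i "Suc i"] u_pos[of "Suc i"] by (intro mult_mono) auto
    moreover have "K_source * u m \<ge> 0" using K_source_pos u_pos[of m] by simp
    ultimately show "- (2 * K * real n powr - e) * (real n / (real i + 1)) powr e
        \<le> Mx m + K_source * u m + (- rho i - K_source * u (Suc i))"
      using IH[OF i] powr_e[of i] by (simp add: mult.assoc)
  next
    fix i assume i: "m \<le> i"
    have "K_source * u (Suc i) \<le> K_source * u m" using K_source_pos i by (intro mult_left_mono u_antimono) auto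
    then show "0 \<le> Mx m + K_source * u m + (- rho i - K_source * u (Suc i))" using rho_le_Mx[OF i] by simp
  qed
  \<comment> \<open>Since \<open>2 * m \<le> n\<close>, the window \<open>{m..n}\<close> holds at
    least \<open>n / 2\<close> points.\<close>
  have "osc m / 2 \<le> (real n - real m + 1) * osc m / real n"
  proof -
    have "real n * osc m \<le> 2 * (real n - real m + 1) * osc m"
    proof (intro mult_right_mono osc_nonneg)
      have "real (2 * m) \<le> real n" using m(1) by (intro of_nat_mono)
      then show "real n \<le> 2 * (real n - real m + 1)" by (simp add: algebra_simps)
    qed
    then show ?thesis using n by (simp add: field_simps)
  qed
  also have "(real n - real m + 1) * osc m = (\<Sum>i=m..n. osc m)"
    using m by (simp add: of_nat_diff)
  also have "\<dots> \<le> (\<Sum>i=m..n. (- mn m + rho i) + (Mx m + K_source * u m + (- rho i - K_source * u (Suc i))))"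
  proof (intro sum_mono)
    fix i assume i: "i \<in> {m..n}"
    have "K_source * u (Suc i) \<le> K_source * u m" using K_source_pos i by (intro mult_left_mono u_antimono) auto
    then show "osc m \<le> (- mn m + rho i) + (Mx m + K_source * u m + (- rho i - K_source * u (Suc i)))"
      by (simp add: osc_def)
  qed
  also have "\<dots> = (\<Sum>i=m..n. - mn m + rho i) + (\<Sum>i=m..n. Mx m + K_source * u m + (- rho i - K_source * u (Suc i)))"
    by (rule sum.distrib)
  finally have "osc m / 2 \<le> ((\<Sum>i=m..n. - mn m + rho i) + (\<Sum>i=m..n. Mx m + K_source * u m + (- rho i - K_source * u (Suc i)))) / real n"
    using n by (simp add: divide_right_mono)
  then have "c_doeblin * (osc m / 2) \<le> c_doeblin * (((\<Sum>i=m..n. - mn m + rho i) + (\<Sum>i=m..n. Mx m + K_source * u m + (- rho i - K_source * u (Suc i)))) / real n)"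
    using c_doeblin by (intro mult_left_mono) auto
  then have 3: "c_doeblin * (osc m / 2) \<le> c_doeblin * ((\<Sum>i=m..n. - mn m + rho i) / real n)
      + c_doeblin * ((\<Sum>i=m..n. Mx m + K_source * u m + (- rho i - K_source * u (Suc i))) / real n)"
    by (simp only: add_divide_distrib distrib_left)
  have 4: "K_source * u m \<le> K_source * (real m + 1) powr (- e)" using u_e[of m] K_source_pos by simp
  have 5: "K_source * u (Suc k) \<ge> 0" using K_source_pos u_pos[of "Suc k"] by simp
  have "rho k - rho k' \<le> osc m + K_source * u m - c_doeblin * (osc m / 2) + 3 * (K * real n powr (- e) * \<kappa>)"
  proof -
    have "2 * K * real n powr (- e) * \<kappa> = 2 * (K * real n powr (- e) * \<kappa>)" by simp
    moreover have "osc m = Mx m - mn m" by (rule osc_def)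
    ultimately show ?thesis using 1 2 3 5 by argo
  qed
  then show "rho k - rho k' \<le> (1 - c_doeblin / 2) * osc m + K_source * (real m + 1) powr (- e)
    + 3 * K * (K_overshoot * (real m / real n) powr (eta / 2)) * real n powr (- e)"
    using 4 unfolding \<kappa>_def[symmetric] by (simp add: algebra_simps)
qed

lemma osc_decay: "\<exists>K e. 0 < K \<and> 0 < e \<and> e \<le> eta / 2 \<and> (\<forall>n. osc n \<le> K * (real n + 1) powr (- e))"
proof -
  \<comment> \<open>The scale ratio \<open>D\<close> makes overshooting below \<open>n / D\<close>
    cheap. The 24 is 3 times 8: the 3 stems from \<open>osc_step\<close>, and an eighth of
    \<open>c_doeblin\<close> is allotted to this error.\<close>
  have "((\<lambda>D. real D powr (- (eta / 2))) \<longlongrightarrow> 0) sequentially"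
    using eta by (intro tendsto_neg_powr filterlim_real_sequentially) auto
  then have "\<forall>\<^sub>F D in sequentially. real D powr (- (eta / 2)) < c_doeblin / (24 * K_overshoot)"
    using c_doeblin K_overshoot_pos by (intro order_tendstoD) auto
  then obtain D0 where D0: "\<And>D. D \<ge> D0 \<Longrightarrow> real D powr (- (eta / 2)) < c_doeblin / (24 * K_overshoot)"
    by (auto simp: eventually_sequentially)
  define D where "D = max D0 2"
  have D: "D \<ge> 2" "real D powr (- (eta / 2)) \<le> c_doeblin / (24 * K_overshoot)"
    using D0[of D] by (auto simp: D_def)
  have c71: "c_doeblin \<le> 1"
  proof -
    have "c_near \<le> 1 / 20" unfolding c_near_def using K_drift_ge_1 d0_less_1 d_pos[of 0] by (intro frac_le) auto
    then show ?thesis using c_doeblin by simp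
  qed
  \<comment> \<open>The first two caps are the validity range of \<open>osc_step\<close>. The
    quotient of logarithms ensures \<open>(4 * D) powr e \<le> 1 + c_doeblin / 4\<close>: passing
    from \<open>N\<close> to \<open>m\<close> loses a factor of at most \<open>4 * D\<close> in
    scale, and this must not eat up the net contraction \<open>1 - c_doeblin / 4\<close>.\<close>
  define e where "e = min (min (eta / 2) (d 0)) (ln (1 + c_doeblin / 4) / ln (4 * real D))"
  have "0 < e"
    using eta d_pos[of 0] c_doeblin D by (auto simp: e_def)
  moreover have "e \<le> eta / 2" "e \<le> d 0" "e \<le> ln (1 + c_doeblin / 4) / ln (4 * real D)"
    unfolding e_def by linarith+
  ultimately have e: "0 < e" "e \<le> eta / 2" "e \<le> d 0" "e \<le> ln (1 + c_doeblin / 4) / ln (4 * real D)"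
    by auto
  have e4: "(4 * real D) powr e \<le> 1 + c_doeblin / 4"
  proof -
    have "e * ln (4 * real D) \<le> ln (1 + c_doeblin / 4)" using e(4) D by (simp add: pos_le_divide_eq)
    then have "exp (e * ln (4 * real D)) \<le> exp (ln (1 + c_doeblin / 4))" by simp
    then show ?thesis using D c_doeblin by (simp add: powr_def)
  qed
  \<comment> \<open>The first summand settles \<open>N < 2\<close>, where
    \<open>(N + 1) powr (- e)\<close> is at least 1/2; the second makes the source at most
    \<open>c_doeblin / 8 * K\<close>.\<close>
  define K where "K = 2 * K_step + 8 * K_source / c_doeblin"
  have KB: "K_source \<le> c_doeblin / 8 * K" using c_doeblin by (simp add: K_def field_simps)
  have K: "K > 0" using c_doeblin K_source_pos by (simp add: K_def add_pos_pos)
  have "c_doeblin / 8 * K \<le> 1 * K" using c71 K by (intro mult_right_mono) auto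
  then have BK: "K_source \<le> K" using KB by simp
  have "osc N \<le> K * (real N + 1) powr (- e)" for N
  proof (induction N rule: less_induct)
    case (less N)
    show ?case
    proof (cases "N < 2")
      case True
      have "osc N \<le> K_step" using rho_upper rho_pos by (intro osc_le) (smt (verit))
      also have "K_step \<le> K * (1 / 2)" using c_doeblin K_source_pos by (simp add: K_def)
      also have "1 / 2 = 2 powr (-1 :: real)" by (simp add: powr_minus)
      also have "K * 2 powr (-1) \<le> K * 2 powr (- e)" using K e eta by (intro mult_left_mono powr_mono) auto
      also have "\<dots> \<le> K * (real N + 1) powr (- e)"
        using True K e by (intro mult_left_mono powr_mono2') auto
      finally show ?thesis .
    next
      case False
      define n where "n = N div 2"
      define m where "m = n div D"
      have n: "n > 0" "2 * n \<le> N" "N + 1 \<le> 4 * n" using False unfolding n_def by presburger+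
      have "D * m \<le> n" unfolding m_def by simp
      moreover have "2 * m \<le> D * m" using D by (intro mult_right_mono) auto
      ultimately have m: "2 * m \<le> n" "D * m \<le> n" by linarith+
      have "n < D * (m + 1)" unfolding m_def using D by (simp add: dividend_less_times_div)
      then have mD: "real n \<le> real D * (real m + 1)"
        by (metis less_imp_le of_nat_1 of_nat_add of_nat_le_iff of_nat_mult)
      have m_powr: "(real m + 1) powr (- e) \<le> real D powr e * real n powr (- e)"
      proof -
        have "(real m + 1) powr (- e) \<le> (real n / real D) powr (- e)"
          using mD n D e by (intro powr_mono2') (auto simp: field_simps)
        also have "\<dots> = real D powr e * real n powr (- e)"
          using n D by (simp add: powr_divide powr_minus divide_simps)
        finally show ?thesis .
      qed
      have \<kappa>: "K_overshoot * (real m / real n) powr (eta / 2) \<le> c_doeblin / 24"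
      proof -
        have "(real m / real n) powr (eta / 2) \<le> (1 / real D) powr (eta / 2)"
        proof (intro powr_mono2)
          have "real D * real m \<le> real n" using m(2) by (metis of_nat_le_iff of_nat_mult)
          then show "real m / real n \<le> 1 / real D" using n D by (simp add: field_simps)
        qed (use eta in auto)
        also have "\<dots> = real D powr (- (eta / 2))" using D by (simp add: powr_divide powr_minus_divide)
        also have "\<dots> \<le> c_doeblin / (24 * K_overshoot)" by (rule D(2))
        finally show ?thesis using K_overshoot_pos by (simp add: field_simps)
      qed
      have D1: "1 \<le> real D powr e" using D e by (intro ge_one_powr_ge_zero) auto
      define y where "y = K * (real D powr e * real n powr (- e))"
      have y: "y \<ge> 0" using K by (simp add: y_def)
      have "osc N \<le> osc (2 * n)" using n by (intro osc_antimono)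
      also have "\<dots> \<le> (1 - c_doeblin / 2) * osc m + K_source * (real m + 1) powr (- e)
          + 3 * K * (K_overshoot * (real m / real n) powr (eta / 2)) * real n powr (- e)"
        using m n by (intro osc_step e BK less.IH) auto
      also have "(1 - c_doeblin / 2) * osc m \<le> (1 - c_doeblin / 2) * y"
      proof (intro mult_left_mono)
        have "osc m \<le> K * (real m + 1) powr (- e)" using m n by (intro less.IH) auto
        also have "\<dots> \<le> y" unfolding y_def using K by (intro mult_left_mono m_powr) auto
        finally show "osc m \<le> y" .
      qed (use c71 in auto)
      also have "K_source * (real m + 1) powr (- e) \<le> c_doeblin / 8 * y"
      proof -
        have "K_source * (real m + 1) powr (- e) \<le> (c_doeblin / 8 * K) * (real D powr e * real n powr (- e))"
          using KB m_powr K_source_pos K c_doeblin by (intro mult_mono) auto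
        then show ?thesis by (simp add: y_def mult_ac)
      qed
      also have "3 * K * (K_overshoot * (real m / real n) powr (eta / 2)) * real n powr (- e) \<le> c_doeblin / 8 * y"
      proof -
        have "3 * K * (K_overshoot * (real m / real n) powr (eta / 2)) * real n powr (- e)
            \<le> 3 * K * (c_doeblin / 24) * (1 * real n powr (- e))"
          unfolding mult_1_left using \<kappa> K by (intro mult_right_mono mult_left_mono) auto
        also have "\<dots> \<le> 3 * K * (c_doeblin / 24) * (real D powr e * real n powr (- e))"
          using D1 K c_doeblin by (intro mult_left_mono mult_right_mono) auto
        finally show ?thesis by (simp add: y_def mult_ac)
      qed
      also have "(1 - c_doeblin / 2) * y + c_doeblin / 8 * y + c_doeblin / 8 * y = (1 - c_doeblin / 4) * y"
        by (simp add: algebra_simps)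
      also have "y \<le> K * ((1 + c_doeblin / 4) * (real N + 1) powr (- e))"
      proof -
        have "real n powr (- e) \<le> ((real N + 1) / 4) powr (- e)"
          using n e by (intro powr_mono2') auto
        also have "\<dots> = 4 powr e * (real N + 1) powr (- e)"
          by (simp add: powr_divide powr_minus divide_simps)
        finally have "real D powr e * real n powr (- e) \<le> real D powr e * (4 powr e * (real N + 1) powr (- e))"
          by (intro mult_left_mono) auto
        also have "\<dots> = (4 * real D) powr e * (real N + 1) powr (- e)" by (simp add: powr_mult)
        also have "\<dots> \<le> (1 + c_doeblin / 4) * (real N + 1) powr (- e)" using e4 by (intro mult_right_mono) auto
        finally show ?thesis unfolding y_def using K by (intro mult_left_mono) auto
      qed
      finally have "osc N \<le> (1 - c_doeblin / 4) * (K * ((1 + c_doeblin / 4) * (real N + 1) powr (- e)))"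
        using c71 by (simp add: mult_left_mono)
      also have "\<dots> = (1 - (c_doeblin / 4)\<^sup>2) * (K * (real N + 1) powr (- e))"
      proof -
        have "(1 - t) * (K * ((1 + t) * z)) = (1 - t\<^sup>2) * (K * z)" for t z :: real by algebra
        then show ?thesis .
      qed
      also have "\<dots> \<le> 1 * (K * (real N + 1) powr (- e))"
        using K by (intro mult_right_mono) auto
      finally show ?thesis by simp
    qed
  qed
  then show ?thesis using K e by blast
qed

section \<open>Convergence of \<open>rho\<close> with a rate\<close>

definition beta :: real where "beta = lim rho"

lemma rho_rate: "\<exists>K e. 0 < K \<and> 0 < e \<and> e \<le> eta / 2 \<and> (\<forall>n. \<bar>rho n - beta\<bar> \<le> K * (real n + 1) powr (- e))"
proof -
  obtain K e where Ke: "0 < K" "0 < e" "e \<le> eta / 2" "\<And>n. osc n \<le> K * (real n + 1) powr (- e)"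
    using osc_decay by blast
  have rho_osc: "\<bar>rho i - rho j\<bar> \<le> osc n" if "n \<le> i" "n \<le> j" for n i j
    using rho_le_Mx[OF that(1)] rho_le_Mx[OF that(2)] mn_le_rho[OF that(1)] mn_le_rho[OF that(2)]
    by (simp add: osc_def)
  have "((\<lambda>n. K * (real n + 1) powr (- e)) \<longlongrightarrow> K * 0) sequentially"
    using Ke by (intro tendsto_mult tendsto_const tendsto_neg_powr)
      (auto intro!: filterlim_tendsto_add_at_top[OF tendsto_const filterlim_real_sequentially] simp: add.commute)
  then have lim0: "((\<lambda>n. K * (real n + 1) powr (- e)) \<longlongrightarrow> 0) sequentially" by simp
  have "osc \<longlonglongrightarrow> 0"
    by (rule tendsto_sandwich[OF _ _ tendsto_const lim0]) (auto simp: osc_nonneg Ke(4))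
  have "Cauchy rho"
  proof (rule metric_CauchyI)
    fix r :: real assume "r > 0"
    then have "\<forall>\<^sub>F n in sequentially. osc n < r" using \<open>osc \<longlonglongrightarrow> 0\<close> by (intro order_tendstoD) auto
    then obtain N where N: "osc N < r" by (auto simp: eventually_sequentially)
    show "\<exists>M. \<forall>m\<ge>M. \<forall>n\<ge>M. dist (rho m) (rho n) < r"
      using rho_osc[of N] N by (intro exI[of _ N]) (auto simp: dist_real_def intro: le_less_trans)
  qed
  then have lim: "rho \<longlonglongrightarrow> beta"
    unfolding beta_def by (simp add: Cauchy_convergent_iff convergent_LIMSEQ_iff)
  have "\<bar>rho n - beta\<bar> \<le> osc n" for n
  proof (rule tendsto_upperbound)
    show "((\<lambda>k. \<bar>rho n - rho k\<bar>) \<longlongrightarrow> \<bar>rho n - beta\<bar>) sequentially"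
      by (intro tendsto_intros lim)
    show "\<forall>\<^sub>F k in sequentially. \<bar>rho n - rho k\<bar> \<le> osc n"
      using eventually_ge_at_top[of n] by eventually_elim (auto intro: rho_osc)
  qed auto
  then show ?thesis using Ke by (meson order_trans)
qed

end

section \<open>Identification of the exponent\<close>

text \<open>Gauss's product limit for 1 / Gamma with its last factor \<open>n + z\<close> divided
  out; \<open>pochhammer z n / fact n\<close> are the coefficients of
  \<open>(1 - X) powr (- z)\<close>.\<close>

lemma pochhammer_asymp:
  fixes z :: real
  shows "(\<lambda>n. pochhammer z n / fact n * real n powr (1 - z)) \<longlonglongrightarrow> rGamma z"
proof -
  have "(\<lambda>n. rGamma_series z n * (real n / (real n + z))) \<longlonglongrightarrow> rGamma z * 1"
    by (intro tendsto_mult rGamma_series_LIMSEQ) real_asymp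
  moreover have "\<forall>\<^sub>F n in sequentially. rGamma_series z n * (real n / (real n + z))
      = pochhammer z n / fact n * real n powr (1 - z)"
    using eventually_gt_at_top[of "nat \<lceil>\<bar>z\<bar>\<rceil>"]
  proof eventually_elim
    case (elim n)
    then have n: "real n > 0" "real n + z > 0" by linarith+
    have E: "exp (z * ln (real n)) = real n powr z" using n by (simp add: powr_def)
    have "(z + real n) * (real n / (real n + z)) = real n" using n by (simp add: add.commute)
    then have "pochhammer z (n + 1) * (real n / (real n + z)) = pochhammer z n * real n"
      by (simp only: Suc_eq_plus1[symmetric] pochhammer_Suc mult.assoc)
    then show ?case using n
      by (simp add: rGamma_series_def E powr_diff times_divide_eq_left mult.commute)
  qed
  ultimately show ?thesis by (simp add: tendsto_cong)
qed

text \<open>The 0/0 case of Stolz-Cesaro. For \<open>q\<close> on either side of \<open>l\<close>,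
  the difference of \<open>a\<close> and \<open>q * b\<close> is eventually monotone and tends to 0,
  so its sign is eventually fixed.\<close>

lemma stolz_cesaro_null:
  fixes a b :: "nat \<Rightarrow> real"
  assumes a: "a \<longlonglongrightarrow> 0" and b: "b \<longlonglongrightarrow> 0" and dec: "\<And>n. b (Suc n) < b n"
    and lim: "(\<lambda>n. (a n - a (Suc n)) / (b n - b (Suc n))) \<longlonglongrightarrow> l"
  shows "(\<lambda>n. a n / b n) \<longlonglongrightarrow> l"
proof -
  have b_pos: "b n > 0" for n
  proof -
    have "decseq b" using dec by (intro decseq_SucI less_imp_le)
    then have "0 \<le> b (Suc n)" using b by (rule decseq_ge)
    then show ?thesis using dec[of n] by linarith
  qed
  have tail: "\<forall>\<^sub>F n in sequentially. 0 \<le> c n"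
    if c: "c \<longlonglongrightarrow> 0" and ev: "\<forall>\<^sub>F n in sequentially. c (Suc n) \<le> c n" for c :: "nat \<Rightarrow> real"
  proof -
    obtain M where M: "\<And>n. n \<ge> M \<Longrightarrow> c (Suc n) \<le> c n" using ev by (auto simp: eventually_sequentially)
    have "decseq (\<lambda>n. c (n + M))" using M by (intro decseq_SucI) simp
    moreover have "(\<lambda>n. c (n + M)) \<longlonglongrightarrow> 0" using c by (rule LIMSEQ_ignore_initial_segment)
    ultimately have "0 \<le> c (n + M)" for n by (rule decseq_ge)
    then have "0 \<le> c n" if "n \<ge> M" for n using that by (metis le_add_diff_inverse2)
    then show ?thesis by (auto simp: eventually_sequentially)
  qed
  show ?thesis
  proof (rule order_tendstoI)
    fix y assume y: "y < l"
    define q where "q = (y + l) / 2"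
    have q: "q < l" "y < q" using y by (auto simp: q_def)
    have "\<forall>\<^sub>F n in sequentially. q < (a n - a (Suc n)) / (b n - b (Suc n))"
      using lim q by (intro order_tendstoD)
    then have "\<forall>\<^sub>F n in sequentially. a (Suc n) - q * b (Suc n) \<le> a n - q * b n"
    proof eventually_elim
      case (elim n)
      then have "q * (b n - b (Suc n)) < a n - a (Suc n)"
        using dec[of n] by (simp add: pos_less_divide_eq)
      then show ?case by (simp add: algebra_simps)
    qed
    moreover have "(\<lambda>n. a n - q * b n) \<longlonglongrightarrow> 0 - q * 0"
      by (intro tendsto_intros a b)
    ultimately have "\<forall>\<^sub>F n in sequentially. 0 \<le> a n - q * b n" by (intro tail) auto
    then show "\<forall>\<^sub>F n in sequentially. y < a n / b n"
    proof eventually_elim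
      case (elim n)
      then have "q \<le> a n / b n" using b_pos[of n] by (simp add: pos_le_divide_eq)
      then show ?case using q by simp
    qed
  next
    fix y assume y: "l < y"
    define q where "q = (y + l) / 2"
    have q: "l < q" "q < y" using y by (auto simp: q_def)
    have "\<forall>\<^sub>F n in sequentially. (a n - a (Suc n)) / (b n - b (Suc n)) < q"
      using lim q by (intro order_tendstoD)
    then have "\<forall>\<^sub>F n in sequentially. q * b (Suc n) - a (Suc n) \<le> q * b n - a n"
    proof eventually_elim
      case (elim n)
      then have "a n - a (Suc n) < q * (b n - b (Suc n))"
        using dec[of n] by (simp add: pos_divide_less_eq)
      then show ?case by (simp add: algebra_simps)
    qed
    moreover have "(\<lambda>n. q * b n - a n) \<longlonglongrightarrow> q * 0 - 0"
      by (intro tendsto_intros a b)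
    ultimately have "\<forall>\<^sub>F n in sequentially. 0 \<le> q * b n - a n" by (intro tail) auto
    then show "\<forall>\<^sub>F n in sequentially. a n / b n < y"
    proof eventually_elim
      case (elim n)
      then have "a n / b n \<le> q" using b_pos[of n] by (simp add: pos_divide_le_eq)
      then show ?case using q by simp
    qed
  qed
qed

text \<open>By \<open>edge\<close>, finitely many terms at either end are negligible in the
  self-convolution of \<open>g\<close>, so both indices may be taken large, where \<open>f\<close>
  is close to \<open>c * g\<close>.\<close>

lemma convolution_asymp:
  fixes f g :: "nat \<Rightarrow> real"
  assumes g: "\<And>n. g n > 0" and lim: "(\<lambda>n. f n / g n) \<longlonglongrightarrow> c"
    and edge: "\<And>i. (\<lambda>n. g (n - i) / (\<Sum>j\<le>n. g j * g (n - j))) \<longlonglongrightarrow> 0"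
  shows "(\<lambda>n. (\<Sum>j\<le>n. f j * f (n - j)) / (\<Sum>j\<le>n. g j * g (n - j))) \<longlonglongrightarrow> c\<^sup>2"
proof -
  define h where "h n = f n / g n" for n
  define G where "G n = (\<Sum>j\<le>n. g j * g (n - j))" for n
  have G: "G n > 0" for n unfolding G_def using g by (intro sum_pos) auto
  have f: "f n = h n * g n" for n using g[of n] by (simp add: h_def)
  have "Bseq h" using lim unfolding h_def by (intro convergent_imp_Bseq) (auto simp: convergent_def)
  then obtain K where K: "K > 0" "\<And>n. \<bar>h n\<bar> \<le> K" by (auto simp: Bseq_def)
  have c: "\<bar>c\<bar> \<le> K"
    using tendsto_rabs[OF lim] K by (intro tendsto_upperbound[of "\<lambda>n. \<bar>f n / g n\<bar>"]) (auto simp: h_def)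
  have hh: "\<bar>h i * h j - c\<^sup>2\<bar> \<le> K * (\<bar>h i - c\<bar> + \<bar>h j - c\<bar>)" for i j
  proof -
    have "h i * h j - c\<^sup>2 = h j * (h i - c) + c * (h j - c)" by algebra
    then have "\<bar>h i * h j - c\<^sup>2\<bar> \<le> \<bar>h j * (h i - c)\<bar> + \<bar>c * (h j - c)\<bar>"
      using abs_triangle_ineq by metis
    also have "\<dots> = \<bar>h j\<bar> * \<bar>h i - c\<bar> + \<bar>c\<bar> * \<bar>h j - c\<bar>" by (simp add: abs_mult)
    also have "\<dots> \<le> K * \<bar>h i - c\<bar> + K * \<bar>h j - c\<bar>"
      using K c by (intro add_mono mult_right_mono) auto
    finally show ?thesis by (simp add: distrib_left)
  qed
  have "(\<lambda>n. (\<Sum>j\<le>n. f j * f (n - j)) / G n - c\<^sup>2) \<longlonglongrightarrow> 0"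
  proof (rule metric_LIMSEQ_I)
    fix r :: real assume r: "r > 0"
    \<comment> \<open>The closeness error enters once for each factor of the product, each time
      multiplied by \<open>K\<close>; this \<open>s\<close> makes its share
      \<open>r / 2\<close>.\<close>
    define s where "s = r / (4 * K)"
    have s: "s > 0" using r K by (simp add: s_def)
    obtain M where M: "\<And>n. n \<ge> M \<Longrightarrow> \<bar>h n - c\<bar> < s"
      using lim s unfolding h_def lim_sequentially dist_real_def by blast
    have "(\<lambda>n. \<Sum>i<M. 2 * K * (2 * K * g i * (g (n - i) / G n))) \<longlonglongrightarrow> (\<Sum>i<M. 2 * K * (2 * K * g i * 0))"
      unfolding G_def by (intro tendsto_intros edge)
    then have "\<forall>\<^sub>F n in sequentially. (\<Sum>i<M. 2 * K * (2 * K * g i * (g (n - i) / G n))) < r / 2"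
      using r by (intro order_tendstoD) auto
    moreover have "\<forall>\<^sub>F n in sequentially. n \<ge> M" by (rule eventually_ge_at_top)
    ultimately have "\<forall>\<^sub>F n in sequentially. dist ((\<Sum>j\<le>n. f j * f (n - j)) / G n - c\<^sup>2) 0 < r"
    proof eventually_elim
      case (elim n)
      have bound: "\<bar>h i - c\<bar> \<le> s + (if i < M then 2 * K else 0)" for i
        using M[of i] K(2)[of i] c s by auto
      have "(\<Sum>j\<le>n. f j * f (n - j)) - c\<^sup>2 * G n = (\<Sum>j\<le>n. (h j * h (n - j) - c\<^sup>2) * (g j * g (n - j)))"
      proof -
        have "(\<Sum>j\<le>n. f j * f (n - j)) = (\<Sum>j\<le>n. h j * h (n - j) * (g j * g (n - j)))"
          by (intro sum.cong refl) (simp add: f mult_ac)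
        then show ?thesis by (simp only: G_def sum_distrib_left left_diff_distrib sum_subtractf)
      qed
      then have "\<bar>(\<Sum>j\<le>n. f j * f (n - j)) - c\<^sup>2 * G n\<bar> \<le> (\<Sum>j\<le>n. \<bar>(h j * h (n - j) - c\<^sup>2) * (g j * g (n - j))\<bar>)"
        by (simp only: sum_abs)
      also have "\<dots> \<le> (\<Sum>j\<le>n. K * (\<bar>h j - c\<bar> + \<bar>h (n - j) - c\<bar>) * (g j * g (n - j)))"
      proof (intro sum_mono)
        fix j
        have gg: "0 < g j * g (n - j)" using g by simp
        have "\<bar>(h j * h (n - j) - c\<^sup>2) * (g j * g (n - j))\<bar> = \<bar>h j * h (n - j) - c\<^sup>2\<bar> * (g j * g (n - j))"
          unfolding abs_mult[of "h j * h (n - j) - c\<^sup>2"] using gg by simp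
        also have "\<dots> \<le> K * (\<bar>h j - c\<bar> + \<bar>h (n - j) - c\<bar>) * (g j * g (n - j))"
          using gg by (intro mult_right_mono hh) simp
        finally show "\<bar>(h j * h (n - j) - c\<^sup>2) * (g j * g (n - j))\<bar>
          \<le> K * (\<bar>h j - c\<bar> + \<bar>h (n - j) - c\<bar>) * (g j * g (n - j))" .
      qed
      also have "\<dots> = (\<Sum>j\<le>n. K * \<bar>h j - c\<bar> * (g j * g (n - j))) + (\<Sum>j\<le>n. K * \<bar>h (n - j) - c\<bar> * (g j * g (n - j)))"
        by (simp only: sum.distrib[symmetric] distrib_left distrib_right)
      also have "(\<Sum>j\<le>n. K * \<bar>h (n - j) - c\<bar> * (g j * g (n - j))) = (\<Sum>j\<le>n. K * \<bar>h j - c\<bar> * (g j * g (n - j)))"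
        by (rule sum.reindex_bij_witness[of _ "\<lambda>i. n - i" "\<lambda>i. n - i"]) auto
      also have "(\<Sum>j\<le>n. K * \<bar>h j - c\<bar> * (g j * g (n - j)))
          \<le> (\<Sum>j\<le>n. K * (s + (if j < M then 2 * K else 0)) * (g j * g (n - j)))"
        using K by (intro sum_mono mult_right_mono mult_left_mono mult_nonneg_nonneg bound less_imp_le[OF g]) simp
      also have "\<dots> = (\<Sum>j\<le>n. K * s * (g j * g (n - j)) + (if j < M then K * (2 * K) * (g j * g (n - j)) else 0))"
        by (intro sum.cong refl) (auto simp: algebra_simps)
      also have "\<dots> = K * s * G n + (\<Sum>j\<le>n. if j < M then K * (2 * K) * (g j * g (n - j)) else 0)"
        by (simp add: sum.distrib G_def sum_distrib_left)
      also have "(\<Sum>j\<le>n. if j < M then K * (2 * K) * (g j * g (n - j)) else 0)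
          = (\<Sum>j<M. K * (2 * K) * (g j * g (n - j)))"
        using elim by (intro sum.mono_neutral_cong_right) auto
      finally have 1: "\<bar>(\<Sum>j\<le>n. f j * f (n - j)) - c\<^sup>2 * G n\<bar>
          \<le> 2 * (K * s * G n + (\<Sum>j<M. K * (2 * K) * (g j * g (n - j))))" by simp
      have "dist ((\<Sum>j\<le>n. f j * f (n - j)) / G n - c\<^sup>2) 0 = \<bar>(\<Sum>j\<le>n. f j * f (n - j)) - c\<^sup>2 * G n\<bar> / G n"
      proof -
        have "(\<Sum>j\<le>n. f j * f (n - j)) / G n - c\<^sup>2 = ((\<Sum>j\<le>n. f j * f (n - j)) - c\<^sup>2 * G n) / G n"
          using G[of n] by (simp add: diff_divide_distrib)
        then show ?thesis using G[of n] by (simp only: dist_real_def diff_0_right abs_divide abs_of_pos)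
      qed
      also have "\<dots> \<le> 2 * (K * s * G n + (\<Sum>j<M. K * (2 * K) * (g j * g (n - j)))) / G n"
        using 1 G[of n] by (intro divide_right_mono) auto
      also have "\<dots> = 2 * K * s + (\<Sum>i<M. 2 * K * (2 * K * g i * (g (n - i) / G n)))"
        using G[of n] by (simp add: add_divide_distrib sum_divide_distrib sum_distrib_left mult_ac)
      also have "\<dots> < 2 * K * s + r / 2" using elim by simp
      also have "\<dots> = r" using K by (simp add: s_def)
      finally show ?case .
    qed
    then show "\<exists>no. \<forall>n\<ge>no. dist ((\<Sum>j\<le>n. f j * f (n - j)) / G n - c\<^sup>2) 0 < r"
      by (auto simp: eventually_sequentially)
  qed
  then show ?thesis unfolding G_def by (simp add: LIM_zero_iff)
qed

text \<open>Squaring \<open>(1 - X) powr (- z)\<close>, coefficient by coefficient.\<close>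

lemma pochhammer_convolution:
  fixes z :: real
  shows "(\<Sum>j\<le>n. pochhammer z j / fact j * (pochhammer z (n - j) / fact (n - j))) = pochhammer (2 * z) n / fact n"
proof -
  have "pochhammer (z + z) n = (\<Sum>j\<le>n. of_nat (n choose j) * pochhammer z j * pochhammer z (n - j))"
    by (rule pochhammer_binomial_sum)
  also have "\<dots> = (\<Sum>j\<le>n. fact n * (pochhammer z j / fact j * (pochhammer z (n - j) / fact (n - j))))"
    by (intro sum.cong refl) (simp add: binomial_fact)
  finally have "pochhammer (2 * z) n
      = fact n * (\<Sum>j\<le>n. pochhammer z j / fact j * (pochhammer z (n - j) / fact (n - j)))"
    unfolding mult_2 sum_distrib_left .
  then show ?thesis by simp
qed

lemma powr_edge_asymp:
  fixes c :: real
  assumes "c < 1"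
  shows "(\<lambda>n. real n powr (2 * c - 1) * (real n - real i) powr (- c)) \<longlonglongrightarrow> 0"
proof -
  have "(\<lambda>n. real n powr (c - 1) * (real n / (real n - real i)) powr c) \<longlonglongrightarrow> 0 * 1 powr c"
  proof (intro tendsto_mult tendsto_powr tendsto_const)
    show "(\<lambda>n. real n powr (c - 1)) \<longlonglongrightarrow> 0"
      using assms by (intro tendsto_neg_powr filterlim_real_sequentially) simp
    show "(\<lambda>n. real n / (real n - real i)) \<longlonglongrightarrow> 1" by real_asymp
  qed simp
  moreover have "\<forall>\<^sub>F n in sequentially. real n powr (c - 1) * (real n / (real n - real i)) powr c
      = real n powr (2 * c - 1) * (real n - real i) powr (- c)"
    using eventually_gt_at_top[of i]
  proof eventually_elim
    case (elim n)
    then have n: "real n > 0" "real n - real i > 0" by auto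
    have "real n powr (2 * c - 1) = real n powr (c - 1) * real n powr c"
      by (simp add: powr_add[symmetric])
    then show ?case using n by (simp add: powr_divide powr_minus_divide)
  qed
  ultimately show ?thesis by (simp add: tendsto_cong)
qed

context tail_recursion
begin

section \<open>The range of \<open>beta\<close> and the exact order of \<open>u\<close>\<close>

lemma rho_tendsto: "rho \<longlonglongrightarrow> beta"
proof -
  obtain K e where Ke: "0 < K" "0 < e" "\<And>n. \<bar>rho n - beta\<bar> \<le> K * (real n + 1) powr (- e)"
    using rho_rate by blast
  have "(\<lambda>n. K * (real n + 1) powr (- e)) \<longlonglongrightarrow> 0" using Ke by real_asymp
  then have "(\<lambda>n. rho n - beta) \<longlonglongrightarrow> 0"
    by (rule Lim_null_comparison[rotated]) (use Ke in auto)
  then show ?thesis by (simp add: LIM_zero_iff)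
qed

text \<open>Otherwise \<open>rho\<close> would eventually exceed \<open>1 - eta / 2\<close>, so
  \<open>u n\<close> would be at most of order \<open>n powr (eta / 2 - 1)\<close> and, by
  \<open>T_upper\<close>, \<open>T n\<close> at most of order \<open>n powr (eta / 2)\<close>; but
  \<open>T_powr\<close> forces at least \<open>n powr eta\<close>.\<close>

lemma beta_less_1: "beta < 1"
proof (rule ccontr)
  assume "\<not> beta < 1"
  define c where "c = 1 - eta / 2"
  have c: "0 < c" "c < 1" "c < beta" using eta \<open>\<not> beta < 1\<close> by (auto simp: c_def)
  have "\<forall>\<^sub>F n in sequentially. c < rho n" using rho_tendsto c by (intro order_tendstoD)
  then obtain M where M: "\<And>n. n \<ge> M \<Longrightarrow> c < rho n" by (auto simp: eventually_sequentially)
  have dec: "(real (M + n) + 1) powr c * u (M + n) \<le> (real M + 1) powr c * u M" for n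
  proof (induction n)
    case (Suc n)
    have "c * u (M + n) \<le> x (M + n)"
      using M[of "M + n"] u_pos[of "M + n"] by (simp add: x_eq_rho)
    then have "(real (M + n) + 2) powr c * u (Suc (M + n)) \<le> (real (M + n) + 1) powr c * u (M + n)"
      by (intro u_powr_step c)
    moreover have "real (M + Suc n) + 1 = real (M + n) + 2" by simp
    ultimately show ?case using Suc by (simp only: add_Suc_right)
  qed simp
  define A where "A = (real M + 1) powr c * u M"
  have "k powr (eta / 2) \<le> K_sum * A" if "k = real (M + n)" "M + n > 0" for k n
  proof -
    have k: "k > 0" using that(2) by (simp only: that(1) of_nat_0_less_iff)
    have T1: "T 1 = 1" by (simp add: T_def u_0)
    have "T 1 \<le> (real 1 / k) powr eta * T (M + n)"
      unfolding that(1) using that(2) by (intro T_powr) auto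
    then have "k powr eta \<le> T (M + n)" using k T1 by (simp add: powr_divide pos_le_divide_eq)
    also have "\<dots> \<le> K_sum * k * u (M + n)" unfolding that(1) using that(2) by (intro T_upper)
    finally have "k powr eta * k powr c \<le> K_sum * k * u (M + n) * k powr c"
      by (rule mult_right_mono) simp
    then have "k powr eta * k powr c \<le> K_sum * k * (k powr c * u (M + n))"
      by (simp add: mult_ac)
    also have "k powr c * u (M + n) \<le> (k + 1) powr c * u (M + n)"
      using k c by (intro mult_right_mono powr_mono2 less_imp_le[OF u_pos]) auto
    also have "\<dots> \<le> A" using dec[of n] by (simp add: that A_def)
    finally have "k powr eta * k powr c \<le> K_sum * k * A" using K_sum_ge_1 k by simp
    moreover have "k powr eta * k powr c = k powr (eta / 2) * k"
    proof -
      have "eta + c = eta / 2 + 1" by (simp add: c_def)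
      then have "k powr eta * k powr c = k powr (eta / 2 + 1)" by (simp only: powr_add[symmetric])
      then show ?thesis using k by (simp add: powr_add)
    qed
    ultimately show ?thesis using k by (simp add: mult_ac)
  qed
  then have le: "real n powr (eta / 2) \<le> K_sum * A" if "n \<ge> Suc M" for n
    using that by (metis Suc_leD Suc_le_lessD gr_zeroI le_add_diff_inverse not_less_zero)
  have "filterlim (\<lambda>n. real n powr s) at_top sequentially" if "s > 0" for s :: real
    using that by real_asymp
  from this[of "eta / 2"] have "filterlim (\<lambda>n. real n powr (eta / 2)) at_top sequentially"
    using eta by simp
  then have "\<forall>\<^sub>F n in sequentially. K_sum * A < real n powr (eta / 2)" by (simp add: filterlim_at_top_dense)
  then obtain n where "n \<ge> Suc M" "K_sum * A < real n powr (eta / 2)"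
    unfolding eventually_sequentially by (meson max.cobounded1 max.cobounded2)
  then show False using le[of n] by simp
qed

lemma beta_pos: "beta > 0"
proof -
  have "d 0 \<le> beta" using rho_tendsto rho_lower by (intro tendsto_lowerbound) auto
  then show ?thesis using d_pos[of 0] by linarith
qed

definition b :: "nat \<Rightarrow> real" where "b n = pochhammer (1 - beta) n / fact n"

lemma b_pos: "b n > 0"
  using beta_less_1 by (simp add: b_def pochhammer_pos)

lemma b_Suc: "b (Suc n) = b n * (1 - beta / (real n + 1))"
  by (simp add: b_def pochhammer_Suc field_simps)

lemma u_Suc: "u (Suc n) = u n * (1 - rho n / (real n + 1))"
proof -
  have "u n * (rho n / (real n + 1)) = x n / (real n + 1)" by (simp add: x_eq_rho mult.commute)
  also have "\<dots> = u n - u (Suc n)" by (simp add: x_def d_def)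
  finally show ?thesis by (simp add: right_diff_distrib)
qed

text \<open>The step factors of \<open>u\<close> and \<open>b\<close> are
  \<open>1 - rho n / (n + 1)\<close> and \<open>1 - beta / (n + 1)\<close>, so the quotient is a
  product of \<open>1 + t n\<close> with \<open>t n\<close> at most of order
  \<open>n powr (- 1 - e)\<close>. Summability of \<open>t\<close>, hence the rate of
  \<open>rho\<close>, excludes a slowly varying correction and a zero limit.\<close>

lemma u_over_b: "\<exists>c>0. (\<lambda>n. u n / b n) \<longlonglongrightarrow> c"
proof -
  obtain K e where Ke: "0 < K" "0 < e" "\<And>n. \<bar>rho n - beta\<bar> \<le> K * (real n + 1) powr (- e)"
    using rho_rate by blast
  define t where "t n = (beta - rho n) / (real n + 1 - beta)" for n
  have den: "real n + 1 - beta > 0" for n using beta_less_1 by simp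
  have step: "u (Suc n) / b (Suc n) = u n / b n * (1 + t n)" for n
  proof -
    define r where "r = real n + 1"
    have r: "r > 0" "r - beta > 0" using den[of n] by (auto simp: r_def)
    then have "1 + t n = (1 - rho n / r) / (1 - beta / r)"
      by (simp add: t_def r_def[symmetric] add_divide_eq_iff diff_divide_eq_iff)
    then show ?thesis by (simp add: u_Suc b_Suc r_def)
  qed
  have t: "1 + t n > 0" for n
  proof -
    have "u (Suc n) / b (Suc n) > 0" "u n / b n > 0" using u_pos b_pos by auto
    then show ?thesis unfolding step by (rule zero_less_mult_pos)
  qed
  have prod: "u (Suc n) / b (Suc n) = (\<Prod>i\<le>n. 1 + t i)" for n
    by (induction n) (simp_all only: step, simp_all add: u_0 b_def)
  have "summable (\<lambda>n. \<bar>t n\<bar>)"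
  proof (rule summable_comparison_test)
    show "\<exists>M. \<forall>n\<ge>M. norm \<bar>t n\<bar> \<le> K / (1 - beta) * real (Suc n) powr (- e - 1)"
    proof (intro exI allI impI)
      fix n
      have "(real n + 1) * (1 - beta) \<le> real n + 1 - beta"
        using beta_pos by (simp add: algebra_simps)
      then have "\<bar>t n\<bar> \<le> K * (real n + 1) powr (- e) / ((real n + 1) * (1 - beta))"
        unfolding t_def abs_divide using Ke(3)[of n] beta_less_1 beta_pos by (intro frac_le) auto
      also have "\<dots> = K / (1 - beta) * real (Suc n) powr (- e - 1)"
        by (simp add: powr_diff add.commute)
      finally show "norm \<bar>t n\<bar> \<le> K / (1 - beta) * real (Suc n) powr (- e - 1)" by simp
    qed
    have "summable (\<lambda>n. real n powr (- e - 1))" using Ke by (simp add: summable_real_powr_iff)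
    then have "summable (\<lambda>n. real (Suc n) powr (- e - 1))" by (subst summable_Suc_iff)
    then show "summable (\<lambda>n. K / (1 - beta) * real (Suc n) powr (- e - 1))" by (rule summable_mult)
  qed
  then have conv: "convergent_prod (\<lambda>k. 1 + t k)"
    using t by (intro summable_imp_convergent_prod_real) (auto simp: less_le add_eq_0_iff2)
  define c where "c = prodinf (\<lambda>k. 1 + t k)"
  have lim: "(\<lambda>n. \<Prod>i\<le>n. 1 + t i) \<longlonglongrightarrow> c" unfolding c_def by (rule convergent_prod_LIMSEQ[OF conv])
  have "c \<ge> 0" using t by (intro tendsto_lowerbound[OF lim]) (auto intro!: always_eventually prod_nonneg less_imp_le[OF t])
  moreover have "c \<noteq> 0" unfolding c_def using t by (simp add: prodinf_nonzero conv less_imp_neq[symmetric])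
  moreover have "(\<lambda>n. u (Suc n) / b (Suc n)) \<longlonglongrightarrow> c" using lim by (simp add: prod)
  then have "(\<lambda>n. u n / b n) \<longlonglongrightarrow> c" by (rule LIMSEQ_imp_Suc)
  ultimately show ?thesis by (auto intro!: exI[of _ c])
qed

text \<open>Differencing one factor gives the convolution of \<open>d\<close> and \<open>u\<close>,
  which is \<open>v (Suc n)\<close>; the new boundary term \<open>u (Suc n) * u 0\<close> removes
  its linear part.\<close>

lemma convolution_u_step: "(\<Sum>j\<le>n. u j * u (n - j)) - (\<Sum>j\<le>Suc n. u j * u (Suc n - j)) = lam * (u (Suc n))\<^sup>2"
proof -
  have "(\<Sum>j\<le>Suc n. u j * u (Suc n - j)) = (\<Sum>j\<le>n. u j * u (Suc n - j)) + u (Suc n)"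
    by (simp add: u_0)
  moreover have "(\<Sum>j\<le>n. u j * u (n - j)) - (\<Sum>j\<le>n. u j * u (Suc n - j)) = (\<Sum>j<Suc n. d (n - j) * u j)"
    unfolding sum_subtractf[symmetric] lessThan_Suc_atMost
    by (intro sum.cong refl) (auto simp: d_def Suc_diff_le algebra_simps)
  ultimately show ?thesis using a_sum_aux[of n] by (simp add: v_def u_0)
qed

text \<open>Summing \<open>convolution_u_step\<close> gives a conserved quantity; its convolution
  part is nonnegative, so the sum of squares stays bounded.\<close>

lemma summable_u_squared: "summable (\<lambda>n. (u n)\<^sup>2)"
proof (rule bounded_imp_summable)
  fix n
  have "(\<Sum>j\<le>n. u j * u (n - j)) + lam * (\<Sum>j\<le>n. (u j)\<^sup>2) = 1 + lam"
  proof (induction n)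
    case (Suc n)
    then show ?case using convolution_u_step[of n] by (simp add: distrib_left)
  qed (simp add: u_0)
  moreover have "0 \<le> (\<Sum>j\<le>n. u j * u (n - j))"
    by (intro sum_nonneg mult_nonneg_nonneg less_imp_le[OF u_pos])
  ultimately show "(\<Sum>j\<le>n. (u j)\<^sup>2) \<le> (1 + lam) / lam" using lam_pos by (simp add: field_simps)
qed auto

lemma u_asymp: "\<exists>c>0. (\<lambda>n. u n / b n) \<longlonglongrightarrow> c \<and>
  (\<lambda>n. u n * real n powr beta) \<longlonglongrightarrow> c * rGamma (1 - beta) \<and> c * rGamma (1 - beta) > 0"
proof -
  obtain c where c: "c > 0" "(\<lambda>n. u n / b n) \<longlonglongrightarrow> c" using u_over_b by blast
  have "(\<lambda>n. b n * real n powr beta) \<longlonglongrightarrow> rGamma (1 - beta)"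
    using pochhammer_asymp[of "1 - beta"] by (simp add: b_def)
  with c(2) have "(\<lambda>n. u n / b n * (b n * real n powr beta)) \<longlonglongrightarrow> c * rGamma (1 - beta)"
    by (rule tendsto_mult)
  moreover have "u n / b n * (b n * real n powr beta) = u n * real n powr beta" for n
    using b_pos[of n] by simp
  moreover have "rGamma (1 - beta) > 0"
    using beta_less_1 by (simp add: rGamma_inverse_Gamma)
  ultimately show ?thesis using c by (auto intro!: exI[of _ c])
qed

lemma beta_greater_half: "beta > 1 / 2"
proof -
  obtain L where L: "L > 0" "(\<lambda>n. u n * real n powr beta) \<longlonglongrightarrow> L" using u_asymp by blast
  have "\<forall>\<^sub>F n in sequentially. L / 2 < u n * real n powr beta" using L by (intro order_tendstoD) auto
  then have "\<forall>\<^sub>F n in sequentially. norm (real n powr (- 2 * beta)) \<le> (2 / L)\<^sup>2 * (u n)\<^sup>2"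
    using eventually_gt_at_top[of 0]
  proof eventually_elim
    case (elim n)
    have "real n powr (- beta) \<le> 2 / L * u n"
      using elim L by (simp add: powr_minus_divide field_simps)
    then have "(real n powr (- beta))\<^sup>2 \<le> (2 / L * u n)\<^sup>2" by (intro power_mono) auto
    moreover have "(real n powr (- beta))\<^sup>2 = real n powr (- 2 * beta)"
      by (simp add: power2_eq_square powr_add[symmetric])
    ultimately show ?case by (simp add: power_mult_distrib power_divide)
  qed
  then have "summable (\<lambda>n. real n powr (- 2 * beta))"
    by (rule summable_comparison_test_ev) (intro summable_mult summable_u_squared)
  then show ?thesis by (simp add: summable_real_powr_iff)
qed

text \<open>Two evaluations of the limit of \<open>s n / D n\<close>. Since \<open>u\<close> is
  asymptotic to \<open>c * b\<close>, \<open>convolution_asymp\<close> gives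
  \<open>c\<^sup>2\<close>; since \<open>s\<close> and \<open>D\<close> tend to 0 with known
  increments, Stolz-Cesaro gives \<open>l\<close>. The unknown \<open>c\<close> enters both
  quadratically and cancels.\<close>

lemma lam_eq: "lam = (2 * beta - 1) * (Gamma (1 - beta))\<^sup>2 / Gamma (2 - 2 * beta)"
proof -
  define D where "D n = pochhammer (2 - 2 * beta) n / fact n" for n
  define s where "s = (\<lambda>n. \<Sum>j\<le>n. u j * u (n - j))"
  have conv_b: "(\<Sum>j\<le>n. b j * b (n - j)) = D n" for n
    using pochhammer_convolution[of "1 - beta" n] by (simp add: b_def D_def)
  have D_pos: "D n > 0" for n using beta_less_1 by (simp add: D_def pochhammer_pos)
  define R where "R = rGamma (2 - 2 * beta)"
  have R: "R > 0" using beta_less_1 by (simp add: R_def rGamma_inverse_Gamma)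
  have D_lim: "(\<lambda>n. D n * real n powr (2 * beta - 1)) \<longlonglongrightarrow> R"
    using pochhammer_asymp[of "2 - 2 * beta"] by (simp add: D_def R_def algebra_simps)
  obtain c where c: "c > 0" "(\<lambda>n. u n / b n) \<longlonglongrightarrow> c"
      "(\<lambda>n. u n * real n powr beta) \<longlonglongrightarrow> c * rGamma (1 - beta)" using u_asymp by blast
  have "(\<lambda>n. real n powr (1 - 2 * beta)) \<longlonglongrightarrow> 0" using beta_greater_half
    by (intro tendsto_neg_powr filterlim_real_sequentially) simp
  with D_lim have "(\<lambda>n. D n * real n powr (2 * beta - 1) * real n powr (1 - 2 * beta)) \<longlonglongrightarrow> R * 0"
    by (rule tendsto_mult)
  moreover have "\<forall>\<^sub>F n in sequentially. D n * real n powr (2 * beta - 1) * real n powr (1 - 2 * beta) = D n"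
    using eventually_gt_at_top[of 0] by eventually_elim (simp add: powr_add[symmetric] mult.assoc)
  ultimately have D_0: "D \<longlonglongrightarrow> 0" by (simp add: tendsto_cong)
  have edge: "(\<lambda>n. b (n - i) / D n) \<longlonglongrightarrow> 0" for i
  proof -
    have b_lim: "(\<lambda>n. b n * real n powr beta) \<longlonglongrightarrow> rGamma (1 - beta)"
      using pochhammer_asymp[of "1 - beta"] by (simp add: b_def)
    then have "(\<lambda>n. b (n - i) * real (n - i) powr beta) \<longlonglongrightarrow> rGamma (1 - beta)"
      by (rule filterlim_compose) (rule filterlim_minus_const_nat_at_top)
    moreover have "(\<lambda>n. real n powr (2 * beta - 1) * (real n - real i) powr (- beta)) \<longlonglongrightarrow> 0"
      by (rule powr_edge_asymp[OF beta_less_1])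
    ultimately have "(\<lambda>n. b (n - i) * real (n - i) powr beta * (real n powr (2 * beta - 1) * (real n - real i) powr (- beta))
        / (D n * real n powr (2 * beta - 1))) \<longlonglongrightarrow> rGamma (1 - beta) * 0 / R"
      using R by (intro tendsto_intros D_lim) auto
    moreover have "\<forall>\<^sub>F n in sequentially. b (n - i) * real (n - i) powr beta
        * (real n powr (2 * beta - 1) * (real n - real i) powr (- beta)) / (D n * real n powr (2 * beta - 1)) = b (n - i) / D n"
      using eventually_gt_at_top[of i]
    proof eventually_elim
      case (elim n)
      then have "real (n - i) = real n - real i" "real n > 0" "real n - real i > 0" by auto
      then show ?case using D_pos[of n] by (simp add: powr_minus_divide)
    qed
    ultimately show ?thesis by (simp add: tendsto_cong)
  qed
  have lim1: "(\<lambda>n. s n / D n) \<longlonglongrightarrow> c\<^sup>2"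
    using convolution_asymp[of b u c] b_pos c(2) edge unfolding s_def conv_b by simp
  have "(\<lambda>n. s n / D n * D n) \<longlonglongrightarrow> c\<^sup>2 * 0" by (intro tendsto_mult lim1 D_0)
  then have s_0: "s \<longlonglongrightarrow> 0" using D_pos by (simp add: less_imp_neq[symmetric])
  have D_step: "D n - D (Suc n) = D (Suc n) * (2 * beta - 1) / (real n + 2 - 2 * beta)" for n
  proof -
    define r q where "r = real n + 1" and "q = real n + 2 - 2 * beta"
    have rq: "r > 0" "q > 0" "r - q = 2 * beta - 1" using beta_less_1 by (auto simp: r_def q_def)
    have "D (Suc n) = D n * (q / r)"
      by (simp add: D_def pochhammer_Suc r_def q_def algebra_simps)
    moreover have "1 - q / r = (2 * beta - 1) / r"
      using rq(1) by (simp add: rq(3)[symmetric] diff_divide_distrib)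
    moreover have "D n - D n * (q / r) = D n * (1 - q / r)" by (simp add: algebra_simps)
    ultimately show ?thesis using rq(1,2) unfolding q_def[symmetric] by simp
  qed
  have D_dec: "D (Suc n) < D n" for n
  proof -
    have "0 < D (Suc n) * (2 * beta - 1) / (real n + 2 - 2 * beta)"
      using D_pos[of "Suc n"] beta_greater_half beta_less_1 by (intro divide_pos_pos mult_pos_pos) auto
    then show ?thesis using D_step[of n] by linarith
  qed
  \<comment> \<open>With \<open>m = Suc n\<close> the ratio of increments is \<open>lam * (u
    m)\<^sup>2 * (m + 1 - 2 * beta) / (D m * (2 * beta - 1))\<close>; the powers of \<open>m\<close>
    cancel to leading order and only the limiting constants of \<open>u\<close> and \<open>D\<close>
    remain.\<close>
  define l where "l = lam * (c * rGamma (1 - beta))\<^sup>2 / (R * (2 * beta - 1))"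
  have "(\<lambda>m. lam * (u m * real m powr beta)\<^sup>2 * ((real m + 1 - 2 * beta) / real m)
      / (D m * real m powr (2 * beta - 1) * (2 * beta - 1))) \<longlonglongrightarrow> lam * (c * rGamma (1 - beta))\<^sup>2 * 1 / (R * (2 * beta - 1))"
  proof -
    have "(\<lambda>m. (real m + 1 - s) / real m) \<longlonglongrightarrow> 1" for s :: real by real_asymp
    from tendsto_mult[OF tendsto_mult[OF tendsto_const tendsto_power[OF c(3)]] this]
      and tendsto_mult[OF D_lim tendsto_const]
    show ?thesis by (rule tendsto_divide) (use R beta_greater_half in auto)
  qed
  then have "(\<lambda>n. lam * (u (Suc n) * real (Suc n) powr beta)\<^sup>2 * ((real (Suc n) + 1 - 2 * beta) / real (Suc n))
      / (D (Suc n) * real (Suc n) powr (2 * beta - 1) * (2 * beta - 1))) \<longlonglongrightarrow> l"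
    unfolding l_def mult_1_right by (rule LIMSEQ_Suc)
  moreover have "lam * (u (Suc n) * real (Suc n) powr beta)\<^sup>2 * ((real (Suc n) + 1 - 2 * beta) / real (Suc n))
      / (D (Suc n) * real (Suc n) powr (2 * beta - 1) * (2 * beta - 1)) = (s n - s (Suc n)) / (D n - D (Suc n))" for n
  proof -
    define m where "m = real (Suc n)"
    have m: "m > 0" "real n + 2 - 2 * beta = m + 1 - 2 * beta" "m + 1 - 2 * beta > 0"
      using beta_less_1 by (auto simp: m_def)
    have "m powr (2 * beta - 1) = (m powr beta)\<^sup>2 / m"
      using m by (simp add: powr_diff power2_eq_square powr_add[symmetric])
    moreover have "lam * (w * P)\<^sup>2 * (q / m) / (E * (P\<^sup>2 / m) * g) = lam * w\<^sup>2 / (E * g / q)"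
      if "P > 0" "q > 0" "E > 0" "g > 0" for w P q E g :: real
      using that m(1) by (simp add: field_simps power2_eq_square)
    moreover have "s n - s (Suc n) = lam * (u (Suc n))\<^sup>2" unfolding s_def by (rule convolution_u_step)
    ultimately show ?thesis
      unfolding D_step m_def[symmetric] m(2) using m D_pos[of "Suc n"] beta_greater_half by simp
  qed
  ultimately have "(\<lambda>n. (s n - s (Suc n)) / (D n - D (Suc n))) \<longlonglongrightarrow> l" by simp
  then have "(\<lambda>n. s n / D n) \<longlonglongrightarrow> l" by (rule stolz_cesaro_null[OF s_0 D_0 D_dec])
  with lim1 have "c\<^sup>2 = l" by (rule LIMSEQ_unique)
  then have "c\<^sup>2 * (R * (2 * beta - 1)) = c\<^sup>2 * (lam * (rGamma (1 - beta))\<^sup>2)"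
    using R beta_greater_half by (simp add: l_def power_mult_distrib field_simps)
  then have "R * (2 * beta - 1) = lam * (rGamma (1 - beta))\<^sup>2" using c(1) by simp
  moreover have "Gamma (1 - beta) > 0" using beta_less_1 by simp
  ultimately show ?thesis by (simp add: R_def rGamma_inverse_Gamma field_simps power2_eq_square)
qed

section \<open>Second moments\<close>

lemma convolution_u_upper: "(\<Sum>i<k. u i * u (k - 1 - i)) \<le> K_sum * u k * T k"
proof (cases "k = 0")
  case False
  have c: "0 < d 0" using d_pos .
  have "d 0 * (\<Sum>i<k. u i * u (k - 1 - i)) = (\<Sum>i<k. d 0 * u i * u (k - 1 - i))"
    by (simp add: sum_distrib_left mult.assoc)
  also have "\<dots> \<le> (\<Sum>i<k. x i * u (k - 1 - i))"
    by (intro sum_mono mult_right_mono x_lower less_imp_le[OF u_pos])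
  also have "\<dots> \<le> K_drift * u k * (real k * u k)"
    using a_drift_x[of k] False by (simp add: power2_eq_square mult_ac)
  also have "\<dots> \<le> K_drift * u k * T k"
    using K_drift_ge_1 u_pos[of k] by (intro mult_left_mono T_lower') auto
  finally show ?thesis using c by (simp add: K_sum_def field_simps)
qed (simp add: T_def)

definition K_conv :: real where "K_conv = 4 * K_sum + 8 * K_sum / eta"

lemma K_conv_pos: "K_conv > 0" using K_sum_ge_1 eta by (simp add: K_conv_def add_pos_pos)

text \<open>Split at \<open>k / 2\<close>: below it \<open>u (k - 1 - i)\<close> is comparable to
  \<open>u k\<close> and \<open>u_weighted_sum\<close> handles the weight; above it the weight is
  comparable to \<open>k powr (- e)\<close> and the plain convolution remains.\<close>

lemma weighted_convolution_upper:
  assumes e: "0 < e" "e \<le> eta / 2" and k: "k > 0"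
  shows "(\<Sum>i<k. (real i + 1) powr (- e) * u i * u (k - 1 - i)) \<le> K_conv * (real k + 1) powr (- e) * (u k * T k)"
proof -
  have e1: "e \<le> 1" using e eta by simp
  have kpos: "real k > 0" using k by simp
  \<comment> \<open>Halving the base of a power with exponent \<open>- e\<close> costs at most a
    factor 2; this serves for \<open>k\<close> against \<open>k + 1\<close> and for \<open>i\<close>
    against \<open>k\<close>.\<close>
  have two: "2 powr e \<le> (2::real)" using e1 powr_mono[of e 1 2] by simp
  have "real k powr (- e) \<le> ((real k + 1) / 2) powr (- e)" using k e by (intro powr_mono2') auto
  also have "\<dots> = 2 powr e * (real k + 1) powr (- e)"
    by (simp add: powr_divide powr_minus_divide)
  also have "\<dots> \<le> 2 * (real k + 1) powr (- e)" using two by (intro mult_right_mono) auto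
  finally have kk: "real k powr (- e) \<le> 2 * (real k + 1) powr (- e)" .
  have "(\<Sum>i<k. (real i + 1) powr (- e) * u i * u (k - 1 - i))
      \<le> (\<Sum>i<k. real k powr (- e) * (2 * K_sum * u k) * (u i * (real k / (real i + 1)) powr e)
          + 2 * real k powr (- e) * (u i * u (k - 1 - i)))"
  proof (intro sum_mono)
    fix i assume i: "i \<in> {..<k}"
    have pos: "0 < u i" "0 < u (k - 1 - i)" "0 < u k" by (rule u_pos)+
    show "(real i + 1) powr (- e) * u i * u (k - 1 - i)
      \<le> real k powr (- e) * (2 * K_sum * u k) * (u i * (real k / (real i + 1)) powr e)
          + 2 * real k powr (- e) * (u i * u (k - 1 - i))"
    proof (cases "2 * i \<le> k")
      case True
      have "u (k - 1 - i) \<le> K_sum * real k / (real (k - 1 - i) + 1) * u k"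
        using i by (intro u_le_shift) auto
      also have "\<dots> = K_sum * u k * (real k / (real (k - 1 - i) + 1))" by simp
      also have "\<dots> \<le> K_sum * u k * 2"
        using i True K_sum_ge_1 pos by (intro mult_left_mono) (auto simp: divide_le_eq of_nat_diff)
      finally have "(real i + 1) powr (- e) * u i * u (k - 1 - i) \<le> (real i + 1) powr (- e) * u i * (K_sum * u k * 2)"
        using pos by (intro mult_left_mono) auto
      also have "\<dots> = real k powr (- e) * (2 * K_sum * u k) * (u i * (real k / (real i + 1)) powr e)"
        using kpos by (simp add: powr_divide powr_minus_divide)
      finally show ?thesis using pos by (smt (verit) mult_nonneg_nonneg powr_ge_zero)
    next
      case False
      have "(real i + 1) powr (- e) \<le> (real k / 2) powr (- e)"
        using False kpos e by (intro powr_mono2') auto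
      also have "\<dots> = 2 powr e * real k powr (- e)" by (simp add: powr_divide powr_minus_divide)
      also have "\<dots> \<le> 2 * real k powr (- e)" using two by (intro mult_right_mono) auto
      finally have "(real i + 1) powr (- e) * (u i * u (k - 1 - i)) \<le> 2 * real k powr (- e) * (u i * u (k - 1 - i))"
        using pos by (intro mult_right_mono) auto
      moreover have "0 \<le> real k powr (- e) * (2 * K_sum * u k) * (u i * (real k / (real i + 1)) powr e)"
        using pos K_sum_ge_1 by (intro mult_nonneg_nonneg) auto
      ultimately show ?thesis unfolding mult.assoc by linarith
    qed
  qed
  also have "\<dots> = real k powr (- e) * (2 * K_sum * u k) * (\<Sum>i<k. u i * (real k / (real i + 1)) powr e)
      + 2 * real k powr (- e) * (\<Sum>i<k. u i * u (k - 1 - i))"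
    by (simp only: sum.distrib sum_distrib_left)
  also have "\<dots> \<le> real k powr (- e) * (2 * K_sum * u k) * (2 / eta * T k) + 2 * real k powr (- e) * (K_sum * u k * T k)"
  proof (intro add_mono mult_left_mono convolution_u_upper)
    show "(\<Sum>i<k. u i * (real k / (real i + 1)) powr e) \<le> 2 / eta * T k"
      using u_weighted_sum[OF e, of k k] k by simp
  qed (use K_sum_ge_1 u_pos[of k] in auto)
  also have "\<dots> = real k powr (- e) * ((4 * K_sum / eta + 2 * K_sum) * (u k * T k))"
    by (simp add: algebra_simps)
  also have "\<dots> \<le> 2 * (real k + 1) powr (- e) * ((4 * K_sum / eta + 2 * K_sum) * (u k * T k))"
    using kk K_sum_ge_1 eta u_pos[of k] T_nonneg[of k] by (intro mult_right_mono) auto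
  also have "\<dots> = K_conv * (real k + 1) powr (- e) * (u k * T k)"
    by (simp add: K_conv_def algebra_simps)
  finally show ?thesis .
qed

text \<open>Concavity puts the power below its tangent at \<open>k\<close>, so averaging loses at
  least \<open>(1 - e) * (k + 1) powr (- e)\<close> times the mean step; by \<open>x_lower\<close>
  the mean step is at least \<open>d 0 * (u k * T k)\<close>. The factor 1/2 is the lower bound for
  \<open>1 - e\<close>.\<close>

lemma supersolution:
  assumes e: "0 < e" "e \<le> eta / 2" and k: "k > 0"
  shows "(\<Sum>i<k. a k i * (real i + 1) powr (1 - e)) + (1 / 2) * d 0 * (real k + 1) powr (- e) * (u k * T k)
    \<le> v k * (real k + 1) powr (1 - e)"
proof -
  have e1: "0 < 1 - e" "1 - e < 1" "1 / 2 \<le> 1 - e" using e eta by auto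
  define P where "P = (real k + 1) powr (- e)"
  have P: "P > 0" "(real k + 1) powr (1 - e) = P * (real k + 1)"
    by (auto simp: P_def powr_diff powr_minus_divide)
  have "(real i + 1) powr (1 - e) \<le> P * (real k + 1) - (1 - e) * P * real (k - i)" if "i < k" for i
  proof -
    define y where "y = (real i + 1) / (real k + 1)"
    have "(real i + 1) powr (1 - e) = (real k + 1) powr (1 - e) * y powr (1 - e)"
      by (simp add: y_def powr_divide)
    also have "\<dots> \<le> (real k + 1) powr (1 - e) * (1 + (1 - e) * (y - 1))"
      using e1 by (intro mult_left_mono powr_le_tangent) (auto simp: y_def)
    also have "\<dots> = P * (real k + 1) + (1 - e) * P * ((real k + 1) * (y - 1))"
      unfolding P(2) by (simp add: algebra_simps)
    also have "(real k + 1) * (y - 1) = - real (k - i)"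
      using that by (simp add: y_def field_simps of_nat_diff)
    finally show ?thesis by simp
  qed
  then have "(\<Sum>i<k. a k i * (real i + 1) powr (1 - e))
      \<le> (\<Sum>i<k. a k i * (P * (real k + 1) - (1 - e) * P * real (k - i)))"
    by (intro sum_mono mult_left_mono less_imp_le[OF a_pos]) auto
  also have "\<dots> = (\<Sum>i<k. a k i) * (P * (real k + 1)) - (1 - e) * P * (\<Sum>i<k. a k i * real (k - i))"
    unfolding sum_distrib_left sum_distrib_right sum_subtractf[symmetric]
    by (intro sum.cong refl) (simp add: algebra_simps)
  also have "\<dots> \<le> v k * (P * (real k + 1)) - (1 / 2) * P * (d 0 * (u k * T k))"
  proof -
    have "d 0 * (u k * T k) = (\<Sum>i<k. d 0 * u (k - 1 - i) * u k)"
    proof -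
      have "T k = (\<Sum>i<k. u (k - 1 - i))" unfolding T_def
        by (rule sum.reindex_bij_witness[of _ "\<lambda>i. k - 1 - i" "\<lambda>i. k - 1 - i"]) auto
      then show ?thesis by (simp add: sum_distrib_left mult_ac)
    qed
    also have "\<dots> \<le> (\<Sum>i<k. x (k - 1 - i) * u i)"
      by (intro sum_mono mult_mono x_lower u_antimono less_imp_le[OF u_pos] less_imp_le[OF x_pos]) auto
    also have "\<dots> = (\<Sum>i<k. a k i * real (k - i))"
      by (intro sum.cong refl) (auto simp: x_def a_def of_nat_diff)
    finally have "(1 / 2) * P * (d 0 * (u k * T k)) \<le> (1 - e) * P * (\<Sum>i<k. a k i * real (k - i))"
      using e1 P u_pos[of k] T_nonneg[of k] d_pos[of 0] by (intro mult_mono) auto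
    then show ?thesis using a_sum[OF k] by simp
  qed
  finally show ?thesis unfolding P(2) P_def[symmetric] by (simp add: mult_ac)
qed

text \<open>With \<open>mu k\<close> twice the second moment of \<open>N\<close> on
  \<open>LIS = k + 1\<close>, the bounded expression is the second moment of
  \<open>N - al * (k + 1)\<close> there. The sequence \<open>(k + 1) * u k\<close> solves the
  recursion of \<open>mu\<close> with \<open>x i\<close> in place of \<open>u i / 2\<close> in the
  source; as \<open>x\<close> is close to \<open>beta * u\<close>, the choice
  \<open>al * beta = 1 / 2\<close> makes the sources of \<open>mu\<close> and
  \<open>al * (k + 1) * u k\<close> agree to leading order.\<close>

lemma second_moment_bound:
  fixes mu :: "nat \<Rightarrow> real"
  defines "al \<equiv> 1 / (2 * beta)"
  assumes mu_rec: "\<And>k. k > 0 \<Longrightarrow> mu k * (1 + lam * u k)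
    = (\<Sum>i<k. d (k - 1 - i) * mu i) + (\<Sum>i<k. u i * u (k - 1 - i)) / 2"
  shows "\<exists>K e. 0 < K \<and> 0 < e \<and> (\<forall>k. mu k / 2 - al * (real k + 1) * u k + al\<^sup>2 * (real k + 1) * x k
    \<le> K * (real k + 1) powr (1 - e) * u k)"
proof -
  obtain K e where Ke: "0 < K" "0 < e" "e \<le> eta / 2" "\<And>n. \<bar>rho n - beta\<bar> \<le> K * (real n + 1) powr (- e)"
    using rho_rate by blast
  have al: "al > 0" "al * beta = 1 / 2" using beta_pos by (auto simp: al_def)
  define D where "D k = mu k - al * (real k + 1) * u k" for k
  have xu: "\<bar>u i / 2 - al * x i\<bar> \<le> al * K * ((real i + 1) powr (- e) * u i)" for i
  proof -
    have "u i / 2 - al * x i = al * (beta - rho i) * u i"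
      using al(2) by (simp add: x_eq_rho algebra_simps)
    then have "\<bar>u i / 2 - al * x i\<bar> = al * \<bar>rho i - beta\<bar> * u i"
      using al u_pos[of i] by (simp add: abs_mult abs_minus_commute)
    also have "\<dots> \<le> al * (K * (real i + 1) powr (- e)) * u i"
      using al u_pos[of i] Ke by (intro mult_right_mono mult_left_mono) auto
    finally show ?thesis by (simp add: mult_ac)
  qed
  have D_rec: "D k * (1 + lam * u k) = (\<Sum>i<k. d (k - 1 - i) * D i) + (\<Sum>i<k. (u i / 2 - al * x i) * u (k - 1 - i))"
    if k: "k > 0" for k
  proof -
    have "(real k + 1) * v k = (\<Sum>i<k. a k i * (real k + 1))"
      unfolding sum_distrib_right[symmetric] a_sum[OF k] by (rule mult.commute)
    also have "\<dots> = (\<Sum>i<k. d (k - 1 - i) * ((real i + 1) * u i) + x (k - 1 - i) * u i)"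
      by (intro sum.cong refl) (auto simp: a_def x_def of_nat_diff algebra_simps)
    also have "\<dots> = (\<Sum>i<k. d (k - 1 - i) * ((real i + 1) * u i)) + (\<Sum>i<k. x (k - 1 - i) * u i)"
      by (rule sum.distrib)
    also have "(\<Sum>i<k. x (k - 1 - i) * u i) = (\<Sum>i<k. x i * u (k - 1 - i))"
      by (rule sum.reindex_bij_witness[of _ "\<lambda>i. k - 1 - i" "\<lambda>i. k - 1 - i"]) auto
    finally have 1: "(real k + 1) * u k * (1 + lam * u k)
        = (\<Sum>i<k. d (k - 1 - i) * ((real i + 1) * u i)) + (\<Sum>i<k. x i * u (k - 1 - i))"
      by (simp add: v_eq mult.assoc)
    have "(\<Sum>i<k. d (k - 1 - i) * D i) = (\<Sum>i<k. d (k - 1 - i) * mu i) - al * (\<Sum>i<k. d (k - 1 - i) * ((real i + 1) * u i))"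
      unfolding D_def sum_distrib_left sum_subtractf[symmetric]
      by (intro sum.cong refl) (simp add: algebra_simps)
    moreover have "(\<Sum>i<k. (u i / 2 - al * x i) * u (k - 1 - i))
        = (\<Sum>i<k. u i * u (k - 1 - i)) / 2 - al * (\<Sum>i<k. x i * u (k - 1 - i))"
      unfolding sum_distrib_left sum_divide_distrib sum_subtractf[symmetric]
      by (intro sum.cong refl) (simp add: algebra_simps)
    moreover have "D k * (1 + lam * u k) = mu k * (1 + lam * u k) - al * ((real k + 1) * u k * (1 + lam * u k))"
      by (simp add: D_def algebra_simps)
    ultimately show ?thesis unfolding mu_rec[OF k] 1 by (simp add: algebra_simps)
  qed
  \<comment> \<open>\<open>\<bar>D 0\<bar>\<close> starts the induction; the second part is what the
    gain with factor \<open>d 0 / 2\<close> in \<open>supersolution\<close> requires to absorb the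
    source.\<close>
  define A where "A = \<bar>D 0\<bar> + 2 * al * K * K_conv / d 0"
  have A: "A \<ge> 0" "A \<ge> \<bar>D 0\<bar>" "2 * al * K * K_conv / d 0 \<le> A"
    using al Ke K_conv_pos d_pos[of 0] by (auto simp: A_def)
  have D_bound: "\<bar>D k\<bar> \<le> A * ((real k + 1) powr (1 - e) * u k)" for k
  proof (induction k rule: less_induct)
    case (less k)
    show ?case
    proof (cases "k = 0")
      case False
      then have k: "k > 0" by simp
      have "\<bar>D k\<bar> * (1 + lam * u k) = \<bar>D k * (1 + lam * u k)\<bar>"
        using lam_pos u_pos[of k] by (simp add: abs_mult)
      also have "\<dots> \<le> \<bar>\<Sum>i<k. d (k - 1 - i) * D i\<bar> + \<bar>\<Sum>i<k. (u i / 2 - al * x i) * u (k - 1 - i)\<bar>"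
        unfolding D_rec[OF k] by (rule abs_triangle_ineq)
      also have "\<bar>\<Sum>i<k. d (k - 1 - i) * D i\<bar> \<le> (\<Sum>i<k. A * (a k i * (real i + 1) powr (1 - e)))"
      proof (rule order_trans[OF sum_abs sum_mono])
        fix i assume i: "i \<in> {..<k}"
        have "\<bar>d (k - 1 - i) * D i\<bar> = d (k - 1 - i) * \<bar>D i\<bar>"
          using d_pos[of "k - 1 - i"] by (simp only: abs_mult abs_of_pos)
        also have "\<dots> \<le> d (k - 1 - i) * (A * ((real i + 1) powr (1 - e) * u i))"
          using less i by (intro mult_left_mono less_imp_le[OF d_pos]) auto
        finally show "\<bar>d (k - 1 - i) * D i\<bar> \<le> A * (a k i * (real i + 1) powr (1 - e))"
          by (simp add: a_def mult_ac)
      qed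
      also have "\<dots> = A * (\<Sum>i<k. a k i * (real i + 1) powr (1 - e))"
        by (simp only: sum_distrib_left)
      also have "\<bar>\<Sum>i<k. (u i / 2 - al * x i) * u (k - 1 - i)\<bar>
          \<le> (\<Sum>i<k. al * K * ((real i + 1) powr (- e) * u i * u (k - 1 - i)))"
      proof (rule order_trans[OF sum_abs sum_mono])
        fix i
        have "\<bar>(u i / 2 - al * x i) * u (k - 1 - i)\<bar> = \<bar>u i / 2 - al * x i\<bar> * u (k - 1 - i)"
          using u_pos[of "k - 1 - i"] by (simp only: abs_mult abs_of_pos)
        also have "\<dots> \<le> al * K * ((real i + 1) powr (- e) * u i) * u (k - 1 - i)"
          by (intro mult_right_mono xu less_imp_le[OF u_pos])
        finally show "\<bar>(u i / 2 - al * x i) * u (k - 1 - i)\<bar> \<le> al * K * ((real i + 1) powr (- e) * u i * u (k - 1 - i))"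
          by (simp only: mult.assoc)
      qed
      also have "\<dots> = al * K * (\<Sum>i<k. (real i + 1) powr (- e) * u i * u (k - 1 - i))"
        by (simp only: sum_distrib_left)
      also have "\<dots> \<le> al * K * (K_conv * (real k + 1) powr (- e) * (u k * T k))"
        using al Ke k by (intro mult_left_mono weighted_convolution_upper) auto
      also have "\<dots> = (2 * al * K * K_conv / d 0) * ((1 / 2) * d 0 * (real k + 1) powr (- e) * (u k * T k))"
        using d_pos[of 0] by simp
      also have "\<dots> \<le> A * ((1 / 2) * d 0 * (real k + 1) powr (- e) * (u k * T k))"
        using A d_pos[of 0] u_pos[of k] T_nonneg[of k] by (intro mult_right_mono) auto
      also have "A * (\<Sum>i<k. a k i * (real i + 1) powr (1 - e)) + \<dots>
          = A * ((\<Sum>i<k. a k i * (real i + 1) powr (1 - e)) + (1 / 2) * d 0 * (real k + 1) powr (- e) * (u k * T k))"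
        by (simp only: distrib_left)
      also have "\<dots> \<le> A * (v k * (real k + 1) powr (1 - e))"
        using A Ke k by (intro mult_left_mono supersolution) auto
      finally have "\<bar>D k\<bar> * (1 + lam * u k) \<le> A * ((real k + 1) powr (1 - e) * u k) * (1 + lam * u k)"
        by (simp add: v_eq mult_ac)
      moreover have "1 + lam * u k > 0" using lam_pos u_pos[of k] by (simp add: add_pos_pos)
      ultimately show ?thesis by (simp only: mult_le_cancel_right_pos)
    qed (use A in \<open>simp add: u_0\<close>)
  qed
  define L where "L = A / 2 + al\<^sup>2 * K + 1"
  have "mu k / 2 - al * (real k + 1) * u k + al\<^sup>2 * (real k + 1) * x k \<le> L * (real k + 1) powr (1 - e) * u k" for k
  proof -
    have "mu k / 2 - al * (real k + 1) * u k + al\<^sup>2 * (real k + 1) * x k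
        = D k / 2 - al * (real k + 1) * (u k / 2 - al * x k)"
      by (simp add: D_def field_simps power2_eq_square)
    also have "\<dots> \<le> A * ((real k + 1) powr (1 - e) * u k) / 2 + al * (real k + 1) * (al * K * ((real k + 1) powr (- e) * u k))"
    proof -
      have "al * (real k + 1) * - (u k / 2 - al * x k) \<le> al * (real k + 1) * (al * K * ((real k + 1) powr (- e) * u k))"
        using xu[of k] al by (intro mult_left_mono) auto
      then have "- (al * (real k + 1) * (u k / 2 - al * x k)) \<le> al * (real k + 1) * (al * K * ((real k + 1) powr (- e) * u k))"
        by (simp only: mult_minus_right)
      then show ?thesis using D_bound[of k] by linarith
    qed
    also have "(real k + 1) * (real k + 1) powr (- e) = (real k + 1) powr (1 - e)"
      by (simp add: powr_diff powr_minus_divide)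
    then have "al * (real k + 1) * (al * K * ((real k + 1) powr (- e) * u k)) = al\<^sup>2 * K * ((real k + 1) powr (1 - e) * u k)"
      by (metis (no_types, opaque_lifting) mult.assoc mult.left_commute power2_eq_square)
    also have "A * ((real k + 1) powr (1 - e) * u k) / 2 + al\<^sup>2 * K * ((real k + 1) powr (1 - e) * u k)
        \<le> L * (real k + 1) powr (1 - e) * u k"
      using u_pos[of k] by (simp add: L_def algebra_simps)
    finally show ?thesis .
  qed
  moreover have "L > 0" using A al Ke by (simp add: L_def add_nonneg_pos)
  ultimately show ?thesis using Ke by blast
qed

end

section \<open>The constant alpha\<close>

lemma Gamma_legendre_duplication_real:
  fixes z :: real
  assumes "z > 0"
  shows "Gamma z * Gamma (z + 1/2) = 2 powr (1 - 2 * z) * sqrt pi * Gamma (2 * z)"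
proof -
  have nz: "complex_of_real z \<notin> \<int>\<^sub>\<le>\<^sub>0" "complex_of_real z + 1/2 \<notin> \<int>\<^sub>\<le>\<^sub>0"
    using assms by (auto elim!: nonpos_Ints_cases simp: complex_eq_iff)
  have "complex_of_real (Gamma z * Gamma (z + 1/2)) = Gamma (complex_of_real z) * Gamma (complex_of_real z + 1/2)"
    using Gamma_complex_of_real[of "z + 1/2"] by (simp add: Gamma_complex_of_real)
  also have "\<dots> = exp ((1 - 2 * complex_of_real z) * of_real (ln 2)) * of_real (sqrt pi) * Gamma (2 * complex_of_real z)"
    by (rule Gamma_legendre_duplication[OF nz])
  also have "\<dots> = complex_of_real (exp ((1 - 2 * z) * ln 2) * sqrt pi * Gamma (2 * z))"
    using Gamma_complex_of_real[of "2 * z"] by (simp add: exp_of_real[symmetric])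
  finally show ?thesis by (simp only: of_real_eq_iff) (simp add: powr_def)
qed

text \<open>The quotient is the Beta function on the diagonal. Its logarithmic derivative
  \<open>2 * Digamma z - 2 * Digamma (2 * z)\<close> is nonpositive because Digamma
  increases.\<close>

lemma Beta_diag_antimono:
  fixes x y :: real
  assumes "0 < x" "x \<le> y"
  shows "Gamma y ^ 2 / Gamma (2 * y) \<le> Gamma x ^ 2 / Gamma (2 * x)"
proof -
  have "2 * ln_Gamma y - ln_Gamma (2 * y) \<le> 2 * ln_Gamma x - ln_Gamma (2 * x)"
  proof (rule DERIV_nonpos_imp_nonincreasing[OF assms(2)])
    fix z assume z: "x \<le> z"
    then have "z > 0" using assms by simp
    then have "((\<lambda>z. 2 * ln_Gamma z - ln_Gamma (2 * z)) has_real_derivative 2 * Digamma z - Digamma (2 * z) * 2) (at z)"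
      by (auto intro!: derivative_eq_intros)
    moreover have "Digamma z \<le> Digamma (2 * z)" using \<open>z > 0\<close> by (intro Digamma_real_mono) auto
    ultimately show "\<exists>D. ((\<lambda>z. 2 * ln_Gamma z - ln_Gamma (2 * z)) has_real_derivative D) (at z) \<and> D \<le> 0"
      by (intro exI[of _ "2 * Digamma z - Digamma (2 * z) * 2"]) auto
  qed
  then have "exp (2 * ln_Gamma y - ln_Gamma (2 * y)) \<le> exp (2 * ln_Gamma x - ln_Gamma (2 * x))" by simp
  moreover have "exp (2 * ln_Gamma z - ln_Gamma (2 * z)) = Gamma z ^ 2 / Gamma (2 * z)" if "z > 0" for z :: real
    using that by (simp add: exp_diff exp_double Gamma_real_pos_exp)
  ultimately show ?thesis using assms by simp
qed

text \<open>\<open>2 * b - 1\<close> times the Beta function at \<open>(1 - b, 1 - b)\<close>, the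
  right-hand side of \<open>lam_eq\<close>. Both factors are positive and increasing in
  \<open>b\<close>, the first strictly.\<close>

definition alpha_ratio :: "real \<Rightarrow> real" where
  "alpha_ratio b = (2 * b - 1) * (Gamma (1 - b))\<^sup>2 / Gamma (2 - 2 * b)"

lemma alpha_ratio_pos: "1/2 < b \<Longrightarrow> b < 1 \<Longrightarrow> 0 < alpha_ratio b"
  unfolding alpha_ratio_def by (intro divide_pos_pos mult_pos_pos zero_less_power Gamma_real_pos) auto

lemma alpha_ratio_strict_mono:
  assumes "1/2 < b" "b < c" "c < 1"
  shows "alpha_ratio b < alpha_ratio c"
proof -
  define g where "g b = (Gamma (1 - b))\<^sup>2 / Gamma (2 * (1 - b))" for b :: real
  have "alpha_ratio b = (2 * b - 1) * g b" "alpha_ratio c = (2 * c - 1) * g c"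
    by (simp_all add: alpha_ratio_def g_def)
  moreover have "g b \<le> g c" unfolding g_def using assms by (intro Beta_diag_antimono) auto
  moreover have "g b > 0" unfolding g_def using assms by (intro divide_pos_pos zero_less_power Gamma_real_pos) auto
  moreover have "(2 * b - 1) * g b < (2 * c - 1) * g b"
    using assms \<open>g b > 0\<close> by (intro mult_strict_right_mono) auto
  moreover have "(2 * c - 1) * g b \<le> (2 * c - 1) * g c"
    using assms \<open>g b \<le> g c\<close> by (intro mult_left_mono) auto
  ultimately show ?thesis by linarith
qed

text \<open>The duplication formula at \<open>1 - b\<close> produces Gamma at
  \<open>3/2 - b\<close>; one step of the functional equation leads down to the negative argument
  \<open>1/2 - b\<close>, whence the minus sign.\<close>

lemma alpha_ratio_eq:
  assumes "1/2 < b" "b < 1"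
  shows "1 / (4 powr b * sqrt pi) * (Gamma (1/2 - b) / Gamma (1 - b)) = - 1 / alpha_ratio b"
proof -
  define G where "G = Gamma (1 - b)"
  define G2 where "G2 = Gamma (2 - 2 * b)"
  have G: "G > 0" "G2 > 0" using assms by (auto simp: G_def G2_def)
  have "Gamma (1/2 - b + 1) = (1/2 - b) * Gamma (1/2 - b)"
  proof (rule Gamma_plus1, rule notI)
    assume "1/2 - b \<in> \<int>\<^sub>\<le>\<^sub>0"
    then obtain n :: int where "1/2 - b = of_int n" by (auto elim: nonpos_Ints_cases)
    then have "-1 < n" "n < 0" using assms by linarith+
    then show False by simp
  qed
  moreover have "G * Gamma (1/2 - b + 1) = 2 powr (2 * b - 1) * sqrt pi * G2"
    using Gamma_legendre_duplication_real[of "1 - b"] assms by (simp add: G_def G2_def algebra_simps)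
  moreover have "2 powr (2 * b - 1) = 4 powr b / (2::real)"
  proof -
    have "(4::real) powr b = (2 powr 2) powr b" by simp
    also have "\<dots> = 2 powr (2 * b)" by (simp only: powr_powr)
    finally show ?thesis by (simp add: powr_diff)
  qed
  ultimately have "G * ((1/2 - b) * Gamma (1/2 - b)) = 4 powr b / 2 * sqrt pi * G2" by simp
  then have "Gamma (1/2 - b) = 4 powr b / 2 * sqrt pi * G2 / (G * (1/2 - b))"
    using G assms by (simp add: field_simps)
  then have "1 / (4 powr b * sqrt pi) * (Gamma (1/2 - b) / G) = G2 / (2 * G\<^sup>2 * (1/2 - b))"
    by (simp add: power2_eq_square)
  also have "\<dots> = - 1 / ((2 * b - 1) * G\<^sup>2 / G2)"
    using G assms by (simp add: field_simps)
  finally show ?thesis by (simp add: alpha_ratio_def G_def G2_def)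
qed

text \<open>Uniqueness is strict monotonicity of \<open>alpha_ratio\<close>; existence is supplied
  by \<open>b\<close>, which will be the limit \<open>beta\<close>.\<close>

lemma alpha_eqI:
  assumes p: "0 < p" "p < 1" and b: "1/2 < b" "b < 1" and eq: "(1 - p) / p = alpha_ratio b"
  shows "alpha p = 1 / (2 * b)"
  unfolding alpha_def
proof (rule the_equality)
  have pe: "p / (p - 1) = - 1 / alpha_ratio b"
    unfolding eq[symmetric] using p by (simp add: field_simps)
  show "1 / 2 < 1 / (2 * b) \<and> 1 / (2 * b) < 1 \<and>
      1 / (4 powr (1 / (2 * (1 / (2 * b)))) * sqrt pi) *
      (Gamma (1 / 2 - 1 / (2 * (1 / (2 * b)))) / Gamma (1 - 1 / (2 * (1 / (2 * b))))) = p / (p - 1)"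
    using alpha_ratio_eq[OF b] b pe by (simp add: field_simps)
  fix a assume a: "1 / 2 < a \<and> a < 1 \<and>
      1 / (4 powr (1 / (2 * a)) * sqrt pi) * (Gamma (1 / 2 - 1 / (2 * a)) / Gamma (1 - 1 / (2 * a))) = p / (p - 1)"
  define c where "c = 1 / (2 * a)"
  have c: "1/2 < c" "c < 1" using a by (auto simp: c_def field_simps)
  have "- 1 / alpha_ratio c = - 1 / alpha_ratio b"
    using a alpha_ratio_eq[OF c] pe by (simp add: c_def)
  then have "alpha_ratio c = alpha_ratio b"
    using alpha_ratio_pos[OF c] alpha_ratio_pos[OF b] by (simp add: field_simps)
  then have "c = b"
    using alpha_ratio_strict_mono[of b c] alpha_ratio_strict_mono[of c b] b c by (cases b c rule: linorder_cases) auto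
  moreover have "a = 1 / (2 * c)" by (simp add: c_def)
  ultimately show "a = 1 / (2 * b)" by simp
qed

section \<open>The Bienayme-Galton-Watson law\<close>

text \<open>Tonelli for a product: any finite partial sum lies in a rectangle, whose sum
  factors.\<close>

lemma has_sum_product_nonneg:
  fixes f :: "'a \<Rightarrow> real" and g :: "'b \<Rightarrow> real"
  assumes f: "(f has_sum a) A" "\<And>x. f x \<ge> 0" and g: "(g has_sum b) B" "\<And>y. g y \<ge> 0"
  shows "((\<lambda>(x, y). f x * g y) has_sum (a * b)) (A \<times> B)"
proof (rule has_sum_SigmaI)
  show "((\<lambda>y. case (x, y) of (x, y) \<Rightarrow> f x * g y) has_sum f x * b) B" for x
    using has_sum_cmult_right[OF g(1), of "f x"] by simp
  show "((\<lambda>x. f x * b) has_sum a * b) A" by (rule has_sum_cmult_left[OF f(1)])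
  show "(\<lambda>(x, y). f x * g y) summable_on A \<times> B"
  proof (rule nonneg_bdd_above_summable_on)
    show "bdd_above (sum (\<lambda>(x, y). f x * g y) ` {F. F \<subseteq> A \<times> B \<and> finite F})"
    proof (rule bdd_aboveI2)
      fix F assume "F \<in> {F. F \<subseteq> A \<times> B \<and> finite F}"
      then have F: "F \<subseteq> A \<times> B" "finite F" by auto
      have "sum (\<lambda>(x, y). f x * g y) F \<le> sum (\<lambda>(x, y). f x * g y) (fst ` F \<times> snd ` F)"
        using F f g by (intro sum_mono2) (force simp: image_iff)+
      also have "\<dots> = sum f (fst ` F) * sum g (snd ` F)"
        by (simp add: sum_product sum.cartesian_product)
      also have "\<dots> \<le> a * b"
      proof (intro mult_mono)
        show "sum f (fst ` F) \<le> a"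
          using F f by (intro has_sum_mono2[OF has_sum_finite f(1)]) auto
        show "sum g (snd ` F) \<le> b"
          using F g by (intro has_sum_mono2[OF has_sum_finite g(1)]) auto
        show "0 \<le> a" using f by (intro has_sum_nonneg[OF f(1)])
        show "0 \<le> sum g (snd ` F)" using g by (intro sum_nonneg)
      qed
      finally show "sum (\<lambda>(x, y). f x * g y) F \<le> a * b" .
    qed
  qed (use f g in auto)
qed

lemma has_sum_sum_finite:
  fixes f :: "'i \<Rightarrow> 'a \<Rightarrow> real"
  assumes "finite I" "\<And>i. i \<in> I \<Longrightarrow> (f i has_sum s i) A"
  shows "((\<lambda>x. \<Sum>i\<in>I. f i x) has_sum (\<Sum>i\<in>I. s i)) A"
  using assms by (induction I rule: finite_induct) (auto intro!: has_sum_add)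

text \<open>A finite exhaustion by height, so that bounds on finite partial sums can be proved by
  induction.\<close>

fun trees :: "nat \<Rightarrow> stree set" where
  "trees 0 = {}"
| "trees (Suc n) = insert Leaf ((\<lambda>(s, l, r). Node s l r) ` (UNIV \<times> trees n \<times> trees n))"

lemma finite_trees: "finite (trees n)"
  by (induction n) auto

lemma trees_mono: "m \<le> n \<Longrightarrow> trees m \<subseteq> trees n"
proof (induction n arbitrary: m)
  case (Suc n)
  show ?case
  proof (cases m)
    case (Suc m')
    then have "trees m' \<subseteq> trees n" using Suc.IH Suc.prems by simp
    then have "trees (Suc m') \<subseteq> trees (Suc n)"
      unfolding trees.simps by (intro insert_mono image_mono Sigma_mono) auto
    then show ?thesis using Suc by simp
  qed simp
qed simp

lemma trees_exhaust: "\<exists>n. t \<in> trees n"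
proof (induction t)
  case Leaf
  show ?case by (intro exI[of _ 1]) simp
next
  case (Node s l r)
  then obtain m n where "l \<in> trees m" "r \<in> trees n" by blast
  then have "l \<in> trees (max m n)" "r \<in> trees (max m n)" using trees_mono by (meson max.cobounded1 max.cobounded2 subsetD)+
  then have "Node s l r \<in> trees (Suc (max m n))" by force
  then show ?case by blast
qed

locale bgw =
  fixes p :: real
  assumes p_pos: "0 < p" and p_less_1: "p < 1"
begin

abbreviation "w \<equiv> bgw_prob p"

lemma w_simps [simp]:
  "w Leaf = 1 / 2"
  "w (Node True l r) = p / 2 * (w l * w r)"
  "w (Node False l r) = (1 - p) / 2 * (w l * w r)"
  by (simp_all add: bgw_prob_def power_add)

lemma w_pos: "w t > 0"
  using p_pos p_less_1 by (simp add: bgw_prob_def)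

text \<open>Decomposing at the root turns a sum \<open>s\<close> into
  \<open>1/2 + s\<^sup>2 / 2\<close>, and criticality makes 1 a fixed point.\<close>

lemma sum_trees_le_1: "sum w (trees n) \<le> 1"
proof (induction n)
  case (Suc n)
  let ?A = "UNIV \<times> trees n \<times> trees n"
  have "sum w (trees (Suc n)) = w Leaf + sum w ((\<lambda>(s, l, r). Node s l r) ` ?A)"
    unfolding trees.simps using finite_trees by (intro sum.insert) auto
  also have "sum w ((\<lambda>(s, l, r). Node s l r) ` ?A) = (\<Sum>(s, l, r)\<in>?A. w (Node s l r))"
    by (subst sum.reindex) (auto simp: inj_on_def intro!: sum.cong)
  also have "\<dots> = (\<Sum>s\<in>UNIV. \<Sum>l\<in>trees n. \<Sum>r\<in>trees n. w (Node s l r))"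
    by (simp add: sum.cartesian_product)
  also have "\<dots> = (\<Sum>l\<in>trees n. \<Sum>r\<in>trees n. w (Node False l r) + w (Node True l r))"
    by (simp add: UNIV_bool sum.distrib del: w_simps)
  also have "\<dots> = (\<Sum>l\<in>trees n. \<Sum>r\<in>trees n. w l * w r / 2)"
    by (intro sum.cong refl) (simp add: field_simps)
  also have "\<dots> = (\<Sum>l\<in>trees n. \<Sum>r\<in>trees n. w l * w r) / 2"
    by (simp only: sum_divide_distrib)
  also have "\<dots> = (sum w (trees n))\<^sup>2 / 2"
    by (simp add: power2_eq_square sum_product)
  also have "\<dots> \<le> 1 / 2"
    using Suc less_imp_le[OF w_pos] by (simp add: power_le_one sum_nonneg)
  finally show ?case by simp
qed simp

lemma sum_w_le_1:
  assumes "finite F"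
  shows "sum w F \<le> 1"
proof -
  have "\<exists>n. F \<subseteq> trees n" using assms
  proof (induction F rule: finite_induct)
    case (insert t F)
    then obtain m n where "F \<subseteq> trees m" "t \<in> trees n" using trees_exhaust by blast
    then have "insert t F \<subseteq> trees (max m n)" using trees_mono[of m "max m n"] trees_mono[of n "max m n"] by auto
    then show ?case by blast
  qed simp
  then obtain n where "F \<subseteq> trees n" by blast
  then have "sum w F \<le> sum w (trees n)" using less_imp_le[OF w_pos] by (intro sum_mono2 finite_trees)
  then show ?thesis using sum_trees_le_1[of n] by simp
qed

lemma w_summable: "w summable_on A"
  using sum_w_le_1 less_imp_le[OF w_pos]
  by (intro nonneg_bdd_above_summable_on bdd_aboveI2[of _ _ 1]) auto

lemma w_bounded_summable:
  assumes "\<And>t. \<bar>g t\<bar> \<le> C"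
  shows "(\<lambda>t. w t * g t) summable_on A"
proof (rule abs_summable_summable, rule Infinite_Sum.abs_summable_on_comparison_test')
  show "(\<lambda>t. w t * C) summable_on A" by (intro summable_on_cmult_left w_summable)
  show "norm (w t * g t) \<le> w t * C" for t
    using assms[of t] w_pos[of t] by (simp add: abs_mult)
qed

lemma has_sum_tree:
  assumes "((\<lambda>(l, r). w l * w r * g (Node True l r)) has_sum x) UNIV"
    and "((\<lambda>(l, r). w l * w r * g (Node False l r)) has_sum y) UNIV"
  shows "((\<lambda>t. w t * g t) has_sum (g Leaf / 2 + (p / 2 * x + (1 - p) / 2 * y))) UNIV"
proof -
  let ?T = "\<lambda>(l, r). Node True l r" and ?F = "\<lambda>(l, r). Node False l r"
  have U: "UNIV = {Leaf} \<union> (range ?T \<union> range ?F)"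
  proof (intro set_eqI iffI)
    fix t :: stree
    show "t \<in> {Leaf} \<union> (range ?T \<union> range ?F)"
    proof (cases t)
      case (Node s l r)
      then show ?thesis by (cases s) (auto intro: rev_image_eqI[of "(l, r)"])
    qed simp
  qed simp
  have T: "((\<lambda>t. w t * g t) has_sum (p / 2 * x)) (range ?T)"
    using has_sum_cmult_right[OF assms(1), of "p / 2"]
    by (subst has_sum_reindex) (auto simp: inj_on_def o_def case_prod_unfold mult.assoc)
  have F: "((\<lambda>t. w t * g t) has_sum ((1 - p) / 2 * y)) (range ?F)"
    using has_sum_cmult_right[OF assms(2), of "(1 - p) / 2"]
    by (subst has_sum_reindex) (auto simp: inj_on_def o_def case_prod_unfold mult.assoc)
  have L: "((\<lambda>t. w t * g t) has_sum (g Leaf / 2)) {Leaf}"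
    using has_sum_finite[of "{Leaf}" "\<lambda>t. w t * g t"] by simp
  show ?thesis unfolding U
    by (intro has_sum_Un_disjoint L T F) auto
qed

lemma has_sum_pair:
  assumes "((\<lambda>t. w t * g t) has_sum x) UNIV" "((\<lambda>t. w t * h t) has_sum y) UNIV"
    and "\<And>t. g t \<ge> 0" "\<And>t. h t \<ge> 0"
  shows "((\<lambda>(l, r). w l * w r * (g l * h r)) has_sum (x * y)) UNIV"
  using has_sum_product_nonneg[OF assms(1) _ assms(2)] assms(3,4) less_imp_le[OF w_pos]
  by (simp add: mult_ac)

text \<open>For \<open>j = 0\<close> the power is 1 even where \<open>N t = 0\<close>, so the zeroth
  moment is the plain probability of \<open>LIS = k\<close>.\<close>

definition ind :: "nat \<Rightarrow> nat \<Rightarrow> stree \<Rightarrow> real" where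
  "ind j k t = of_bool (LIS t = k) * real (N t) ^ j"

definition E :: "nat \<Rightarrow> nat \<Rightarrow> real" where
  "E j k = infsum (\<lambda>t. w t * ind j k t) UNIV"

lemma ind_nonneg: "ind j k t \<ge> 0"
  by (simp add: ind_def)

lemma ind_le: "ind j k t \<le> real k ^ j"
  using N_le_LIS[of t] by (auto simp: ind_def intro!: power_mono)

lemma has_sum_E: "((\<lambda>t. w t * ind j k t) has_sum E j k) UNIV"
  unfolding E_def using ind_nonneg ind_le
  by (intro has_sum_infsum w_bounded_summable[of _ "real k ^ j"]) auto

lemma E_0 [simp]: "E j 0 = 0"
  unfolding E_def ind_def using LIS_pos by (intro infsum_0) simp

definition below :: "nat \<Rightarrow> stree \<Rightarrow> real" where "below k t = of_bool (LIS t < k)"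

definition S :: "nat \<Rightarrow> real" where "S k = (\<Sum>i<k. E 0 i)"

lemma below_eq: "below k t = (\<Sum>i<k. ind 0 i t)"
  by (simp add: below_def ind_def of_bool_def sum.delta')

lemma has_sum_below: "((\<lambda>t. w t * below k t) has_sum S k) UNIV"
  unfolding below_eq S_def sum_distrib_left by (intro has_sum_sum_finite has_sum_E) auto

lemma S_le_1: "S k \<le> 1"
proof (rule has_sum_le_finite_sums[OF has_sum_below])
  fix F :: "stree set" assume "finite F"
  have "(\<Sum>t\<in>F. w t * below k t) \<le> sum w F"
    using w_pos by (intro sum_mono) (simp add: below_def less_imp_le)
  then show "(\<Sum>t\<in>F. w t * below k t) \<le> 1" using sum_w_le_1[OF \<open>finite F\<close>] by simp
qed

lemma sum_ind_split:
  fixes m n k :: nat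
  shows "(\<Sum>i\<le>k. of_bool (m = i) * of_bool (n = k - i) * (c::real)) = of_bool (m + n = k) * c"
proof -
  have "(\<Sum>i\<le>k. of_bool (m = i) * of_bool (n = k - i) * c) = (\<Sum>i\<le>k. if i = m then of_bool (n = k - m) * c else 0)"
    by (intro sum.cong) auto
  also have "\<dots> = of_bool (m + n = k) * c"
    by (subst sum.delta) auto
  finally show ?thesis .
qed

lemma conv_ind:
  "(\<Sum>m\<le>k. ind i m l * ind j (k - m) r) = of_bool (LIS l + LIS r = k) * (real (N l) ^ i * real (N r) ^ j)"
  unfolding sum_ind_split[symmetric] by (intro sum.cong refl) (simp add: ind_def)

lemma has_sum_conv:
  "((\<lambda>(l, r). w l * w r * (\<Sum>m\<le>k. ind i m l * ind j (k - m) r)) has_sum (\<Sum>m\<le>k. E i m * E j (k - m))) UNIV"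
proof -
  have "((\<lambda>x. \<Sum>m\<le>k. (\<lambda>(l, r). w l * w r * (ind i m l * ind j (k - m) r)) x) has_sum (\<Sum>m\<le>k. E i m * E j (k - m))) UNIV"
    by (intro has_sum_sum_finite has_sum_pair has_sum_E ind_nonneg) auto
  then show ?thesis by (simp add: case_prod_unfold sum_distrib_left)
qed

text \<open>Under a minus sign the larger side decides. A tie contributes only for
  \<open>j = 0\<close>, because \<open>N\<close> vanishes there.\<close>

lemma has_sum_ind_False:
  "((\<lambda>(l, r). w l * w r * ind j k (Node False l r)) has_sum
    (2 * E j k * S k + of_bool (j = 0) * (E 0 k)\<^sup>2)) UNIV"
proof -
  have eq: "ind j k (Node False l r) = ind j k l * below k r + below k l * ind j k r
      + of_bool (j = 0) * (ind 0 k l * ind 0 k r)" for l r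
    by (cases "LIS l" "LIS r" rule: linorder_cases) (auto simp: ind_def below_def max_def)
  have b: "below k t \<ge> 0" for t by (simp add: below_def)
  have "((\<lambda>x. (\<lambda>(l, r). w l * w r * (ind j k l * below k r)) x + (\<lambda>(l, r). w l * w r * (below k l * ind j k r)) x
      + of_bool (j = 0) * (\<lambda>(l, r). w l * w r * (ind 0 k l * ind 0 k r)) x) has_sum
      (E j k * S k + S k * E j k + of_bool (j = 0) * (E 0 k * E 0 k))) UNIV"
    by (intro has_sum_add has_sum_cmult_right has_sum_pair has_sum_E has_sum_below ind_nonneg b)
  then show ?thesis unfolding eq by (simp add: case_prod_unfold algebra_simps power2_eq_square)
qed

lemma E_eqI:
  assumes "((\<lambda>(l, r). w l * w r * ind j k (Node True l r)) has_sum x) UNIV"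
  shows "E j k = of_bool (k = 1) / 2 + (p / 2 * x + (1 - p) / 2 * (2 * E j k * S k + of_bool (j = 0) * (E 0 k)\<^sup>2))"
proof -
  have "ind j k Leaf = of_bool (k = 1)" by (auto simp: ind_def)
  then show ?thesis
    using has_sum_unique[OF has_sum_E has_sum_tree[OF assms has_sum_ind_False]] by simp
qed

lemma E0_rec: "E 0 k = of_bool (k = 1) / 2 + p / 2 * (\<Sum>m\<le>k. E 0 m * E 0 (k - m))
  + (1 - p) / 2 * (2 * E 0 k * S k + (E 0 k)\<^sup>2)"
proof -
  have "ind 0 k (Node True l r) = (\<Sum>m\<le>k. ind 0 m l * ind 0 (k - m) r)" for l r
    unfolding conv_ind by (simp add: ind_def)
  then have "((\<lambda>(l, r). w l * w r * ind 0 k (Node True l r)) has_sum (\<Sum>m\<le>k. E 0 m * E 0 (k - m))) UNIV"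
    using has_sum_conv[of 0 0 k] by simp
  from E_eqI[OF this] show ?thesis by simp
qed

lemma conv_commute: "(\<Sum>m\<le>k. E i m * E j (k - m)) = (\<Sum>m\<le>k. E j m * E i (k - m))"
  by (rule sum.reindex_bij_witness[of _ "\<lambda>m. k - m" "\<lambda>m. k - m"]) auto

lemma E1_rec: "E 1 k = of_bool (k = 1) / 2 + p * (\<Sum>m\<le>k. E 1 m * E 0 (k - m)) + (1 - p) * E 1 k * S k"
proof -
  have "ind 1 k (Node True l r) = (\<Sum>m\<le>k. ind 1 m l * ind 0 (k - m) r) + (\<Sum>m\<le>k. ind 0 m l * ind 1 (k - m) r)" for l r
    unfolding conv_ind by (simp add: ind_def)
  then have "((\<lambda>(l, r). w l * w r * ind 1 k (Node True l r)) has_sum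
      ((\<Sum>m\<le>k. E 1 m * E 0 (k - m)) + (\<Sum>m\<le>k. E 0 m * E 1 (k - m)))) UNIV"
    using has_sum_add[OF has_sum_conv[of 1 0 k] has_sum_conv[of 0 1 k]]
    by (simp add: case_prod_unfold distrib_left)
  from E_eqI[OF this, unfolded conv_commute[of 0 1]] show ?thesis by (simp add: field_simps)
qed

lemma E2_rec: "E 2 k = of_bool (k = 1) / 2 + p * (\<Sum>m\<le>k. E 2 m * E 0 (k - m))
  + p * (\<Sum>m\<le>k. E 1 m * E 1 (k - m)) + (1 - p) * E 2 k * S k"
proof -
  have "ind 2 k (Node True l r) = (\<Sum>m\<le>k. ind 2 m l * ind 0 (k - m) r) + (\<Sum>m\<le>k. ind 0 m l * ind 2 (k - m) r)
      + 2 * (\<Sum>m\<le>k. ind 1 m l * ind 1 (k - m) r)" for l r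
    unfolding conv_ind by (simp add: ind_def power2_sum)
  then have "((\<lambda>(l, r). w l * w r * ind 2 k (Node True l r)) has_sum
      ((\<Sum>m\<le>k. E 2 m * E 0 (k - m)) + (\<Sum>m\<le>k. E 0 m * E 2 (k - m)) + 2 * (\<Sum>m\<le>k. E 1 m * E 1 (k - m)))) UNIV"
    using has_sum_add[OF has_sum_add[OF has_sum_conv[of 2 0 k] has_sum_conv[of 0 2 k]]
        has_sum_cmult_right[OF has_sum_conv[of 1 1 k], of 2]]
    by (simp add: case_prod_unfold distrib_left mult_ac)
  from E_eqI[OF this, unfolded conv_commute[of 0 2]] show ?thesis by (simp add: field_simps)
qed

text \<open>\<open>E j 0 = 0\<close> removes both ends of the sum; the shift matches the indexing of
  \<open>tail\<close>, whose differences at \<open>k\<close> belong to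
  \<open>LIS = Suc k\<close>.\<close>

lemma conv_shift: "(\<Sum>m\<le>Suc k. E i m * E j (Suc k - m)) = (\<Sum>m<k. E i (Suc m) * E j (k - m))"
proof -
  have "(\<Sum>m\<le>Suc k. E i m * E j (Suc k - m)) = (\<Sum>m\<le>k. E i (Suc m) * E j (k - m))"
    by (subst sum.atMost_Suc_shift) simp
  also have "\<dots> = (\<Sum>m<k. E i (Suc m) * E j (k - m))"
    by (simp add: lessThan_Suc_atMost[symmetric])
  finally show ?thesis .
qed

definition tail :: "nat \<Rightarrow> real" where "tail k = 1 - S (Suc k)"

lemma tail_diff: "tail k - tail (Suc k) = E 0 (Suc k)"
  by (simp add: tail_def S_def)

lemma tail_0: "tail 0 = 1"
  by (simp add: tail_def S_def)

lemma E0_pos: "E 0 (Suc k) > 0"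
proof (induction k rule: less_induct)
  case (less k)
  have E0: "E 0 (Suc k) \<ge> 0"
    by (rule has_sum_nonneg[OF has_sum_E]) (intro mult_nonneg_nonneg ind_nonneg less_imp_le[OF w_pos])
  have S0: "S (Suc k) \<ge> 0"
    by (rule has_sum_nonneg[OF has_sum_below]) (simp add: below_def less_imp_le[OF w_pos])
  have "0 < of_bool (Suc k = 1) / 2 + p / 2 * (\<Sum>m\<le>Suc k. E 0 m * E 0 (Suc k - m))"
  proof (cases k)
    case 0
    then show ?thesis by (simp add: conv_shift)
  next
    case (Suc k')
    have "0 < (\<Sum>m<k. E 0 (Suc m) * E 0 (k - m))"
    proof (intro sum_pos)
      fix m assume "m \<in> {..<k}"
      then have "0 < E 0 (Suc m)" "0 < E 0 (Suc (k - 1 - m))" using less by auto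
      then show "0 < E 0 (Suc m) * E 0 (k - m)" using \<open>m \<in> {..<k}\<close> by (simp add: Suc_diff_Suc)
    qed (use Suc in auto)
    then show ?thesis using Suc p_pos unfolding conv_shift by simp
  qed
  moreover have "0 \<le> (1 - p) / 2 * (2 * E 0 (Suc k) * S (Suc k) + (E 0 (Suc k))\<^sup>2)"
    using p_less_1 E0 S0 by (intro mult_nonneg_nonneg add_nonneg_nonneg) auto
  ultimately show ?case using E0_rec[of "Suc k"] by linarith
qed

lemma tail_pos: "tail k > 0"
  using S_le_1[of "Suc (Suc k)"] E0_pos[of k] by (simp add: tail_def S_def)

section \<open>Conclusion\<close>

abbreviation "lm \<equiv> (1 - p) / p"

lemma lm_pos: "lm > 0"
  using p_pos p_less_1 by simp

lemma S_Suc_eq: "S (Suc k) = 1 - tail k"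
  by (simp add: tail_def)

lemma E0_Suc: "E 0 (Suc k) = tail k - tail (Suc k)"
  by (simp add: tail_diff)

lemma p_lm: "p * (1 + lm * y) = p + (1 - p) * y"
  using p_pos by (simp add: distrib_left)

sublocale tail_recursion lm tail
proof
  show "0 < lm" by (rule lm_pos)
  show "tail 0 = 1" by (rule tail_0)
  show "tail k > 0" for k by (rule tail_pos)
  show "tail (Suc k) < tail k" for k using E0_pos[of k] by (simp add: E0_Suc)
  show "2 * (tail 0 - tail 1) + lm * ((tail 0)\<^sup>2 - (tail 1)\<^sup>2) = 1 + lm"
  proof -
    have "E 0 1 = 1 / 2 + (1 - p) / 2 * (E 0 1)\<^sup>2"
      using E0_rec[of 1] conv_shift[of 0 0 0] by (simp add: S_def)
    then have "1 - tail 1 = 1 / 2 + (1 - p) / 2 * (1 - tail 1)\<^sup>2"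
      using E0_Suc[of 0] by (simp add: tail_0)
    then have "p * (2 * (1 - tail 1) + lm * (1 - (tail 1)\<^sup>2)) = p * (1 + lm)"
      using p_pos by (simp add: field_simps power2_eq_square)
    then show ?thesis using p_pos by (simp add: tail_0)
  qed
  show "2 * (tail k - tail (Suc k)) + lm * ((tail k)\<^sup>2 - (tail (Suc k))\<^sup>2) =
      (\<Sum>i<k. (tail i - tail (Suc i)) * (tail (k - 1 - i) - tail (k - i)))" if k: "k > 0" for k
  proof -
    define C where "C = (\<Sum>i<k. (tail i - tail (Suc i)) * (tail (k - 1 - i) - tail (k - i)))"
    have "(\<Sum>m\<le>Suc k. E 0 m * E 0 (Suc k - m)) = C"
      unfolding conv_shift C_def
    proof (intro sum.cong refl)
      fix i assume "i \<in> {..<k}"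
      then have "k - i = Suc (k - 1 - i)" by auto
      then show "E 0 (Suc i) * E 0 (k - i) = (tail i - tail (Suc i)) * (tail (k - 1 - i) - tail (k - i))"
        by (simp add: E0_Suc)
    qed
    then have "tail k - tail (Suc k) = p / 2 * C
        + (1 - p) / 2 * (2 * (tail k - tail (Suc k)) * (1 - tail k) + (tail k - tail (Suc k))\<^sup>2)"
      using E0_rec[of "Suc k"] k by (simp add: E0_Suc S_Suc_eq)
    then have "p * (2 * (tail k - tail (Suc k)) + lm * ((tail k)\<^sup>2 - (tail (Suc k))\<^sup>2)) = p * C"
      using p_pos by (simp add: field_simps power2_eq_square)
    then show ?thesis using p_pos by (simp add: C_def)
  qed
qed

lemma conv_d_eq: "(\<Sum>m\<le>Suc k. E i m * E 0 (Suc k - m)) = (\<Sum>m<k. d (k - 1 - m) * E i (Suc m))"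
  unfolding conv_shift
proof (intro sum.cong refl)
  fix m assume "m \<in> {..<k}"
  then have "k - m = Suc (k - 1 - m)" by auto
  then show "E i (Suc m) * E 0 (k - m) = d (k - 1 - m) * E i (Suc m)"
    by (simp add: E0_Suc d_def)
qed

text \<open>This identity comes from deleting each leaf independently with probability \<open>\<epsilon>\<close>. Conditionally
  on survival the remaining tree has the same law, so \<open>P(LIS > k)\<close> is multiplied by
  \<open>sqrt (1 - \<epsilon>)\<close>; differentiate at \<open>\<epsilon> = 0\<close>.\<close>
lemma E1_Suc: "E 1 (Suc k) = tail k / 2"
proof (induction k rule: less_induct)
  case (less k)
  show ?case
  proof (cases "k = 0")
    case True
    have "E 1 1 = 1 / 2" using E1_rec[of 1] conv_shift[of 1 0 0] by (simp add: S_def)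
    then show ?thesis using True by (simp add: tail_0)
  next
    case False
    have conv: "(\<Sum>m<k. d (k - 1 - m) * E 1 (Suc m)) = (\<Sum>m<k. a k m) / 2"
      unfolding sum_divide_distrib using less by (intro sum.cong refl) (simp add: a_def)
    have "E 1 (Suc k) = p * (v k / 2) + (1 - p) * E 1 (Suc k) * (1 - tail k)"
      using E1_rec[of "Suc k"] False a_sum[of k] unfolding conv_d_eq conv S_Suc_eq by simp
    then have "E 1 (Suc k) * (p + (1 - p) * tail k) = tail k / 2 * (p * (1 + lm * tail k))"
      by (simp add: v_eq algebra_simps)
    moreover have "p + (1 - p) * tail k > 0" using p_pos p_less_1 tail_pos[of k] by (simp add: add_pos_pos)
    ultimately show ?thesis unfolding p_lm by simp
  qed
qed

text \<open>By \<open>E1_Suc\<close> the mixed term is a quarter of the self-convolution of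
  \<open>tail\<close>; doubling gives the shape of \<open>mu_rec\<close>.\<close>

lemma E2_Suc:
  assumes "k > 0"
  shows "2 * E 2 (Suc k) * (1 + lm * tail k)
    = (\<Sum>m<k. d (k - 1 - m) * (2 * E 2 (Suc m))) + (\<Sum>m<k. tail m * tail (k - 1 - m)) / 2"
proof -
  have "(\<Sum>m\<le>Suc k. E 1 m * E 1 (Suc k - m)) = (\<Sum>m<k. tail m * tail (k - 1 - m) / 4)"
    unfolding conv_shift
  proof (intro sum.cong refl)
    fix m assume "m \<in> {..<k}"
    then have "k - m = Suc (k - 1 - m)" by auto
    then show "E 1 (Suc m) * E 1 (k - m) = tail m * tail (k - 1 - m) / 4" by (simp only: E1_Suc)
  qed
  then have conv: "(\<Sum>m\<le>Suc k. E 1 m * E 1 (Suc k - m)) = (\<Sum>m<k. tail m * tail (k - 1 - m)) / 4"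
    by (simp only: sum_divide_distrib)
  have "E 2 (Suc k) = p * (\<Sum>m<k. d (k - 1 - m) * E 2 (Suc m))
      + p * ((\<Sum>m<k. tail m * tail (k - 1 - m)) / 4) + (1 - p) * E 2 (Suc k) * (1 - tail k)"
    using E2_rec[of "Suc k"] assms unfolding conv_d_eq conv S_Suc_eq by simp
  then have "E 2 (Suc k) * (p * (1 + lm * tail k)) = p * ((\<Sum>m<k. d (k - 1 - m) * E 2 (Suc m))
      + (\<Sum>m<k. tail m * tail (k - 1 - m)) / 4)"
    unfolding p_lm by (simp add: algebra_simps)
  then have "E 2 (Suc k) * (1 + lm * tail k) = (\<Sum>m<k. d (k - 1 - m) * E 2 (Suc m))
      + (\<Sum>m<k. tail m * tail (k - 1 - m)) / 4"
    using p_pos by (simp add: mult.left_commute)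
  moreover have "(\<Sum>m<k. d (k - 1 - m) * (2 * E 2 (Suc m))) = 2 * (\<Sum>m<k. d (k - 1 - m) * E 2 (Suc m))"
    by (simp add: sum_distrib_left mult_ac)
  ultimately show ?thesis by simp
qed

lemma alpha_eq: "alpha p = 1 / (2 * beta)"
  using p_pos p_less_1 beta_greater_half beta_less_1 lam_eq
  by (intro alpha_eqI) (simp_all add: alpha_ratio_def)

lemma variance_bound:
  "\<exists>K e. 0 < K \<and> 0 < e \<and> (\<forall>k. E 2 (Suc k) - 2 * alpha p * real (Suc k) * E 1 (Suc k)
    + (alpha p * real (Suc k))\<^sup>2 * E 0 (Suc k) \<le> K * real (Suc k) powr (2 - e) * E 0 (Suc k))"
proof -
  obtain K e where Ke: "0 < K" "0 < e" "\<And>k. 2 * E 2 (Suc k) / 2 - alpha p * (real k + 1) * tail k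
      + (alpha p)\<^sup>2 * (real k + 1) * x k \<le> K * (real k + 1) powr (1 - e) * tail k"
    using second_moment_bound[of "\<lambda>k. 2 * E 2 (Suc k)", OF E2_Suc] unfolding alpha_eq by blast
  have "E 2 (Suc k) - 2 * alpha p * real (Suc k) * E 1 (Suc k)
    + (alpha p * real (Suc k))\<^sup>2 * E 0 (Suc k) \<le> K / d 0 * real (Suc k) powr (2 - e) * E 0 (Suc k)" for k
  proof -
    define n where "n = real (Suc k)"
    have n: "n > 0" "real k + 1 = n" by (auto simp: n_def)
    have xk: "x k = n * E 0 (Suc k)" by (simp add: x_def d_def E0_Suc n_def)
    have "E 2 (Suc k) - 2 * alpha p * n * E 1 (Suc k) + (alpha p * n)\<^sup>2 * E 0 (Suc k)
        = 2 * E 2 (Suc k) / 2 - alpha p * n * tail k + (alpha p)\<^sup>2 * n * x k"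
      unfolding E1_Suc xk by (simp add: power2_eq_square)
    also have "\<dots> \<le> K * n powr (1 - e) * tail k" using Ke(3)[of k] unfolding n(2) .
    \<comment> \<open>By \<open>x_lower\<close>, \<open>tail k\<close> is at most of order
      \<open>n * E 0 (Suc k)\<close>; this supplies one more power of \<open>n\<close>.\<close>
    also have "\<dots> \<le> K * n powr (1 - e) * (n * E 0 (Suc k) / d 0)"
      using x_lower[of k] Ke d_pos[of 0] unfolding xk
      by (intro mult_left_mono) (auto simp: pos_le_divide_eq mult.commute)
    also have "\<dots> = K / d 0 * (n powr (1 - e) * n) * E 0 (Suc k)" by simp
    also have "n powr (1 - e) * n = n powr (2 - e)"
      using n powr_add[of n "1 - e" 1] by simp
    finally show ?thesis by (simp add: n_def)
  qed
  moreover have "K / d 0 > 0" using Ke d_pos[of 0] by simp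
  ultimately show ?thesis using Ke by blast
qed

section \<open>From the variance to the conditional mean deviation\<close>

lemma infsum_LIS: "infsum (\<lambda>t. w t * f t) {t. LIS t = k} = infsum (\<lambda>t. w t * (of_bool (LIS t = k) * f t)) UNIV"
  by (rule infsum_cong_neutral) auto

text \<open>A pointwise quadratic bound integrates to the moments \<open>E j (Suc k)\<close>;
  multiplying by \<open>E 0 (Suc k)\<close> clears the conditioning. The constants stay free so that
  they can depend on \<open>k\<close>.\<close>

lemma cond_expect_le:
  assumes "\<And>t. LIS t = Suc k \<Longrightarrow> \<bar>f t\<bar> \<le> c1 + c2 * (real (N t) / real (Suc k) - al)\<^sup>2"
  shows "\<bar>cond_expect p (Suc k) f\<bar> * E 0 (Suc k) \<le> c1 * E 0 (Suc k)
    + c2 / (real (Suc k))\<^sup>2 * (E 2 (Suc k) - 2 * al * real (Suc k) * E 1 (Suc k) + (al * real (Suc k))\<^sup>2 * E 0 (Suc k))"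
proof -
  define n where "n = real (Suc k)"
  have n: "n > 0" by (simp add: n_def)
  define g where "g t = c1 * ind 0 (Suc k) t + c2 / n\<^sup>2 * (ind 2 (Suc k) t - 2 * al * n * ind 1 (Suc k) t
    + (al * n)\<^sup>2 * ind 0 (Suc k) t)" for t
  have g: "((\<lambda>t. w t * g t) has_sum (c1 * E 0 (Suc k) + c2 / n\<^sup>2 * (E 2 (Suc k) - 2 * al * n * E 1 (Suc k)
      + (al * n)\<^sup>2 * E 0 (Suc k)))) UNIV"
  proof -
    have "((\<lambda>t. c1 * (w t * ind 0 (Suc k) t) + c2 / n\<^sup>2 * (w t * ind 2 (Suc k) t + (- 2 * al * n) * (w t * ind 1 (Suc k) t)
      + (al * n)\<^sup>2 * (w t * ind 0 (Suc k) t))) has_sum (c1 * E 0 (Suc k) + c2 / n\<^sup>2 * (E 2 (Suc k) + (- 2 * al * n) * E 1 (Suc k)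
      + (al * n)\<^sup>2 * E 0 (Suc k)))) UNIV"
      by (intro has_sum_add has_sum_cmult_right has_sum_E)
    then show ?thesis by (simp add: g_def algebra_simps)
  qed
  have fg: "\<bar>of_bool (LIS t = Suc k) * f t\<bar> \<le> g t" for t
  proof (cases "LIS t = Suc k")
    case True
    have "(real (N t) / n - al)\<^sup>2 = (real (N t) ^ 2 - 2 * al * n * real (N t) + (al * n)\<^sup>2) / n\<^sup>2"
      using n by (simp add: field_simps power2_eq_square)
    then show ?thesis using True assms[OF True] by (simp add: g_def ind_def n_def)
  qed (simp add: g_def ind_def)
  have E0: "infsum w {t. LIS t = Suc k} = E 0 (Suc k)"
    using infsum_LIS[of "\<lambda>_. 1" "Suc k"] by (simp add: E_def ind_def)
  define I where "I = infsum (\<lambda>t. w t * f t) {t. LIS t = Suc k}"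
  have "\<bar>I\<bar> \<le> c1 * E 0 (Suc k) + c2 / n\<^sup>2 * (E 2 (Suc k) - 2 * al * n * E 1 (Suc k) + (al * n)\<^sup>2 * E 0 (Suc k))"
  proof -
    have le: "norm (w t * (of_bool (LIS t = Suc k) * f t)) \<le> w t * g t" for t
      using fg[of t] w_pos[of t] by (simp only: real_norm_def abs_mult[of "w t"] abs_of_pos mult_left_mono less_imp_le)
    have sg: "(\<lambda>t. w t * g t) summable_on UNIV" using g by (rule has_sum_imp_summable)
    have "(\<lambda>t. w t * (of_bool (LIS t = Suc k) * f t)) summable_on UNIV"
      by (rule abs_summable_summable[OF Infinite_Sum.abs_summable_on_comparison_test'[OF sg le]])
    then have "norm I \<le> infsum (\<lambda>t. w t * g t) UNIV"
      unfolding I_def infsum_LIS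
      by (intro norm_infsum_le[OF has_sum_infsum has_sum_infsum] sg le)
    then show ?thesis using infsumI[OF g] by simp
  qed
  moreover have "\<bar>cond_expect p (Suc k) f\<bar> * E 0 (Suc k) = \<bar>I\<bar>"
    using E0_pos[of k] by (simp add: cond_expect_def E0 I_def abs_divide)
  ultimately show ?thesis by (simp add: n_def)
qed

lemma cond_expect_bound:
  "\<exists>K e. 0 < e \<and> (\<forall>k>0. \<bar>cond_expect p k (\<lambda>t. \<bar>real (card (Lmax_cap t)) / real k - alpha p\<bar>)\<bar> \<le> K * real k powr (- e))"
proof -
  obtain K e where Ke: "0 < K" "0 < e" "\<And>k. E 2 (Suc k) - 2 * alpha p * real (Suc k) * E 1 (Suc k)
    + (alpha p * real (Suc k))\<^sup>2 * E 0 (Suc k) \<le> K * real (Suc k) powr (2 - e) * E 0 (Suc k)"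
    using variance_bound by blast
  have "\<bar>cond_expect p (Suc k) (\<lambda>t. \<bar>real (card (Lmax_cap t)) / real (Suc k) - alpha p\<bar>)\<bar>
      \<le> (1 + K) / 2 * real (Suc k) powr (- (e / 2))" for k
  proof -
    define n where "n = real (Suc k)"
    have n: "n > 0" by (simp add: n_def)
    define r where "r = n powr (- (e / 2))"
    have r: "r > 0" using n by (simp add: r_def)
    define V where "V = E 2 (Suc k) - 2 * alpha p * n * E 1 (Suc k) + (alpha p * n)\<^sup>2 * E 0 (Suc k)"
    let ?c = "\<bar>cond_expect p (Suc k) (\<lambda>t. \<bar>real (card (Lmax_cap t)) / n - alpha p\<bar>)\<bar>"
    \<comment> \<open>Stands in for the Cauchy-Schwarz inequality: \<open>r\<close> has the size of
      the bound on the standard deviation of \<open>N / n\<close>, which balances both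
      terms.\<close>
    have amgm: "\<bar>y\<bar> \<le> r / 2 + 1 / (2 * r) * y\<^sup>2" for y :: real
    proof -
      have "0 \<le> (\<bar>y\<bar> - r)\<^sup>2" by simp
      then have "2 * r * \<bar>y\<bar> \<le> r\<^sup>2 + y\<^sup>2" by (simp add: power2_diff mult_ac)
      then show ?thesis using r by (simp add: field_simps power2_eq_square)
    qed
    have "?c * E 0 (Suc k) \<le> r / 2 * E 0 (Suc k) + 1 / (2 * r) / n\<^sup>2 * V"
      unfolding V_def n_def by (rule cond_expect_le) (use amgm in \<open>simp add: N_def n_def\<close>)
    also have "1 / (2 * r) / n\<^sup>2 * V \<le> 1 / (2 * r) / n\<^sup>2 * (K * n powr (2 - e) * E 0 (Suc k))"
      using Ke(3)[of k] r unfolding V_def n_def by (intro mult_left_mono) auto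
    also have "n powr (2 - e) = n\<^sup>2 * (r * r)"
    proof -
      have "n powr (2 - e) = n powr 2 * (n powr (- (e / 2)) * n powr (- (e / 2)))"
        unfolding powr_add[symmetric] by simp
      then show ?thesis using n by (simp add: r_def)
    qed
    also have "r / 2 * E 0 (Suc k) + 1 / (2 * r) / n\<^sup>2 * (K * (n\<^sup>2 * (r * r)) * E 0 (Suc k)) = (1 + K) / 2 * r * E 0 (Suc k)"
      using n r by (simp add: field_simps)
    finally have "?c \<le> (1 + K) / 2 * r" using E0_pos[of k] by (simp only: mult_le_cancel_right_pos)
    then show ?thesis by (simp add: r_def n_def)
  qed
  then have "\<forall>k>0. \<bar>cond_expect p k (\<lambda>t. \<bar>real (card (Lmax_cap t)) / real k - alpha p\<bar>)\<bar> \<le> (1 + K) / 2 * real k powr (- (e / 2))"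
    by (metis gr0_implies_Suc)
  then show ?thesis using Ke by (intro exI[of _ "(1 + K) / 2"] exI[of _ "e / 2"]) auto
qed

end

theorem theorem9p1:
  fixes p :: real
  assumes "0 < p" and "p < 1"
  shows "\<exists>\<epsilon>>0. (\<lambda>k. cond_expect p k
            (\<lambda>t. \<bar>real (card (Lmax_cap t)) / real k - alpha p\<bar>))
          \<in> O(\<lambda>k. real k powr (- \<epsilon>))"
proof -
  interpret bgw p using assms by unfold_locales
  obtain K e where "0 < e" and bound: "\<And>k. k > 0 \<Longrightarrow>
      \<bar>cond_expect p k (\<lambda>t. \<bar>real (card (Lmax_cap t)) / real k - alpha p\<bar>)\<bar> \<le> K * real k powr (- e)"
    using cond_expect_bound by blast
  have "(\<lambda>k. cond_expect p k (\<lambda>t. \<bar>real (card (Lmax_cap t)) / real k - alpha p\<bar>)) \<in> O(\<lambda>k. real k powr (- e))"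
    using bound by (intro bigoI[of _ K] eventually_mono[OF eventually_gt_at_top[of 0]]) auto
  then show ?thesis using \<open>0 < e\<close> by blast
qed

end
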